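(* Let $j\in\{1,\ldots,d\}$ be fixed and let $\alpha=(\alpha_1,\ldots,\alpha_d)$ satisfy $\alpha_j>-3/2$ and $\alpha_i>-1$ for $i\ne j$. If $\alpha_j\ge-1/2$, then $\{\widetilde T_t^{\alpha,\widehat L,j}\}_{t\ge0}$ is a submarkovian (but not Markovian) symmetric diffusion semigroup on $(\mathbb{R}_+^d,m_\alpha)$ satisfying, for each $1\le p\le\infty$, $$\|\widetilde T_t^{\alpha,\widehat L,j}\|_{p\to p}\le e^{-t/2},\qquad t>0.$$ If $\alpha_j<-1/2$, then $\{\widetilde T_t^{\alpha,\widehat L,j}\}_{t\ge0}$ is not an $L^p$-contractive semigroup, but there exists a constant $c=c(\alpha)>1$ such that, for each $1\le p\le\infty$, $$\|\widetilde T_t^{\alpha,\widehat L,j}\|_{p\to p}\le c\,e^{-t/2},\qquad t>0.$$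
   Context: Notation: $d\ge 1$, $\mathbb{R}_+=(0,\infty)$, $dm_\alpha(x)=\big(\prod_{i=1}^d x_i^{\alpha_i}e^{-x_i}\big)dx$ on $\mathbb{R}_+^d$, $L^p=L^p(\mathbb{R}_+^d,m_\alpha)$, $\|\cdot\|_{p\to p}$ is the operator norm on $L^p$, $\mathbf 1$ is the constant function $1$, $e_j$ is the $j$th coordinate vector, and $I_\nu$ is the modified Bessel function of the first kind of order $\nu$. The semigroup. For $\gamma=(\gamma_1,\ldots,\gamma_d)\in(-1,\infty)^d$, with $|\gamma|=\gamma_1+\ldots+\gamma_d$, $t>0$ and $x,y\in\mathbb{R}_+^d$, the Laguerre polynomial heat kernel is $$G_t^{\gamma,\widehat L}(x,y)=\frac{e^{t(|\gamma|+d)/2}}{(2\sinh(t/2))^d}\exp\Big(-\frac{e^{-t/2}}{2\sinh(t/2)}\sum_{i=1}^d(x_i+y_i)\Big)\prod_{i=1}^d(x_iy_i)^{-\gamma_i/2}I_{\gamma_i}\Big(\frac{\sqrt{x_iy_i}}{\sinh(t/2)}\Big).$$ The modified Laguerre polynomial semigroup is given on all $L^p(\mathbb{R}_+^d,m_\alpha)$, $1\le p\le\infty$, by $$\widetilde T_t^{\alpha,\widehat L,j}f(x)=e^{-t}\int_{\mathbb{R}_+^d}\sqrt{x_jy_j}\,G_t^{\alpha+e_j,\widehat L}(x,y)f(y)\,dm_\alpha(y),\quad x\in\mathbb{R}_+^d,\ t>0,$$ and $\widetilde T_0^{\alpha,\widehat L,j}=\mathrm{Id}$. On $L^2$ it is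 the semigroup generated by a suitable self-adjoint extension of $-\sum_{i=1}^d\big(x_i\partial_{x_i}^2+(\alpha_i+1-x_i)\partial_{x_i}\big)+\frac{\alpha_j+1/2+x_j}{2x_j}$. Definitions. On a $\sigma$-finite measure space $(X,\mu)$, a symmetric diffusion semigroup is a family of linear operators $\{T_t\}_{t\ge0}$, $T_0=\mathrm{Id}$, mapping a linear subspace of the measurable functions that contains all $L^p(X,\mu)$, $1\le p\le\infty$ (e.g. $L^1+L^\infty$) into measurable functions, such that: (i) for each $1\le p\le\infty$ every $T_t$ is a contraction on $L^p$ and $\{T_t\}_{t\ge0}$ is a semigroup there; (ii) each $T_t$ is self-adjoint on $L^2$; (iii) $\lim_{t\to0^+}T_tf=f$ in $L^2$ for each $f\in L^2$. It is Markovian if in addition (iv) $T_tf\ge0$ whenever $f\ge0$, for all $t$, and (v) $T_t\mathbf 1=\mathbf 1$ for all $t$. It is submarkovian if (i)-(iv) hold and (v') $T_t\mathbf 1\le\mathbf 1$ for all $t$. A semigroup $\{T_t\}_{t\ge 0}=\{\exp(-tL)\}_{t\ge0}$ generated by a positive self-adjoint operator $L$ on $L^2(X,\mu)$ is called $L^p$-contractive if $\|T_tf\|_p\le\|f\|_p$ for all $1\le p\le\infty$, all $t\ge0$ and all $f\in L^2\cap L^p(X,\mu)$. *)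

theory Defs
  imports "HOL-Analysis.Analysis" "HOL-Probability.Essential_Supremum"
begin

section \<open>Real $L^p$ spaces and operators on them\<close>

text \<open>
  The exponent ranges over \<^typ>\<open>ennreal\<close>, with \<^term>\<open>\<infinity> :: ennreal\<close> included. Functions are
  real-valued representatives; equality in $L^p$ is equality almost everywhere.
\<close>

definition Lp_norm :: "'a measure \<Rightarrow> ennreal \<Rightarrow> ('a \<Rightarrow> real) \<Rightarrow> ennreal" where
  "Lp_norm M p f =
    (if p = \<infinity> then esssup M (\<lambda>x. ennreal \<bar>f x\<bar>)
     else let I = (\<integral>\<^sup>+x. ennreal (\<bar>f x\<bar> powr enn2real p) \<partial>M)
          in if I = \<infinity> then \<infinity> else ennreal (enn2real I powr (1 / enn2real p)))"

definition Lp :: "'a measure \<Rightarrow> ennreal \<Rightarrow> ('a \<Rightarrow> real) set" where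
  "Lp M p = {f \<in> borel_measurable M. Lp_norm M p f < \<infinity>}"

text \<open>
  \<open>D\<close> is the domain of the operator: a linear space of measurable functions containing
  every $L^p$. Operators act on representatives, so compatibility with equality almost everywhere
  is part of the definition.
\<close>

definition operator_domain :: "'a measure \<Rightarrow> ('a \<Rightarrow> real) set \<Rightarrow> bool" where
  "operator_domain M D \<longleftrightarrow>
     D \<subseteq> borel_measurable M \<and>
     (\<forall>f\<in>D. \<forall>g\<in>D. \<forall>a b. (\<lambda>x. a * f x + b * g x) \<in> D) \<and>
     (\<forall>p\<ge>1. Lp M p \<subseteq> D)"

definition linear_operator ::
  "'a measure \<Rightarrow> ('a \<Rightarrow> real) set \<Rightarrow> (('a \<Rightarrow> real) \<Rightarrow> 'a \<Rightarrow> real) \<Rightarrow> bool" where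
  "linear_operator M D S \<longleftrightarrow>
     operator_domain M D \<and>
     (\<forall>f\<in>D. S f \<in> borel_measurable M) \<and>
     (\<forall>f\<in>D. \<forall>g\<in>D. (AE x in M. f x = g x) \<longrightarrow> (AE x in M. S f x = S g x)) \<and>
     (\<forall>f\<in>D. \<forall>g\<in>D. \<forall>a b. AE x in M. S (\<lambda>y. a * f y + b * g y) x = a * S f x + b * S g x)"

text \<open>
  The operator norm on $L^p$. It is set to \<^term>\<open>\<infinity> :: ennreal\<close> unless \<open>S\<close> is a linear operator
  on \<open>D\<close>; hence a finite bound on it also says that \<open>S\<close> is defined, linear and bounded on
  all of $L^p$.
\<close>

definition op_norm ::
  "'a measure \<Rightarrow> ('a \<Rightarrow> real) set \<Rightarrow> ennreal \<Rightarrow> (('a \<Rightarrow> real) \<Rightarrow> 'a \<Rightarrow> real) \<Rightarrow> ennreal" where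
  "op_norm M D p S =
    (if linear_operator M D S
     then (SUP f\<in>{f \<in> Lp M p. Lp_norm M p f \<le> 1}. Lp_norm M p (S f))
     else \<infinity>)"

section \<open>Symmetric diffusion semigroups\<close>

definition symmetric_diffusion_semigroup ::
  "'a measure \<Rightarrow> ('a \<Rightarrow> real) set \<Rightarrow> (real \<Rightarrow> ('a \<Rightarrow> real) \<Rightarrow> 'a \<Rightarrow> real) \<Rightarrow> bool" where
  "symmetric_diffusion_semigroup M D T \<longleftrightarrow>
     sigma_finite_measure M \<and>
     (\<forall>t\<ge>0. linear_operator M D (T t)) \<and>
     (\<forall>f\<in>D. AE x in M. T 0 f x = f x) \<and>
     (\<forall>p\<ge>1. \<forall>t\<ge>0. op_norm M D p (T t) \<le> 1) \<and>
     (\<forall>p\<ge>1. \<forall>f\<in>Lp M p. \<forall>s\<ge>0. \<forall>t\<ge>0. AE x in M. T (s + t) f x = T s (T t f) x) \<and>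
     (\<forall>t\<ge>0. \<forall>f\<in>Lp M 2. \<forall>g\<in>Lp M 2. (LINT x|M. T t f x * g x) = (LINT x|M. f x * T t g x)) \<and>
     (\<forall>f\<in>Lp M 2. ((\<lambda>t. Lp_norm M 2 (\<lambda>x. T t f x - f x)) \<longlongrightarrow> 0) (at_right 0))"

definition positive_operators ::
  "'a measure \<Rightarrow> ('a \<Rightarrow> real) set \<Rightarrow> (real \<Rightarrow> ('a \<Rightarrow> real) \<Rightarrow> 'a \<Rightarrow> real) \<Rightarrow> bool" where
  "positive_operators M D T \<longleftrightarrow>
     (\<forall>t\<ge>0. \<forall>f\<in>D. (AE x in M. 0 \<le> f x) \<longrightarrow> (AE x in M. 0 \<le> T t f x))"

definition markovian_semigroup ::
  "'a measure \<Rightarrow> ('a \<Rightarrow> real) set \<Rightarrow> (real \<Rightarrow> ('a \<Rightarrow> real) \<Rightarrow> 'a \<Rightarrow> real) \<Rightarrow> bool" where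
  "markovian_semigroup M D T \<longleftrightarrow>
     symmetric_diffusion_semigroup M D T \<and> positive_operators M D T \<and>
     (\<forall>t\<ge>0. AE x in M. T t (\<lambda>_. 1) x = 1)"

definition submarkovian_semigroup ::
  "'a measure \<Rightarrow> ('a \<Rightarrow> real) set \<Rightarrow> (real \<Rightarrow> ('a \<Rightarrow> real) \<Rightarrow> 'a \<Rightarrow> real) \<Rightarrow> bool" where
  "submarkovian_semigroup M D T \<longleftrightarrow>
     symmetric_diffusion_semigroup M D T \<and> positive_operators M D T \<and>
     (\<forall>t\<ge>0. AE x in M. T t (\<lambda>_. 1) x \<le> 1)"

text \<open>
  The property by which a semigroup $\exp(-tL)$, with $L$ positive and self-adjoint on $L^2$, is
  called $L^p$-contractive. That the family is such a semigroup is not made a conjunct, so that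
  the negation of this predicate denies the inequality itself.
\<close>

definition Lp_contractive ::
  "'a measure \<Rightarrow> (real \<Rightarrow> ('a \<Rightarrow> real) \<Rightarrow> 'a \<Rightarrow> real) \<Rightarrow> bool" where
  "Lp_contractive M T \<longleftrightarrow>
     (\<forall>p\<ge>1. \<forall>t\<ge>0. \<forall>f \<in> Lp M 2 \<inter> Lp M p. T t f \<in> Lp M p \<and> Lp_norm M p (T t f) \<le> Lp_norm M p f)"

section \<open>The modified Laguerre polynomial semigroup\<close>

text \<open>
  Power series of the modified Bessel function of the first kind $I_\nu(z)$ for $z > 0$;
  \<^const>\<open>rGamma\<close> is the reciprocal Gamma function, with value $0$ at the poles of Gamma.
\<close>

definition bessel_I :: "real \<Rightarrow> real \<Rightarrow> real" where
  "bessel_I \<nu> z = (\<Sum>k. (z / 2) powr (2 * real k + \<nu>) * rGamma (real k + \<nu> + 1) / fact k)"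

definition pos_orthant :: "(real ^ 'n) set" where
  "pos_orthant = {x. \<forall>i. 0 < x $ i}"

definition laguerre_measure :: "real ^ 'n \<Rightarrow> (real ^ 'n) measure" where
  "laguerre_measure \<alpha> =
     density (restrict_space lborel pos_orthant)
       (\<lambda>x. ennreal (\<Prod>i\<in>UNIV. x $ i powr (\<alpha> $ i) * exp (- (x $ i))))"

definition laguerre_kernel :: "real ^ 'n \<Rightarrow> real \<Rightarrow> real ^ 'n \<Rightarrow> real ^ 'n \<Rightarrow> real" where
  "laguerre_kernel \<gamma> t x y =
     exp (t * ((\<Sum>i\<in>UNIV. \<gamma> $ i) + real CARD('n)) / 2) / (2 * sinh (t / 2)) ^ CARD('n)
     * exp (- (exp (- t / 2) / (2 * sinh (t / 2))) * (\<Sum>i\<in>UNIV. x $ i + y $ i))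
     * (\<Prod>i\<in>UNIV. (x $ i * y $ i) powr (- \<gamma> $ i / 2)
                    * bessel_I (\<gamma> $ i) (sqrt (x $ i * y $ i) / sinh (t / 2)))"

definition modified_laguerre_semigroup ::
  "real ^ 'n \<Rightarrow> 'n \<Rightarrow> real \<Rightarrow> (real ^ 'n \<Rightarrow> real) \<Rightarrow> real ^ 'n \<Rightarrow> real" where
  "modified_laguerre_semigroup \<alpha> j t f =
     (if t = 0 then f
      else (\<lambda>x. exp (- t) *
              (LINT y|laguerre_measure \<alpha>.
                 sqrt (x $ j * y $ j) * laguerre_kernel (\<alpha> + axis j 1) t x y * f y)))"

text \<open>
  The functions for which all the defining integrals converge absolutely. Since a non-convergent
  Bochner integral has value $0$ here, taking this set as the domain is what makes statements
  about the operators on $L^p$ include the convergence of the integrals.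
\<close>

definition modified_laguerre_domain :: "real ^ 'n \<Rightarrow> 'n \<Rightarrow> (real ^ 'n \<Rightarrow> real) set" where
  "modified_laguerre_domain \<alpha> j =
     {f \<in> borel_measurable (laguerre_measure \<alpha>).
        \<forall>t>0. \<forall>x\<in>pos_orthant.
          integrable (laguerre_measure \<alpha>)
            (\<lambda>y. sqrt (x $ j * y $ j) * laguerre_kernel (\<alpha> + axis j 1) t x y * f y)}"

end

theory Submission
  imports Defs
begin

text \<open>
  With \<open>q = exp (-t)\<close> the Laguerre heat kernel is a product of one-dimensional kernels, each of which is,
  in \<open>y\<close>, a Poisson mixture of Gamma densities. Termwise integration reduces the Chapman-Kolmogorov
  identity to a Vandermonde convolution. It also gives the row mass of the modified kernel: with
  \<open>\<nu> = \<alpha>\<^sub>j + 1\<close> and \<open>\<mu> = q x\<^sub>j / (1 - q)\<close> it equals \<open>exp (-t/2)\<close> times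
  \<open>sqrt (\<mu>/\<pi>) \<integral>\<^sub>0\<^sup>1 u\<^sup>-\<^sup>1\<^sup>/\<^sup>2 (1 - u)\<^sup>\<nu>\<^sup>-\<^sup>1\<^sup>/\<^sup>2 exp (-\<mu> u) du\<close>.
  For \<open>\<nu> \<ge> 1/2\<close> dropping the factor \<open>(1 - u)\<^sup>\<nu>\<^sup>-\<^sup>1\<^sup>/\<^sup>2 \<le> 1\<close> bounds this by \<open>1\<close>; for \<open>\<nu> < 1/2\<close> it stays bounded
  but exceeds \<open>1\<close> for large \<open>\<mu>\<close>, and small \<open>t\<close> together with \<open>x\<^sub>j\<close> proportional to \<open>1 - q\<close>
  violates contractivity on \<open>L\<^sup>\<infinity>\<close>. As the kernel is symmetric, the row bound gives every
  \<open>L\<^sup>p\<close> bound by Jensen's inequality. Strong continuity on \<open>L\<^sup>2\<close> is transported from the Markovian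
  Laguerre semigroup with parameter \<open>\<alpha> + e\<^sub>j\<close> by the unitary map \<open>f \<mapsto> f / sqrt x\<^sub>j\<close>.
\<close>

section \<open>Bessel series and Gamma integrals\<close>

text \<open>The hypotheses allow \<open>\<alpha> $ j\<close> to be at most -1. Then
  \<open>laguerre_measure \<alpha>\<close> is infinite and the constant 1 is not in L^2, whereas all
  entries of \<open>\<alpha> + axis j 1\<close> exceed -1 and the shifted measure is finite. The
  arguments that require finite mass or conserved mass are therefore carried out for the shifted
  parameter. In the modified kernel, kernel and measure disagree in coordinate j only, and the
  weight sqrt y_j repairs half of the disagreement. The other half leaves the Gamma quotients and
  the factor q x_j^(1/2) (1 - q)^(-1/2), which equals q^(1/2) times the square root of \<mu>; hence
  the rate exp (-t/2). Kernels are summed and integrated in \<open>ennreal\<close>, where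
  interchanges cost only nonnegativity and measurability; Bochner integrals enter with the
  operators. For \<nu> < 1/2 the excess over 1 comes from (1 - u)^(\<nu> - 1/2) \<ge> 1 + (1/2 -
  \<nu>) u. It is of order 1/\<mu>, while cutting the integral at u = 1 costs only an exponentially
  small amount.\<close>

lemma suminf_swap_ennreal:
  fixes f :: "nat \<Rightarrow> nat \<Rightarrow> ennreal"
  shows "(\<Sum>i. \<Sum>j. f i j) = (\<Sum>j. \<Sum>i. f i j)"
proof -
  have "(\<Sum>i. \<Sum>j. f i j) = (\<integral>\<^sup>+i. (\<Sum>j. f i j) \<partial>count_space UNIV)"
    by (simp add: nn_integral_count_space_nat)
  also have "\<dots> = (\<Sum>j. \<integral>\<^sup>+i. f i j \<partial>count_space UNIV)"
    by (intro nn_integral_suminf) auto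
  also have "\<dots> = (\<Sum>j. \<Sum>i. f i j)"
    by (simp add: nn_integral_count_space_nat)
  finally show ?thesis .
qed

lemma suminf_shift_ennreal:
  fixes h :: "nat \<Rightarrow> ennreal"
  shows "(\<Sum>k. if m \<le> k then h (k - m) else 0) = (\<Sum>i. h i)"
  by (subst suminf_offset[where i = m]) auto

text \<open>The substitution i = k - m, j = l - m on the triples with m at most k and l. It lets the
  double series of the Chapman-Kolmogorov integral separate into three independent sums.\<close>

lemma suminf_reindex_common_part:
  fixes F :: "nat \<Rightarrow> nat \<Rightarrow> nat \<Rightarrow> ennreal"
  shows "(\<Sum>k. \<Sum>l. \<Sum>m\<le>k. if m \<le> l then F m (k - m) (l - m) else 0)
       = (\<Sum>m. \<Sum>i. \<Sum>j. F m i j)"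
proof -
  have "(\<Sum>m\<le>k. if m \<le> l then F m (k - m) (l - m) else 0)
      = (\<Sum>m. if m \<le> k then (if m \<le> l then F m (k - m) (l - m) else 0) else 0)" for k l
    by (subst suminf_finite[of "{..k}"]) auto
  then have "(\<Sum>k. \<Sum>l. \<Sum>m\<le>k. if m \<le> l then F m (k - m) (l - m) else 0)
     = (\<Sum>k. \<Sum>l. \<Sum>m. if m \<le> k then (if m \<le> l then F m (k - m) (l - m) else 0) else 0)"
    by simp
  also have "\<dots> = (\<Sum>k. \<Sum>m. \<Sum>l. if m \<le> k then (if m \<le> l then F m (k - m) (l - m) else 0) else 0)"
    by (intro suminf_cong suminf_swap_ennreal)
  also have "\<dots> = (\<Sum>m. \<Sum>k. \<Sum>l. if m \<le> k then (if m \<le> l then F m (k - m) (l - m) else 0) else 0)"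
    by (rule suminf_swap_ennreal)
  also have "\<dots> = (\<Sum>m. \<Sum>k. if m \<le> k then (\<Sum>l. if m \<le> l then F m (k - m) (l - m) else 0) else 0)"
    by (intro suminf_cong) auto
  also have "\<dots> = (\<Sum>m. \<Sum>i. \<Sum>j. F m i j)"
  proof (rule suminf_cong)
    fix m
    have "(\<Sum>k. if m \<le> k then (\<Sum>l. if m \<le> l then F m (k - m) (l - m) else 0) else 0)
        = (\<Sum>k. if m \<le> k then (\<lambda>i. \<Sum>j. F m i j) (k - m) else 0)"
      using suminf_shift_ennreal[of m "\<lambda>j. F m _ j"] by (intro suminf_cong) simp
    also have "\<dots> = (\<Sum>i. \<Sum>j. F m i j)"
      by (rule suminf_shift_ennreal)
    finally show "(\<Sum>k. if m \<le> k then (\<Sum>l. if m \<le> l then F m (k - m) (l - m) else 0) else 0)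
       = (\<Sum>i. \<Sum>j. F m i j)" .
  qed
  finally show ?thesis .
qed

text \<open>Vandermonde's convolution for l + (k + \<nu>) over k, with the binomials written as
  Gamma quotients; the condition m \<le> l records that l choose m vanishes beyond l. The factor
  coupling k and l becomes a sum of products of functions of k - m, l - m and m.\<close>

lemma Gamma_quotient_Vandermonde:
  fixes \<nu> :: real
  assumes "\<nu> > -1"
  shows "Gamma (real k + real l + \<nu> + 1) /
      (fact k * Gamma (real k + \<nu> + 1) * (fact l * Gamma (real l + \<nu> + 1)))
    = (\<Sum>m\<le>k. if m \<le> l then 1 / (fact (k - m) * fact (l - m) * (fact m * Gamma (real m + \<nu> + 1))) else 0)"
proof -
  have G: "Gamma (real n + \<nu> + 1) > 0" for n
    using assms by (intro Gamma_real_pos) simp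
  have np: "x \<notin> \<int>\<^sub>\<le>\<^sub>0" if "x > 0" for x :: real
    using that by (auto dest: nonpos_Ints_nonpos)
  have 1: "(real l + (real k + \<nu>)) gchoose k = Gamma (real k + real l + \<nu> + 1) / (fact k * Gamma (real l + \<nu> + 1))"
    using assms by (subst gbinomial_Gamma) (auto intro!: np simp: algebra_simps)
  have 2: "(real k + \<nu>) gchoose (k - m) = Gamma (real k + \<nu> + 1) / (fact (k - m) * Gamma (real m + \<nu> + 1))"
    if "m \<le> k" for m
    using assms that by (subst gbinomial_Gamma) (auto intro!: np simp: algebra_simps of_nat_diff)
  have 3: "real l gchoose m = (if m \<le> l then fact l / (fact m * fact (l - m)) else 0)" for m
    by (auto simp: binomial_gbinomial[symmetric] binomial_fact binomial_eq_0)
  have "(real l + (real k + \<nu>)) gchoose k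
      = (\<Sum>m\<le>k. (real l gchoose m) * ((real k + \<nu>) gchoose (k - m)))"
    by (subst gbinomial_Vandermonde[symmetric]) (simp add: atMost_atLeast0)
  also have "\<dots> = fact l * Gamma (real k + \<nu> + 1) *
      (\<Sum>m\<le>k. if m \<le> l then 1 / (fact (k - m) * fact (l - m) * (fact m * Gamma (real m + \<nu> + 1))) else 0)"
    unfolding sum_distrib_left by (intro sum.cong) (auto simp: 2 3 mult_ac)
  finally show ?thesis
    unfolding 1 using G[of k] G[of l] by (simp add: field_simps)
qed

lemma nn_integral_Gamma_scaled:
  assumes "b > 0" "p > (0::real)"
  shows "(\<integral>\<^sup>+x. ennreal (indicator {0<..} x * (x powr (b - 1) * exp (- (p * x)))) \<partial>lborel)
    = ennreal (Gamma b / p powr b)"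
proof -
  let ?I = "\<integral>\<^sup>+x. ennreal (indicator {0<..} x * (x powr (b - 1) * exp (- (p * x)))) \<partial>lborel"
  let ?f = "\<lambda>x::real. ennreal (indicator {0..} x * x powr (b - 1) / exp x)"
  have "ennreal (Gamma b) = (\<integral>\<^sup>+x. ?f x \<partial>lborel)"
    using assms by (simp add: Gamma_conv_nn_integral_real)
  also have "\<dots> = ennreal p * (\<integral>\<^sup>+x. ?f (p * x) \<partial>lborel)"
    using nn_integral_real_affine[of ?f p 0] assms by simp
  also have "(\<integral>\<^sup>+x. ?f (p * x) \<partial>lborel)
     = (\<integral>\<^sup>+x. ennreal (p powr (b - 1)) * ennreal (indicator {0<..} x * (x powr (b - 1) * exp (- (p * x)))) \<partial>lborel)"
    using assms
    by (intro nn_integral_cong)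
       (auto simp: ennreal_mult[symmetric] powr_mult exp_minus field_simps indicator_def zero_le_mult_iff
         intro!: arg_cong[where f=ennreal])
  also have "\<dots> = ennreal (p powr (b - 1)) * ?I"
    by (rule nn_integral_cmult) measurable
  finally have *: "ennreal (Gamma b) = ennreal (p powr b) * ?I"
    using assms by (simp add: mult.assoc[symmetric] ennreal_mult[symmetric] powr_diff)
  have "ennreal (Gamma b / p powr b) = ennreal (1 / p powr b) * ennreal (Gamma b)"
    using assms by (simp add: ennreal_mult[symmetric] Gamma_real_nonneg)
  also have "\<dots> = ?I"
    unfolding * using assms by (simp add: mult.assoc[symmetric] ennreal_mult[symmetric])
  finally show ?thesis ..
qed

text \<open>For z > 0 this is z^(-\<nu>/2) I_\<nu>(2 sqrt z), the entire part of the Bessel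
  function. Without the fractional power every term is a monomial, ready for termwise
  integration.\<close>

definition bessel_series :: "real \<Rightarrow> real \<Rightarrow> real" where
  "bessel_series \<nu> z = (\<Sum>k. z ^ k / (fact k * Gamma (real k + \<nu> + 1)))"

text \<open>The Gamma function outgrows every geometric sequence: from \<open>N\<close> on the ratio
  c / (n + \<nu> + 1) is at most 1/2. The free constant serves twice, as c = 1 for convergence and
  as c = 1/\<epsilon> for growth control.\<close>

lemma bessel_coeff_bounded:
  assumes "\<nu> > -1" "c > 0"
  obtains B where "B > 0" "\<And>k. c ^ k / Gamma (real k + \<nu> + 1) \<le> B"
proof -
  have G: "Gamma (real n + \<nu> + 1) > 0" for n
    using assms by (intro Gamma_real_pos) simp
  define N where "N = nat \<lceil>2 * c + 2\<rceil>"
  have N: "real n \<ge> 2 * c + 2" if "n \<ge> N" for n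
    using that unfolding N_def by linarith
  have "summable (\<lambda>k. c ^ k / Gamma (real k + \<nu> + 1))"
  proof (rule summable_ratio_test[of "1/2" N])
    fix n assume n: "n \<ge> N"
    have "real n + \<nu> + 1 > 0" using assms by simp
    then have *: "Gamma (real (Suc n) + \<nu> + 1) = (real n + \<nu> + 1) * Gamma (real n + \<nu> + 1)"
      using Gamma_plus1[of "real n + \<nu> + 1"] nonpos_Ints_nonpos[of "real n + \<nu> + 1"]
      by (metis add.assoc add.commute not_le of_nat_Suc)
    have "c / (real n + \<nu> + 1) \<le> 1 / 2"
      using N[OF n] assms by (simp add: field_simps)
    then have "c / (real n + \<nu> + 1) * (c ^ n / Gamma (real n + \<nu> + 1)) \<le> 1 / 2 * (c ^ n / Gamma (real n + \<nu> + 1))"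
      using G[of n] assms by (intro mult_right_mono) auto
    then show "norm (c ^ Suc n / Gamma (real (Suc n) + \<nu> + 1)) \<le> 1 / 2 * norm (c ^ n / Gamma (real n + \<nu> + 1))"
      unfolding * using G[of n] assms by (simp add: abs_mult)
  qed simp
  then have "Bseq (\<lambda>k. c ^ k / Gamma (real k + \<nu> + 1))"
    by (intro convergent_imp_Bseq summable_LIMSEQ_zero[THEN convergentI])
  then obtain B where "B > 0" "\<And>k. norm (c ^ k / Gamma (real k + \<nu> + 1)) \<le> B"
    by (auto elim: BseqE)
  then show ?thesis
    by (intro that[of B]) (auto simp del: norm_divide intro: order_trans[OF abs_ge_self] simp flip: real_norm_def)
qed

lemma summable_bessel_series:
  assumes "\<nu> > -1" "z \<ge> 0"
  shows "summable (\<lambda>k. z ^ k / (fact k * Gamma (real k + \<nu> + 1)))"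
proof -
  have G: "Gamma (real n + \<nu> + 1) > 0" for n
    using assms by (intro Gamma_real_pos) simp
  obtain B where B: "B > 0" "\<And>k. 1 ^ k / Gamma (real k + \<nu> + 1) \<le> B"
    using bessel_coeff_bounded[OF assms(1), of 1] by auto
  show ?thesis
  proof (rule summable_comparison_test')
    show "summable (\<lambda>k. B * (z ^ k /\<^sub>R fact k))"
      by (intro summable_mult summable_exp_generic)
    fix n
    have "z ^ n / fact n * (1 / Gamma (real n + \<nu> + 1)) \<le> z ^ n / fact n * B"
      using B(2)[of n] assms by (intro mult_left_mono) auto
    then show "norm (z ^ n / (fact n * Gamma (real n + \<nu> + 1))) \<le> B * (z ^ n /\<^sub>R fact n)"
      using G[of n] assms by (simp add: field_simps)
  qed
qed

lemma bessel_series_ennreal: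
  assumes "\<nu> > -1" "z \<ge> 0"
  shows "ennreal (bessel_series \<nu> z) = (\<Sum>k. ennreal (z ^ k / (fact k * Gamma (real k + \<nu> + 1))))"
  unfolding bessel_series_def using assms
  by (intro suminf_ennreal2[symmetric] summable_bessel_series) (auto intro!: divide_nonneg_nonneg mult_nonneg_nonneg Gamma_real_nonneg)

lemma bessel_series_nonneg:
  assumes "\<nu> > -1" "z \<ge> 0"
  shows "bessel_series \<nu> z \<ge> 0"
  unfolding bessel_series_def using assms
  by (intro suminf_nonneg summable_bessel_series) (auto intro!: divide_nonneg_nonneg mult_nonneg_nonneg Gamma_real_nonneg)

text \<open>Compare with the series of exp (\<epsilon> z): the quotient of the coefficients is
  (1/\<epsilon>)^k / Gamma (k + \<nu> + 1), which is bounded. Arbitrarily small \<epsilon> lets the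
  exponential decay of the kernel win in \<open>laguerre_kernel1_bounded\<close>.\<close>

lemma bessel_series_le_exp:
  assumes "\<nu> > -1" "\<epsilon> > 0"
  obtains B where "B > 0" "\<And>z. z \<ge> 0 \<Longrightarrow> bessel_series \<nu> z \<le> B * exp (\<epsilon> * z)"
proof -
  obtain B where B: "B > 0" "\<And>k. (1 / \<epsilon>) ^ k / Gamma (real k + \<nu> + 1) \<le> B"
    using bessel_coeff_bounded[OF assms(1), of "1/\<epsilon>"] assms by auto
  have "bessel_series \<nu> z \<le> B * exp (\<epsilon> * z)" if "z \<ge> 0" for z
    unfolding bessel_series_def exp_def suminf_mult[OF summable_exp_generic, symmetric]
  proof (intro suminf_le summable_bessel_series summable_mult summable_exp_generic)
    fix k
    have "(\<epsilon> * z) ^ k / fact k * ((1 / \<epsilon>) ^ k / Gamma (real k + \<nu> + 1)) \<le> (\<epsilon> * z) ^ k / fact k * B"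
      using B(2)[of k] assms that by (intro mult_left_mono) auto
    moreover have "(\<epsilon> * z) ^ k / fact k * ((1 / \<epsilon>) ^ k / Gamma (real k + \<nu> + 1)) = z ^ k / (fact k * Gamma (real k + \<nu> + 1))"
      using assms by (simp add: power_mult_distrib power_divide)
    ultimately show "z ^ k / (fact k * Gamma (real k + \<nu> + 1)) \<le> B * ((\<epsilon> * z) ^ k /\<^sub>R fact k)"
      by (simp add: field_simps)
  qed (use assms that in auto)
  with B(1) show ?thesis by (rule that)
qed

lemma borel_measurable_bessel_series[measurable]: "bessel_series \<nu> \<in> borel_measurable borel"
  unfolding bessel_series_def[abs_def] by measurable

section \<open>The one-dimensional kernel\<close>

text \<open>One coordinate of \<open>laguerre_measure\<close>, taken on the whole line with density
  0 off the positive half-line; positivity of the variable is thus available almost everywhere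
  only.\<close>

definition gamma_measure :: "real \<Rightarrow> real measure" where
  "gamma_measure a = density lborel (\<lambda>x. ennreal (indicator {0<..} x * (x powr a * exp (- x))))"

lemma sets_gamma_measure[simp, measurable_cong]: "sets (gamma_measure a) = sets borel"
  by (simp add: gamma_measure_def)

lemma space_gamma_measure[simp]: "space (gamma_measure a) = UNIV"
  by (simp add: gamma_measure_def)

lemma AE_gamma_measure_pos: "AE x in gamma_measure a. 0 < x"
  unfolding gamma_measure_def by (subst AE_density) (auto split: split_indicator)

lemma nn_integral_gamma_measure_powr:
  assumes "a + s > -1" "c > -1"
  shows "(\<integral>\<^sup>+x. ennreal (x powr s * exp (- (c * x))) \<partial>gamma_measure a)
    = ennreal (Gamma (a + s + 1) / (1 + c) powr (a + s + 1))"
proof -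
  have "(\<integral>\<^sup>+x. ennreal (x powr s * exp (- (c * x))) \<partial>gamma_measure a)
    = (\<integral>\<^sup>+x. ennreal (indicator {0<..} x * (x powr (a + s + 1 - 1) * exp (- ((1 + c) * x)))) \<partial>lborel)"
    unfolding gamma_measure_def
    by (subst nn_integral_density)
       (auto simp: ennreal_mult[symmetric] powr_add distrib_right mult_exp_exp
        split: split_indicator intro!: nn_integral_cong arg_cong[where f=ennreal])
  also have "\<dots> = ennreal (Gamma (a + s + 1) / (1 + c) powr (a + s + 1))"
    using assms by (intro nn_integral_Gamma_scaled) auto
  finally show ?thesis .
qed

text \<open>The closed form in the Hille-Hardy formula: one coordinate of the heat kernel with q =
  exp (-t), as \<open>laguerre_kernel1_eq_bessel_I\<close> shows. In the variable q the semigroup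
  law is multiplicative.\<close>

definition laguerre_kernel1 :: "real \<Rightarrow> real \<Rightarrow> real \<Rightarrow> real \<Rightarrow> real" where
  "laguerre_kernel1 \<nu> q x y = (1 - q) powr (- \<nu> - 1) * exp (- (q * (x + y) / (1 - q)))
     * bessel_series \<nu> (q * x * y / (1 - q)\<^sup>2)"

lemma laguerre_kernel1_commute: "laguerre_kernel1 \<nu> q x y = laguerre_kernel1 \<nu> q y x"
  by (simp add: laguerre_kernel1_def algebra_simps)

lemma borel_measurable_laguerre_kernel1[measurable (raw)]:
  assumes [measurable]: "f \<in> borel_measurable N" "g \<in> borel_measurable N"
  shows "(\<lambda>w. laguerre_kernel1 \<nu> q (f w) (g w)) \<in> borel_measurable N"
  unfolding laguerre_kernel1_def by measurable

lemma laguerre_kernel1_nonneg: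
  assumes "\<nu> > -1" "0 < q" "q < 1" "x > 0" "y > 0"
  shows "laguerre_kernel1 \<nu> q x y \<ge> 0"
  unfolding laguerre_kernel1_def using assms
  by (intro mult_nonneg_nonneg bessel_series_nonneg) auto

text \<open>The dependence on y is isolated as a power times an exponential, the shape that
  \<open>nn_integral_gamma_measure_powr\<close> integrates.\<close>

lemma laguerre_kernel1_series:
  assumes "\<nu> > -1" "0 < q" "q < 1" "x > 0" "y > 0"
  shows "ennreal (laguerre_kernel1 \<nu> q x y) = (\<Sum>k. ennreal ((1 - q) powr (- \<nu> - 1) * exp (- (q * x / (1 - q)))
           * ((q * x / (1 - q)\<^sup>2) ^ k / (fact k * Gamma (real k + \<nu> + 1)))
           * (y powr real k * exp (- (q / (1 - q) * y)))))"
proof -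
  have "ennreal (laguerre_kernel1 \<nu> q x y)
      = ennreal ((1 - q) powr (- \<nu> - 1) * exp (- (q * (x + y) / (1 - q)))) * ennreal (bessel_series \<nu> (q * x * y / (1 - q)\<^sup>2))"
    unfolding laguerre_kernel1_def using assms by (subst ennreal_mult) (auto intro!: bessel_series_nonneg)
  also have "\<dots> = (\<Sum>k. ennreal ((1 - q) powr (- \<nu> - 1) * exp (- (q * (x + y) / (1 - q))))
      * ennreal ((q * x * y / (1 - q)\<^sup>2) ^ k / (fact k * Gamma (real k + \<nu> + 1))))"
    using assms by (simp add: bessel_series_ennreal)
  also have "\<dots> = (\<Sum>k. ennreal ((1 - q) powr (- \<nu> - 1) * exp (- (q * x / (1 - q)))
           * ((q * x / (1 - q)\<^sup>2) ^ k / (fact k * Gamma (real k + \<nu> + 1)))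
           * (y powr real k * exp (- (q / (1 - q) * y)))))"
  proof (rule suminf_cong)
    fix k
    have 1: "exp (- (q * (x + y) / (1 - q))) = exp (- (q * x / (1 - q))) * exp (- (q / (1 - q) * y))"
      by (simp add: exp_add[symmetric] add_divide_distrib distrib_left)
    have 2: "(q * x * y / (1 - q)\<^sup>2) ^ k = (q * x / (1 - q)\<^sup>2) ^ k * y powr real k"
      using assms by (simp add: powr_realpow power_mult_distrib power_divide)
    have "ennreal ((1 - q) powr (- \<nu> - 1) * exp (- (q * (x + y) / (1 - q))))
      * ennreal ((q * x * y / (1 - q)\<^sup>2) ^ k / (fact k * Gamma (real k + \<nu> + 1)))
      = ennreal ((1 - q) powr (- \<nu> - 1) * exp (- (q * (x + y) / (1 - q)))
      * ((q * x * y / (1 - q)\<^sup>2) ^ k / (fact k * Gamma (real k + \<nu> + 1))))"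
      using assms by (intro ennreal_mult[symmetric]) (auto intro!: divide_nonneg_nonneg mult_nonneg_nonneg Gamma_real_nonneg)
    also have "\<dots> = ennreal ((1 - q) powr (- \<nu> - 1) * exp (- (q * x / (1 - q)))
           * ((q * x / (1 - q)\<^sup>2) ^ k / (fact k * Gamma (real k + \<nu> + 1)))
           * (y powr real k * exp (- (q / (1 - q) * y))))"
      unfolding 1 2 by (simp add: mult_ac)
    finally show "ennreal ((1 - q) powr (- \<nu> - 1) * exp (- (q * (x + y) / (1 - q))))
      * ennreal ((q * x * y / (1 - q)\<^sup>2) ^ k / (fact k * Gamma (real k + \<nu> + 1)))
      = ennreal ((1 - q) powr (- \<nu> - 1) * exp (- (q * x / (1 - q)))
           * ((q * x / (1 - q)\<^sup>2) ^ k / (fact k * Gamma (real k + \<nu> + 1)))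
           * (y powr real k * exp (- (q / (1 - q) * y))))" .
  qed
  finally show ?thesis .
qed

text \<open>As a function of \<open>y\<close>, the kernel is a Poisson mixture of Gamma densities.\<close>

lemma nn_integral_laguerre_kernel1_powr:
  assumes "\<nu> > -1" "0 < q" "q < 1" "x > 0" "a + s > -1"
  defines "\<mu> \<equiv> q * x / (1 - q)"
  shows "(\<integral>\<^sup>+y. ennreal (laguerre_kernel1 \<nu> q x y * y powr s) \<partial>gamma_measure a)
    = (\<Sum>k. ennreal (exp (- \<mu>) * \<mu> ^ k / fact k *
         ((1 - q) powr (a + s - \<nu>) * Gamma (real k + a + s + 1) / Gamma (real k + \<nu> + 1))))"
proof -
  let ?J = "\<lambda>k. \<integral>\<^sup>+y. ennreal (y powr (real k + s) * exp (- (q / (1 - q) * y))) \<partial>gamma_measure a"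
  define c where "c k = (1 - q) powr (- \<nu> - 1) * exp (- \<mu>)
           * ((q * x / (1 - q)\<^sup>2) ^ k / (fact k * Gamma (real k + \<nu> + 1)))" for k
  have G: "Gamma (real n + \<nu> + 1) > 0" for n
    using assms by (intro Gamma_real_pos) simp
  have c: "c k \<ge> 0" for k
    unfolding c_def using assms G[of k] by auto
  have "(\<integral>\<^sup>+y. ennreal (laguerre_kernel1 \<nu> q x y * y powr s) \<partial>gamma_measure a)
    = (\<integral>\<^sup>+y. (\<Sum>k. ennreal (c k) * ennreal (y powr (real k + s) * exp (- (q / (1 - q) * y)))) \<partial>gamma_measure a)"
  proof (intro nn_integral_cong_AE, use AE_gamma_measure_pos in eventually_elim)
    fix y :: real assume y: "y > 0"
    have "ennreal (laguerre_kernel1 \<nu> q x y * y powr s) = ennreal (laguerre_kernel1 \<nu> q x y) * ennreal (y powr s)"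
      using assms y by (intro ennreal_mult laguerre_kernel1_nonneg) auto
    also have "\<dots> = (\<Sum>k. ennreal (c k * (y powr real k * exp (- (q / (1 - q) * y)))) * ennreal (y powr s))"
      using assms y by (simp add: laguerre_kernel1_series c_def \<mu>_def)
    also have "\<dots> = (\<Sum>k. ennreal (c k) * ennreal (y powr (real k + s) * exp (- (q / (1 - q) * y))))"
      using c by (intro suminf_cong) (simp add: ennreal_mult[symmetric] powr_add mult_ac)
    finally show "ennreal (laguerre_kernel1 \<nu> q x y * y powr s)
      = (\<Sum>k. ennreal (c k) * ennreal (y powr (real k + s) * exp (- (q / (1 - q) * y))))" .
  qed
  also have "\<dots> = (\<Sum>k. ennreal (c k) * ?J k)"
    by (simp add: nn_integral_suminf nn_integral_cmult)
  also have "\<dots> = (\<Sum>k. ennreal (exp (- \<mu>) * \<mu> ^ k / fact k *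
         ((1 - q) powr (a + s - \<nu>) * Gamma (real k + a + s + 1) / Gamma (real k + \<nu> + 1))))"
  proof (rule suminf_cong)
    fix k
    have Gs: "Gamma (real k + a + s + 1) > 0"
      using assms by (intro Gamma_real_pos) simp
    have "0 < q / (1 - q)" using assms by simp
    then have "-1 < q / (1 - q)" by linarith
    then have i: "?J k
      = ennreal (Gamma (a + (real k + s) + 1) / (1 + q / (1 - q)) powr (a + (real k + s) + 1))"
      using assms by (intro nn_integral_gamma_measure_powr) auto
    \<comment> \<open>The joint decay rate of exp (-y) in the measure and exp (-q y / (1 - q)) in
      the kernel.\<close>
    have "1 + q / (1 - q) = inverse (1 - q)"
      using assms by (simp add: field_simps)
    then have e: "(1 + q / (1 - q)) powr X = inverse ((1 - q) powr X)" for X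
      using assms(3) by (simp only: inverse_powr diff_ge_0_iff_ge less_imp_le)
    have "(q * x / (1 - q)\<^sup>2) ^ k = \<mu> ^ k * (1 - q) powr (- real k)"
    proof -
      have *: "q * x / (1 - q)\<^sup>2 = \<mu> * inverse (1 - q)"
        by (simp add: \<mu>_def power2_eq_square field_class.field_divide_inverse)
      show ?thesis
        unfolding * using assms(2,3) by (simp add: powr_minus powr_realpow power_mult_distrib power_inverse)
    qed
    then have "c k * (Gamma (real k + a + s + 1) * (1 - q) powr (real k + a + s + 1))
      = exp (- \<mu>) * \<mu> ^ k / fact k * (((1 - q) powr (- \<nu> - 1) * (1 - q) powr (- real k) * (1 - q) powr (real k + a + s + 1)) * Gamma (real k + a + s + 1) / Gamma (real k + \<nu> + 1))"
      unfolding c_def by (simp add: field_simps)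
    also have "(1 - q) powr (- \<nu> - 1) * (1 - q) powr (- real k) * (1 - q) powr (real k + a + s + 1) = (1 - q) powr (a + s - \<nu>)"
      by (simp flip: powr_add)
    finally have *: "c k * (Gamma (real k + a + s + 1) * (1 - q) powr (real k + a + s + 1))
      = exp (- \<mu>) * \<mu> ^ k / fact k * ((1 - q) powr (a + s - \<nu>) * Gamma (real k + a + s + 1) / Gamma (real k + \<nu> + 1))" .
    have "ennreal (c k) * ?J k
      = ennreal (c k) * ennreal (Gamma (real k + a + s + 1) * (1 - q) powr (real k + a + s + 1))"
      unfolding i e by (simp add: add_ac divide_inverse)
    also have "\<dots> = ennreal (c k * (Gamma (real k + a + s + 1) * (1 - q) powr (real k + a + s + 1)))"
      using c Gs by (intro ennreal_mult[symmetric]) auto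
    finally show "ennreal (c k) * ?J k
      = ennreal (exp (- \<mu>) * \<mu> ^ k / fact k * ((1 - q) powr (a + s - \<nu>) * Gamma (real k + a + s + 1) / Gamma (real k + \<nu> + 1)))"
      unfolding * .
  qed
  finally show ?thesis .
qed

lemma suminf_exp_ennreal: "x \<ge> 0 \<Longrightarrow> (\<Sum>k. ennreal (x ^ k / fact k)) = ennreal (exp x)"
  using summable_exp_generic[of x]
  by (subst suminf_ennreal2) (auto simp: exp_def field_simps)

text \<open>Both kernels are expanded in powers of z. Integration yields Gamma (k + l + \<nu> + 1),
  the only factor that couples the two indices; after the Vandermonde identity the sum factors as
  exp \<open>A\<close> times exp \<open>B\<close> times the Bessel series at
  \<open>A * B\<close>.\<close>

lemma laguerre_kernel1_Chapman_Kolmogorov: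
  assumes \<nu>: "\<nu> > -1" and q: "0 < q" "q < 1" and r: "0 < r" "r < 1" and xy: "x > 0" "y > 0"
  shows "(\<integral>\<^sup>+z. ennreal (laguerre_kernel1 \<nu> q x z * laguerre_kernel1 \<nu> r z y) \<partial>gamma_measure \<nu>)
    = ennreal (laguerre_kernel1 \<nu> (q * r) x y)"
proof -
  let ?c = "\<lambda>k l m. if m \<le> l then 1 / (fact (k - m) * fact (l - m) * (fact m * Gamma (real m + \<nu> + 1))) else (0::real)"
  define b where "b q x k = (1 - q) powr (- \<nu> - 1) * exp (- (q * x / (1 - q)))
           * ((q * x / (1 - q)\<^sup>2) ^ k / (fact k * Gamma (real k + \<nu> + 1)))" for q x and k :: nat
  define p where "p = q / (1 - q) + r / (1 - r)"
  have G: "Gamma (real n + \<nu> + 1) > 0" for n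
    using assms by (intro Gamma_real_pos) simp
  have b: "b q x k \<ge> 0" "b r y k \<ge> 0" for k
    unfolding b_def using assms G[of k] by auto
  have qr: "0 < q * r" "q * r < 1"
    using q r mult_strict_mono[of q 1 r 1] by auto
  have p: "1 + p = (1 - q * r) / ((1 - q) * (1 - r))"
  proof -
    have "1 + p = ((1 - q) * (1 - r) + q * (1 - r) + r * (1 - q)) / ((1 - q) * (1 - r))"
      unfolding p_def using q r by (simp add: add_divide_distrib)
    also have "(1 - q) * (1 - r) + q * (1 - r) + r * (1 - q) = 1 - q * r"
      by (simp add: algebra_simps)
    finally show ?thesis .
  qed
  have p_pos: "p > 0" unfolding p_def using q r by (intro add_pos_pos) auto
  \<comment> \<open>\<open>A\<close> and \<open>B\<close> are the coefficients q x / (1 - q)^2 and r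
    y / (1 - r)^2 divided by 1 + p: the Gamma integral contributes one such divisor for each power
    of z.\<close>
  define A where "A = q * x * (1 - r) / ((1 - q) * (1 - q * r))"
  define B where "B = r * y * (1 - q) / ((1 - r) * (1 - q * r))"
  have AB: "A \<ge> 0" "B \<ge> 0" unfolding A_def B_def using q r xy qr by auto
  define F where "F m i j = ennreal (A ^ i / fact i) * (ennreal (B ^ j / fact j) * ennreal ((A * B) ^ m / (fact m * Gamma (real m + \<nu> + 1))))" for m i j
  define K where "K = (1 - q * r) powr (- \<nu> - 1) * exp (- (q * x / (1 - q))) * exp (- (r * y / (1 - r)))"
  have K: "K \<ge> 0" unfolding K_def by auto
  have "(\<integral>\<^sup>+z. ennreal (laguerre_kernel1 \<nu> q x z * laguerre_kernel1 \<nu> r z y) \<partial>gamma_measure \<nu>)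
    = (\<integral>\<^sup>+z. (\<Sum>k. \<Sum>l. ennreal (b q x k * b r y l) * ennreal (z powr (real k + real l) * exp (- (p * z)))) \<partial>gamma_measure \<nu>)"
  proof (intro nn_integral_cong_AE, use AE_gamma_measure_pos in eventually_elim)
    fix z :: real assume z: "z > 0"
    have "ennreal (laguerre_kernel1 \<nu> q x z * laguerre_kernel1 \<nu> r z y)
      = ennreal (laguerre_kernel1 \<nu> q x z) * ennreal (laguerre_kernel1 \<nu> r y z)"
      unfolding laguerre_kernel1_commute[of \<nu> r z y] using assms z
      by (intro ennreal_mult laguerre_kernel1_nonneg) auto
    also have "\<dots> = (\<Sum>k. \<Sum>l. ennreal (b q x k * (z powr real k * exp (- (q / (1 - q) * z))))
        * ennreal (b r y l * (z powr real l * exp (- (r / (1 - r) * z)))))"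
      using assms z by (simp add: laguerre_kernel1_series b_def)
    also have "\<dots> = (\<Sum>k. \<Sum>l. ennreal (b q x k * b r y l) * ennreal (z powr (real k + real l) * exp (- (p * z))))"
    proof (intro suminf_cong)
      fix k l
      have "exp (- (p * z)) = exp (- (q / (1 - q) * z)) * exp (- (r / (1 - r) * z))"
        unfolding p_def by (simp add: exp_add[symmetric] distrib_right)
      then show "ennreal (b q x k * (z powr real k * exp (- (q / (1 - q) * z))))
        * ennreal (b r y l * (z powr real l * exp (- (r / (1 - r) * z))))
        = ennreal (b q x k * b r y l) * ennreal (z powr (real k + real l) * exp (- (p * z)))"
        using b by (simp add: ennreal_mult[symmetric] powr_add mult_ac)
    qed
    finally show "ennreal (laguerre_kernel1 \<nu> q x z * laguerre_kernel1 \<nu> r z y)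
      = (\<Sum>k. \<Sum>l. ennreal (b q x k * b r y l) * ennreal (z powr (real k + real l) * exp (- (p * z))))" .
  qed
  also have "\<dots> = (\<Sum>k. \<Sum>l. ennreal (b q x k * b r y l) * (\<integral>\<^sup>+z. ennreal (z powr (real k + real l) * exp (- (p * z))) \<partial>gamma_measure \<nu>))"
    by (simp add: nn_integral_suminf nn_integral_cmult)
  also have "\<dots> = (\<Sum>k. \<Sum>l. ennreal K * (\<Sum>m\<le>k. if m \<le> l then F m (k - m) (l - m) else 0))"
  proof (intro suminf_cong)
    fix k l
    have i: "(\<integral>\<^sup>+z. ennreal (z powr (real k + real l) * exp (- (p * z))) \<partial>gamma_measure \<nu>)
      = ennreal (Gamma (real k + real l + \<nu> + 1) / (1 + p) powr (real k + real l + \<nu> + 1))"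
      using assms p_pos by (subst nn_integral_gamma_measure_powr) (auto simp: add_ac)
    have h1: "(1 + p) powr (real k + real l + \<nu> + 1) = (1 + p) ^ k * (1 + p) ^ l * (1 + p) powr (\<nu> + 1)"
      using p_pos by (simp add: powr_add powr_realpow)
    have h2: "(1 - q) powr (- \<nu> - 1) * (1 - r) powr (- \<nu> - 1) / (1 + p) powr (\<nu> + 1) = (1 - q * r) powr (- \<nu> - 1)"
    proof -
      have "(1 - q) powr (- \<nu> - 1) * (1 - r) powr (- \<nu> - 1) = ((1 - q) * (1 - r)) powr (- (\<nu> + 1))"
        using q r by (simp add: powr_mult)
      moreover have "(1 + p) powr (\<nu> + 1) = (1 - q * r) powr (\<nu> + 1) / ((1 - q) * (1 - r)) powr (\<nu> + 1)"
        unfolding p using q r qr by (subst powr_divide) auto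
      moreover have "((1 - q) * (1 - r)) powr (\<nu> + 1) > 0" "(1 - q * r) powr (\<nu> + 1) > 0"
        using q r qr by auto
      moreover have "- \<nu> - 1 = - (\<nu> + 1)" by simp
      ultimately show ?thesis
        by (simp only: powr_minus) (simp add: field_simps)
    qed
    have hA: "(q * x / (1 - q)\<^sup>2) ^ k / (1 + p) ^ k = A ^ k"
    proof -
      have "q * x / (1 - q)\<^sup>2 / (1 + p) = A" unfolding p A_def using q r qr by (simp add: power2_eq_square)
      then show ?thesis by (simp flip: power_divide)
    qed
    have hB: "(r * y / (1 - r)\<^sup>2) ^ l / (1 + p) ^ l = B ^ l"
    proof -
      have "r * y / (1 - r)\<^sup>2 / (1 + p) = B" unfolding p B_def using q r qr by (simp add: power2_eq_square)
      then show ?thesis by (simp flip: power_divide)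
    qed
    \<comment> \<open>Stated for arbitrary g, P, Q, R, so that it is a mere regrouping into the
      blocks that \<open>h2\<close>, \<open>hA\<close> and \<open>hB\<close> evaluate.\<close>
    have h: "b q x k * b r y l * (g / (P * Q * R))
       = (((1 - q) powr (- \<nu> - 1) * (1 - r) powr (- \<nu> - 1) / R) * exp (- (q * x / (1 - q))) * exp (- (r * y / (1 - r))))
         * ((q * x / (1 - q)\<^sup>2) ^ k / P) * ((r * y / (1 - r)\<^sup>2) ^ l / Q)
         * (g / (fact k * Gamma (real k + \<nu> + 1) * (fact l * Gamma (real l + \<nu> + 1))))" for g P Q R
      unfolding b_def by (simp add: mult_ac)
    have "b q x k * b r y l * (Gamma (real k + real l + \<nu> + 1) / (1 + p) powr (real k + real l + \<nu> + 1))
        = K * A ^ k * B ^ l * (Gamma (real k + real l + \<nu> + 1) / (fact k * Gamma (real k + \<nu> + 1) * (fact l * Gamma (real l + \<nu> + 1))))"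
      by (simp only: h1 h h2 hA hB K_def)
    also have "\<dots> = K * (\<Sum>m\<le>k. A ^ k * B ^ l * ?c k l m)"
      unfolding Gamma_quotient_Vandermonde[OF \<nu>] by (simp add: sum_distrib_left mult.assoc)
    finally have e1: "b q x k * b r y l * (Gamma (real k + real l + \<nu> + 1) / (1 + p) powr (real k + real l + \<nu> + 1))
       = K * (\<Sum>m\<le>k. A ^ k * B ^ l * ?c k l m)" .
    have e2: "ennreal (\<Sum>m\<le>k. A ^ k * B ^ l * ?c k l m)
       = (\<Sum>m\<le>k. if m \<le> l then F m (k - m) (l - m) else 0)"
    proof (subst sum_ennreal[symmetric])
      show "0 \<le> A ^ k * B ^ l * ?c k l m" for m
        using AB G[of m] by auto
      show "(\<Sum>m\<le>k. ennreal (A ^ k * B ^ l * ?c k l m))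
         = (\<Sum>m\<le>k. if m \<le> l then F m (k - m) (l - m) else 0)"
      proof (intro sum.cong refl)
        fix m assume m: "m \<in> {..k}"
        show "ennreal (A ^ k * B ^ l * ?c k l m)
          = (if m \<le> l then F m (k - m) (l - m) else 0)"
        proof (cases "m \<le> l")
          case True
          have "A ^ k = A ^ (k - m) * A ^ m" "B ^ l = B ^ (l - m) * B ^ m"
            using m True by (auto simp flip: power_add)
          then show ?thesis
            using True AB G[of m] by (simp add: F_def ennreal_mult[symmetric] power_mult_distrib mult_ac)
        qed simp
      qed
    qed
    show "ennreal (b q x k * b r y l) * (\<integral>\<^sup>+z. ennreal (z powr (real k + real l) * exp (- (p * z))) \<partial>gamma_measure \<nu>)
       = ennreal K * (\<Sum>m\<le>k. if m \<le> l then F m (k - m) (l - m) else 0)"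
      unfolding i by (subst ennreal_mult'[symmetric]) (use b K in \<open>simp_all only: e1 e2 ennreal_mult' mult_nonneg_nonneg\<close>)
  qed
  also have "\<dots> = ennreal K * (\<Sum>m. \<Sum>i. \<Sum>j. F m i j)"
    by (simp add: suminf_reindex_common_part)
  also have "\<dots> = ennreal K * (ennreal (exp A) * (ennreal (exp B) * ennreal (bessel_series \<nu> (A * B))))"
    unfolding F_def using AB \<nu>
    by (simp only: ennreal_suminf_cmult ennreal_suminf_multc suminf_exp_ennreal bessel_series_ennreal mult_nonneg_nonneg)
  also have "\<dots> = ennreal (K * exp A * exp B * bessel_series \<nu> (A * B))"
    using K AB \<nu> by (simp add: ennreal_mult[symmetric] bessel_series_nonneg mult_ac)
  also have "K * exp A * exp B * bessel_series \<nu> (A * B) = laguerre_kernel1 \<nu> (q * r) x y"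
  proof -
    \<comment> \<open>\<open>A\<close> and \<open>B\<close> turn the exponents with parameters q and
      r into the two halves of the exponent with parameter q r.\<close>
    have "A - q * x / (1 - q) + (B - r * y / (1 - r)) = - (q * r * (x + y) / (1 - q * r))"
    proof -
      have "A - q * x / (1 - q) = - (q * r * x / (1 - q * r))"
        unfolding A_def using q r qr by (simp add: divide_simps) (simp add: algebra_simps)
      moreover have "B - r * y / (1 - r) = - (q * r * y / (1 - q * r))"
        unfolding B_def using q r qr by (simp add: divide_simps) (simp add: algebra_simps)
      ultimately show ?thesis by (simp add: add_divide_distrib distrib_left)
    qed
    then have "exp (- (q * r * (x + y) / (1 - q * r))) = exp (- (q * x / (1 - q))) * exp (- (r * y / (1 - r))) * exp A * exp B"
      by (simp flip: exp_add add: algebra_simps)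
    moreover have "A * B = q * r * x * y / (1 - q * r)\<^sup>2"
      unfolding A_def B_def using q r by (simp add: power2_eq_square)
    ultimately show ?thesis
      unfolding laguerre_kernel1_def K_def by (simp add: mult_ac)
  qed
  finally show ?thesis .
qed

section \<open>Mass, moments and boundedness of the one-dimensional kernel\<close>

lemma sigma_finite_gamma_measure: "sigma_finite_measure (gamma_measure a)"
  unfolding gamma_measure_def
  by (subst sigma_finite_measure.sigma_finite_iff_density_finite[OF lborel.sigma_finite_measure_axioms]) auto

lemma nn_integral_gamma_measure_power:
  assumes "a + real n > -1"
  shows "(\<integral>\<^sup>+x. ennreal (x ^ n) \<partial>gamma_measure a) = ennreal (Gamma (a + real n + 1))"
proof -
  have "(\<integral>\<^sup>+x. ennreal (x ^ n) \<partial>gamma_measure a) = (\<integral>\<^sup>+x. ennreal (x powr real n * exp (- (0 * x))) \<partial>gamma_measure a)"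
    by (intro nn_integral_cong_AE, use AE_gamma_measure_pos in eventually_elim) (simp add: powr_realpow)
  also have "\<dots> = ennreal (Gamma (a + real n + 1))"
    using assms by (subst nn_integral_gamma_measure_powr) auto
  finally show ?thesis .
qed

text \<open>For a = \<nu> and s = 0 the Gamma quotient of the mixture formula is 1, and the Poisson
  weights sum to 1.\<close>

lemma nn_integral_laguerre_kernel1:
  assumes "\<nu> > -1" "0 < q" "q < 1" "x > 0"
  shows "(\<integral>\<^sup>+y. ennreal (laguerre_kernel1 \<nu> q x y) \<partial>gamma_measure \<nu>) = 1"
proof -
  define \<mu> where "\<mu> = q * x / (1 - q)"
  have \<mu>: "\<mu> \<ge> 0" unfolding \<mu>_def using assms by simp
  have G: "Gamma (real n + \<nu> + 1) > 0" for n
    using assms by (intro Gamma_real_pos) simp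
  have "(\<integral>\<^sup>+y. ennreal (laguerre_kernel1 \<nu> q x y) \<partial>gamma_measure \<nu>)
     = (\<integral>\<^sup>+y. ennreal (laguerre_kernel1 \<nu> q x y * y powr 0) \<partial>gamma_measure \<nu>)"
    by (intro nn_integral_cong_AE, use AE_gamma_measure_pos in eventually_elim) simp
  also have "\<dots> = (\<Sum>k. ennreal (exp (- \<mu>) * \<mu> ^ k / fact k *
         ((1 - q) powr (\<nu> + 0 - \<nu>) * Gamma (real k + \<nu> + 0 + 1) / Gamma (real k + \<nu> + 1))))"
    unfolding \<mu>_def using assms by (intro nn_integral_laguerre_kernel1_powr) auto
  also have "\<dots> = (\<Sum>k. ennreal (exp (- \<mu>)) * ennreal (\<mu> ^ k / fact k))"
    using assms(3) \<mu> less_imp_neq[OF G] by (intro suminf_cong) (simp add: ennreal_mult[symmetric])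
  also have "\<dots> = 1"
    unfolding ennreal_suminf_cmult suminf_exp_ennreal[OF \<mu>]
    by (simp add: ennreal_mult[symmetric] exp_minus)
  finally show ?thesis .
qed

text \<open>The k-th Gamma density of the mixture has mean (1 - q)(k + \<nu> + 1), and k has Poisson
  mean \<mu>, so the moment is q x + (1 - q)(\<nu> + 1). A lower bound suffices, as the moment
  enters the next estimate with a negative sign.\<close>

lemma nn_integral_laguerre_kernel1_first_moment_ge:
  assumes "\<nu> > -1" "0 < q" "q < 1" "x > 0"
  shows "ennreal (q * x) \<le> (\<integral>\<^sup>+y. ennreal (laguerre_kernel1 \<nu> q x y * y) \<partial>gamma_measure \<nu>)"
proof -
  define \<mu> where "\<mu> = q * x / (1 - q)"
  have \<mu>: "\<mu> \<ge> 0" unfolding \<mu>_def using assms by simp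
  have "ennreal (q * x) = ennreal ((1 - q) * exp (- \<mu>) * \<mu>) * (\<Sum>k. ennreal (\<mu> ^ k / fact k))"
    unfolding suminf_exp_ennreal[OF \<mu>]
    using \<mu> assms by (simp add: ennreal_mult[symmetric] exp_minus) (simp add: \<mu>_def)
  also have "\<dots> = (\<Sum>k. ennreal ((1 - q) * exp (- \<mu>)) * ennreal (\<mu> ^ Suc k / fact (Suc k) * real (Suc k)))"
    unfolding ennreal_suminf_cmult[symmetric]
  proof (rule suminf_cong)
    fix k
    have "\<mu> ^ Suc k / fact (Suc k) * real (Suc k) = \<mu> * (\<mu> ^ k / fact k)"
      by (simp del: of_nat_Suc)
    then show "ennreal ((1 - q) * exp (- \<mu>) * \<mu>) * ennreal (\<mu> ^ k / fact k)
       = ennreal ((1 - q) * exp (- \<mu>)) * ennreal (\<mu> ^ Suc k / fact (Suc k) * real (Suc k))"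
      using \<mu> assms by (simp only:) (simp add: ennreal_mult[symmetric] mult.assoc)
  qed
  \<comment> \<open>The index shift is free: the factor \<open>real k\<close> annihilates the term k
    = 0.\<close>
  also have "\<dots> = (\<Sum>k. ennreal ((1 - q) * exp (- \<mu>)) * ennreal (\<mu> ^ k / fact k * real k))"
    by (subst suminf_offset[where i = 1 and f = "\<lambda>k. ennreal ((1 - q) * exp (- \<mu>)) * ennreal (\<mu> ^ k / fact k * real k)"]) auto
  also have "\<dots> \<le> (\<Sum>k. ennreal (exp (- \<mu>) * \<mu> ^ k / fact k *
         ((1 - q) powr (\<nu> + 1 - \<nu>) * Gamma (real k + \<nu> + 1 + 1) / Gamma (real k + \<nu> + 1))))"
  proof (intro suminf_le summableI)
    fix k
    have *: "Gamma (real k + \<nu> + 1 + 1) / Gamma (real k + \<nu> + 1) = real k + \<nu> + 1"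
    proof -
      have pos: "real k + \<nu> + 1 > 0" using assms by simp
      then have "real k + \<nu> + 1 \<notin> \<int>\<^sub>\<le>\<^sub>0" by (auto dest: nonpos_Ints_nonpos)
      with Gamma_real_pos[OF pos] show ?thesis by (subst Gamma_plus1) auto
    qed
    have "(1 - q) * exp (- \<mu>) * (\<mu> ^ k / fact k * real k) \<le> (1 - q) * exp (- \<mu>) * (\<mu> ^ k / fact k * (real k + \<nu> + 1))"
      using \<mu> assms by (intro mult_left_mono) auto
    also have "\<dots> = exp (- \<mu>) * \<mu> ^ k / fact k *
         ((1 - q) powr (\<nu> + 1 - \<nu>) * Gamma (real k + \<nu> + 1 + 1) / Gamma (real k + \<nu> + 1))"
      using assms unfolding times_divide_eq_right[symmetric] * by simp
    finally show "ennreal ((1 - q) * exp (- \<mu>)) * ennreal (\<mu> ^ k / fact k * real k)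
      \<le> ennreal (exp (- \<mu>) * \<mu> ^ k / fact k *
         ((1 - q) powr (\<nu> + 1 - \<nu>) * Gamma (real k + \<nu> + 1 + 1) / Gamma (real k + \<nu> + 1)))"
      using \<mu> assms by (subst ennreal_mult[symmetric]) (auto intro!: ennreal_leI)
  qed
  also have "\<dots> = (\<integral>\<^sup>+y. ennreal (laguerre_kernel1 \<nu> q x y * y powr 1) \<partial>gamma_measure \<nu>)"
    using assms unfolding \<mu>_def by (intro nn_integral_laguerre_kernel1_powr[symmetric]) auto
  also have "\<dots> = (\<integral>\<^sup>+y. ennreal (laguerre_kernel1 \<nu> q x y * y) \<partial>gamma_measure \<nu>)"
    by (intro nn_integral_cong_AE, use AE_gamma_measure_pos in eventually_elim) simp
  finally show ?thesis .
qed

text \<open>Expand the square. Rows and columns of mass one give each pure square the value Gamma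
  (\<nu> + 3), and the mixed integral is at least q times that by the first moment. What remains
  vanishes as q tends to 1, that is, as t tends to 0.\<close>

lemma nn_integral_laguerre_kernel1_square_diff:
  assumes "\<nu> > -1" "0 < q" "q < 1"
  shows "(\<integral>\<^sup>+x. \<integral>\<^sup>+y. ennreal (laguerre_kernel1 \<nu> q x y * (x - y)\<^sup>2) \<partial>gamma_measure \<nu> \<partial>gamma_measure \<nu>)
     \<le> ennreal (2 * (1 - q) * Gamma (\<nu> + 3))"
proof -
  let ?m = "gamma_measure \<nu>" and ?k = "laguerre_kernel1 \<nu> q"
  interpret sigma_finite_measure ?m by (rule sigma_finite_gamma_measure)
  interpret pair_sigma_finite ?m ?m ..
  have G: "Gamma (\<nu> + 3) > 0" using assms by (intro Gamma_real_pos) auto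
  define E where "E = (\<integral>\<^sup>+x. \<integral>\<^sup>+y. ennreal (?k x y * (x - y)\<^sup>2) \<partial>?m \<partial>?m)"
  define X where "X = (\<integral>\<^sup>+x. \<integral>\<^sup>+y. ennreal (?k x y * (x * y)) \<partial>?m \<partial>?m)"
  have sq: "(\<integral>\<^sup>+x. ennreal (x ^ 2) \<partial>?m) = ennreal (Gamma (\<nu> + 3))"
    using assms by (subst nn_integral_gamma_measure_power) (auto simp: add_ac)
  have A: "(\<integral>\<^sup>+x. \<integral>\<^sup>+y. ennreal (?k x y * x\<^sup>2) \<partial>?m \<partial>?m) = ennreal (Gamma (\<nu> + 3))"
  proof -
    have "(\<integral>\<^sup>+x. \<integral>\<^sup>+y. ennreal (?k x y * x\<^sup>2) \<partial>?m \<partial>?m) = (\<integral>\<^sup>+x. (\<integral>\<^sup>+y. ennreal (?k x y) \<partial>?m) * ennreal (x\<^sup>2) \<partial>?m)"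
      by (simp add: ennreal_mult'' nn_integral_multc)
    also have "\<dots> = (\<integral>\<^sup>+x. ennreal (x\<^sup>2) \<partial>?m)"
      by (intro nn_integral_cong_AE, use AE_gamma_measure_pos in eventually_elim)
        (simp add: nn_integral_laguerre_kernel1 assms)
    finally show ?thesis by (simp add: sq)
  qed
  have "(\<integral>\<^sup>+x. \<integral>\<^sup>+y. ennreal (?k x y * y\<^sup>2) \<partial>?m \<partial>?m) = (\<integral>\<^sup>+y. \<integral>\<^sup>+x. ennreal (?k x y * y\<^sup>2) \<partial>?m \<partial>?m)"
    by (rule Fubini'[symmetric]) simp
  also have "\<dots> = ennreal (Gamma (\<nu> + 3))"
    unfolding A[symmetric] by (subst laguerre_kernel1_commute) (rule refl)
  finally have B: "(\<integral>\<^sup>+x. \<integral>\<^sup>+y. ennreal (?k x y * y\<^sup>2) \<partial>?m \<partial>?m) = ennreal (Gamma (\<nu> + 3))" .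
  \<comment> \<open>The mixed term is added on the left instead of subtracted on the right, because
    in \<open>ennreal\<close> the subtraction is meaningful only once finiteness is known.\<close>
  have "E + 2 * X = (\<integral>\<^sup>+x. \<integral>\<^sup>+y. ennreal (?k x y * (x - y)\<^sup>2) + 2 * ennreal (?k x y * (x * y)) \<partial>?m \<partial>?m)"
    unfolding E_def X_def by (simp add: nn_integral_add nn_integral_cmult)
  also have "\<dots> = (\<integral>\<^sup>+x. \<integral>\<^sup>+y. ennreal (?k x y * x\<^sup>2) + ennreal (?k x y * y\<^sup>2) \<partial>?m \<partial>?m)"
  proof (intro nn_integral_cong_AE, use AE_gamma_measure_pos in eventually_elim)
    fix x :: real assume x: "x > 0"
    show "(\<integral>\<^sup>+y. ennreal (?k x y * (x - y)\<^sup>2) + 2 * ennreal (?k x y * (x * y)) \<partial>?m)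
      = (\<integral>\<^sup>+y. ennreal (?k x y * x\<^sup>2) + ennreal (?k x y * y\<^sup>2) \<partial>?m)"
    proof (intro nn_integral_cong_AE, use AE_gamma_measure_pos in eventually_elim)
      fix y :: real assume y: "y > 0"
      have k: "?k x y \<ge> 0" using assms x y by (intro laguerre_kernel1_nonneg)
      have "2 * ennreal (?k x y * (x * y)) = ennreal (2 * (?k x y * (x * y)))"
        by (subst ennreal_mult') auto
      then have "ennreal (?k x y * (x - y)\<^sup>2) + 2 * ennreal (?k x y * (x * y)) = ennreal (?k x y * (x - y)\<^sup>2 + 2 * (?k x y * (x * y)))"
        using x y k by simp
      also have "?k x y * (x - y)\<^sup>2 + 2 * (?k x y * (x * y)) = ?k x y * x\<^sup>2 + ?k x y * y\<^sup>2"
        by (simp add: power2_eq_square algebra_simps)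
      finally show "ennreal (?k x y * (x - y)\<^sup>2) + 2 * ennreal (?k x y * (x * y)) = ennreal (?k x y * x\<^sup>2) + ennreal (?k x y * y\<^sup>2)"
        using k by simp
    qed
  qed
  also have "\<dots> = ennreal (2 * Gamma (\<nu> + 3))"
    using G by (simp add: nn_integral_add A B flip: ennreal_plus)
  finally have eq: "E + 2 * X = ennreal (2 * Gamma (\<nu> + 3))" .
  have "ennreal (q * Gamma (\<nu> + 3)) = (\<integral>\<^sup>+x. ennreal q * ennreal (x\<^sup>2) \<partial>?m)"
    using assms by (simp add: nn_integral_cmult sq ennreal_mult')
  also have "\<dots> \<le> X"
    unfolding X_def
  proof (intro nn_integral_mono_AE, use AE_gamma_measure_pos in eventually_elim)
    fix x :: real assume x: "x > 0"
    have "ennreal q * ennreal (x\<^sup>2) = ennreal x * ennreal (q * x)"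
      using assms x by (simp add: ennreal_mult[symmetric] power2_eq_square mult_ac)
    also have "\<dots> \<le> ennreal x * (\<integral>\<^sup>+y. ennreal (?k x y * y) \<partial>?m)"
      using assms x by (intro mult_left_mono nn_integral_laguerre_kernel1_first_moment_ge) auto
    also have "\<dots> = (\<integral>\<^sup>+y. ennreal (?k x y * (x * y)) \<partial>?m)"
      using x by (subst nn_integral_cmult[symmetric]) (auto simp: ennreal_mult'[symmetric] mult_ac)
    finally show "ennreal q * ennreal (x\<^sup>2) \<le> (\<integral>\<^sup>+y. ennreal (?k x y * (x * y)) \<partial>?m)" .
  qed
  finally have "2 * ennreal (q * Gamma (\<nu> + 3)) \<le> 2 * X"
    by (rule mult_left_mono) simp
  then have "E + 2 * ennreal (q * Gamma (\<nu> + 3)) \<le> ennreal (2 * Gamma (\<nu> + 3))"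
    unfolding eq[symmetric] by (rule add_left_mono)
  moreover have "2 * ennreal (q * Gamma (\<nu> + 3)) = ennreal (2 * (q * Gamma (\<nu> + 3)))"
    by (subst ennreal_mult') auto
  ultimately have le: "E + ennreal (2 * (q * Gamma (\<nu> + 3))) \<le> ennreal (2 * Gamma (\<nu> + 3))"
    by simp
  have "E \<le> ennreal (2 * Gamma (\<nu> + 3) - 2 * (q * Gamma (\<nu> + 3)))"
  proof (cases E)
    case (real e)
    then have "e + 2 * (q * Gamma (\<nu> + 3)) \<le> 2 * Gamma (\<nu> + 3)"
      using le G assms by (simp flip: ennreal_plus)
    then show ?thesis unfolding real by (intro ennreal_leI) simp
  qed (use le in \<open>simp add: top_unique\<close>)
  also have "2 * Gamma (\<nu> + 3) - 2 * (q * Gamma (\<nu> + 3)) = 2 * (1 - q) * Gamma (\<nu> + 3)"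
    by (simp add: algebra_simps)
  finally have "E \<le> ennreal (2 * (1 - q) * Gamma (\<nu> + 3))" .
  then show ?thesis unfolding E_def .
qed

text \<open>The exponential in y decays at rate q / (1 - q); the Bessel series is allowed to consume
  half of it, and the rest also absorbs sqrt y.\<close>

lemma laguerre_kernel1_bounded:
  assumes "\<nu> > -1" "0 < q" "q < 1" "x > 0"
  obtains B where "\<And>y. y > 0 \<Longrightarrow> laguerre_kernel1 \<nu> q x y \<le> B"
    "\<And>y. y > 0 \<Longrightarrow> laguerre_kernel1 \<nu> q x y * sqrt y \<le> B"
proof -
  define r where "r = q / (1 - q)"
  define \<delta> where "\<delta> = r / 2"
  have \<delta>: "\<delta> > 0" using assms by (simp add: \<delta>_def r_def)
  \<comment> \<open>This rate is chosen so that its product with q x y / (1 - q)^2 is exactly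
    \<delta> y.\<close>
  obtain B0 where B0: "B0 > 0" "\<And>z. z \<ge> 0 \<Longrightarrow> bessel_series \<nu> z \<le> B0 * exp ((1 - q) / (2 * x) * z)"
    using bessel_series_le_exp[of \<nu> "(1 - q) / (2 * x)"] assms by auto
  define B1 where "B1 = (1 - q) powr (- \<nu> - 1) * B0"
  have B1: "B1 \<ge> 0" using B0 by (simp add: B1_def)
  have le: "laguerre_kernel1 \<nu> q x y \<le> B1 * exp (- (\<delta> * y))" if "y > 0" for y
  proof -
    have "bessel_series \<nu> (q * x * y / (1 - q)\<^sup>2) \<le> B0 * exp ((1 - q) / (2 * x) * (q * x * y / (1 - q)\<^sup>2))"
      using assms that by (intro B0) auto
    also have "(1 - q) / (2 * x) * (q * x * y / (1 - q)\<^sup>2) = \<delta> * y"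
      using assms by (simp add: \<delta>_def r_def power2_eq_square)
    finally have 1: "bessel_series \<nu> (q * x * y / (1 - q)\<^sup>2) \<le> B0 * exp (\<delta> * y)" .
    have "2 * \<delta> * y = r * y"
      by (simp add: \<delta>_def)
    also have "\<dots> = q * y / (1 - q)"
      by (simp add: r_def)
    also have "\<dots> \<le> q * (x + y) / (1 - q)"
      using assms by (intro divide_right_mono) auto
    finally have "q * (x + y) / (1 - q) \<ge> 2 * \<delta> * y" .
    then have "exp (- (q * (x + y) / (1 - q))) \<le> exp (- (2 * \<delta> * y))" by simp
    then have "(1 - q) powr (- \<nu> - 1) * exp (- (q * (x + y) / (1 - q))) * bessel_series \<nu> (q * x * y / (1 - q)\<^sup>2)
      \<le> (1 - q) powr (- \<nu> - 1) * exp (- (2 * \<delta> * y)) * (B0 * exp (\<delta> * y))"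
      using 1 assms that by (intro mult_mono) (auto intro!: bessel_series_nonneg)
    also have "\<dots> = B1 * (exp (- (2 * \<delta> * y)) * exp (\<delta> * y))" by (simp add: B1_def)
    also have "exp (- (2 * \<delta> * y)) * exp (\<delta> * y) = exp (- (\<delta> * y))" by (simp flip: exp_add)
    finally show ?thesis unfolding laguerre_kernel1_def .
  qed
  \<comment> \<open>Makes 1 + y at most C (1 + \<delta> y), hence at most C exp (\<delta>
    y).\<close>
  define C where "C = max 1 (1 / \<delta>)"
  have C: "C \<ge> 1" "C * \<delta> \<ge> 1"
    using \<delta> by (auto simp: C_def max_def field_simps)
  have sq: "sqrt y \<le> C * exp (\<delta> * y)" if "y > 0" for y
  proof -
    have "y \<le> (1 + y)\<^sup>2" using that by (simp add: power2_eq_square algebra_simps)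
    then have "sqrt y \<le> 1 + y" using that by (intro real_le_lsqrt) auto
    also have "\<dots> \<le> C + C * \<delta> * y" using C that by (intro add_mono) auto
    also have "\<dots> = C * (1 + \<delta> * y)" by (simp add: algebra_simps)
    also have "\<dots> \<le> C * exp (\<delta> * y)" using C by (intro mult_left_mono) auto
    finally show ?thesis .
  qed
  show ?thesis
  proof (rule that[of "B1 * C"])
    fix y :: real assume y: "y > 0"
    have "B1 * exp (- (\<delta> * y)) \<le> B1 * C"
      using B1 C \<delta> y by (intro mult_left_mono order_trans[OF _ C(1)]) auto
    with le[OF y] show "laguerre_kernel1 \<nu> q x y \<le> B1 * C" by simp
    have "laguerre_kernel1 \<nu> q x y * sqrt y \<le> B1 * exp (- (\<delta> * y)) * (C * exp (\<delta> * y))"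
      using le[OF y] sq[OF y] B1 y assms by (intro mult_mono) auto
    also have "\<dots> = B1 * C" by (simp add: exp_minus)
    finally show "laguerre_kernel1 \<nu> q x y * sqrt y \<le> B1 * C" .
  qed
qed

section \<open>The row mass of the modified kernel\<close>

lemma ennreal_le_linear_combination:
  assumes "x \<le> b * y + c * z" "0 \<le> b" "0 \<le> c" "0 \<le> y" "0 \<le> z"
  shows "ennreal x \<le> ennreal b * ennreal y + ennreal c * ennreal z"
proof -
  have "ennreal x \<le> ennreal (b * y + c * z)"
    using assms(1) by (rule ennreal_leI)
  then show ?thesis
    using assms by (simp add: ennreal_mult)
qed

lemma nn_integral_Beta:
  assumes "a > 0" "b > (0::real)"
  shows "(\<integral>\<^sup>+u. ennreal (indicator {0<..<1} u * (u powr (a - 1) * (1 - u) powr (b - 1))) \<partial>lborel) = ennreal (Beta a b)"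
proof -
  have "((\<lambda>u. u powr (a - 1) * (1 - u) powr (b - 1)) has_integral Beta a b) {0<..<1}"
    using has_integral_Beta_real[OF assms] by (simp add: has_integral_Icc_iff_Ioo)
  from nn_integral_has_integral_lebesgue[OF _ this] show ?thesis
    by (simp add: mult_ac)
qed

text \<open>The integral in \<open>half_mass\<close> comes from writing the Gamma quotients
  \<open>\<Gamma>(k + \<nu> + 1/2) / \<Gamma>(k + \<nu> + 1)\<close> as Beta integrals; summing the Poisson weights under the
  integral leaves the exponential.\<close>

definition half_mass :: "real \<Rightarrow> real \<Rightarrow> ennreal" where
  "half_mass \<nu> \<mu> = (\<integral>\<^sup>+u. ennreal (indicator {0<..<1} u *
     (u powr (- 1 / 2) * (1 - u) powr (\<nu> - 1 / 2) * exp (- (\<mu> * u)))) \<partial>lborel)"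

text \<open>The measure has parameter \<nu> - 1 because \<nu> stands for \<alpha>_j + 1. The mixture
  formula with a = \<nu> - 1 and s = 1/2 gives the quotients Gamma (k + \<nu> + 1/2) / Gamma (k +
  \<nu> + 1) and the power (1 - q)^(-1/2).\<close>

lemma nn_integral_laguerre_kernel1_sqrt:
  assumes "\<nu> > - 1 / 2" "0 < q" "q < 1" "x > 0"
  defines "\<mu> \<equiv> q * x / (1 - q)"
  shows "ennreal (q * sqrt x) * (\<integral>\<^sup>+y. ennreal (laguerre_kernel1 \<nu> q x y * sqrt y) \<partial>gamma_measure (\<nu> - 1))
    = ennreal (sqrt q * sqrt (\<mu> / pi)) * half_mass \<nu> \<mu>"
proof -
  have \<mu>: "\<mu> > 0" unfolding \<mu>_def using assms by simp
  have G: "Gamma (real k + \<nu> + 1) > 0" "Gamma (real k + \<nu> + 1 / 2) > 0" for k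
    using assms by (auto intro!: Gamma_real_pos)
  define w where "w u = indicator {0<..<1} u * (u powr (- 1 / 2) * (1 - u) powr (\<nu> - 1 / 2))" for u :: real
  have w: "w u \<ge> 0" for u by (simp add: w_def)
  have [measurable]: "w \<in> borel_measurable borel" unfolding w_def by measurable
  let ?J = "\<lambda>k. \<integral>\<^sup>+u. ennreal (exp (- \<mu>) * w u) * ennreal ((\<mu> * (1 - u)) ^ k / fact k) \<partial>lborel"
  have "(\<integral>\<^sup>+y. ennreal (laguerre_kernel1 \<nu> q x y * sqrt y) \<partial>gamma_measure (\<nu> - 1))
    = (\<integral>\<^sup>+y. ennreal (laguerre_kernel1 \<nu> q x y * y powr (1 / 2)) \<partial>gamma_measure (\<nu> - 1))"
    by (intro nn_integral_cong_AE, use AE_gamma_measure_pos in eventually_elim) (simp add: powr_half_sqrt)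
  also have "\<dots> = (\<Sum>k. ennreal (exp (- \<mu>) * \<mu> ^ k / fact k *
      ((1 - q) powr (\<nu> - 1 + 1 / 2 - \<nu>) * Gamma (real k + (\<nu> - 1) + 1 / 2 + 1) / Gamma (real k + \<nu> + 1))))"
    unfolding \<mu>_def using assms by (intro nn_integral_laguerre_kernel1_powr) auto
  also have "\<dots> = (\<Sum>k. ennreal (1 / (sqrt (1 - q) * sqrt pi)) * ?J k)"
  proof (rule suminf_cong)
    fix k
    have "?J k
      = (\<integral>\<^sup>+u. ennreal (exp (- \<mu>) * \<mu> ^ k / fact k) * ennreal (indicator {0<..<1} u * (u powr (1 / 2 - 1) * (1 - u) powr (real k + \<nu> + 1 / 2 - 1))) \<partial>lborel)"
    proof (intro nn_integral_cong)
      fix u :: real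
      have "0 < u \<Longrightarrow> u < 1 \<Longrightarrow> (1 - u) powr (real k + \<nu> + 1 / 2 - 1) = (1 - u) ^ k * (1 - u) powr (\<nu> - 1 / 2)"
        by (simp add: powr_realpow[symmetric] powr_add[symmetric] add_diff_eq)
      then show "ennreal (exp (- \<mu>) * w u) * ennreal ((\<mu> * (1 - u)) ^ k / fact k)
        = ennreal (exp (- \<mu>) * \<mu> ^ k / fact k) * ennreal (indicator {0<..<1} u * (u powr (1 / 2 - 1) * (1 - u) powr (real k + \<nu> + 1 / 2 - 1)))"
        using \<mu> by (cases "0 < u \<and> u < 1") (auto simp: w_def ennreal_mult[symmetric] power_mult_distrib mult_ac)
    qed
    also have "\<dots> = ennreal (exp (- \<mu>) * \<mu> ^ k / fact k) * ennreal (Beta (1 / 2) (real k + \<nu> + 1 / 2))"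
      using assms(1) by (subst nn_integral_cmult, measurable) (subst nn_integral_Beta, simp_all)
    also have "Beta (1 / 2) (real k + \<nu> + 1 / 2) = sqrt pi * Gamma (real k + \<nu> + 1 / 2) / Gamma (real k + \<nu> + 1)"
      by (simp add: Beta_def Gamma_one_half_real add_ac)
    also have "ennreal (exp (- \<mu>) * \<mu> ^ k / fact k) * ennreal \<dots> = ennreal (exp (- \<mu>) * \<mu> ^ k / fact k * (sqrt pi * Gamma (real k + \<nu> + 1 / 2) / Gamma (real k + \<nu> + 1)))"
      using \<mu> G[of k] by (intro ennreal_mult[symmetric]) auto
    finally have i: "?J k
       = ennreal (exp (- \<mu>) * \<mu> ^ k / fact k * (sqrt pi * Gamma (real k + \<nu> + 1 / 2) / Gamma (real k + \<nu> + 1)))" .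
    have "(1 - q) powr (\<nu> - 1 + 1 / 2 - \<nu>) = 1 / sqrt (1 - q)"
    proof -
      have "\<nu> - 1 + 1 / 2 - \<nu> = - (1 / 2)" by simp
      then show ?thesis
        using assms(3) by (simp only: powr_minus) (simp add: powr_half_sqrt inverse_eq_divide)
    qed
    moreover have "real k + (\<nu> - 1) + 1 / 2 + 1 = real k + \<nu> + 1 / 2" by simp
    ultimately have "exp (- \<mu>) * \<mu> ^ k / fact k *
      ((1 - q) powr (\<nu> - 1 + 1 / 2 - \<nu>) * Gamma (real k + (\<nu> - 1) + 1 / 2 + 1) / Gamma (real k + \<nu> + 1))
      = 1 / (sqrt (1 - q) * sqrt pi) * (exp (- \<mu>) * \<mu> ^ k / fact k * (sqrt pi * Gamma (real k + \<nu> + 1 / 2) / Gamma (real k + \<nu> + 1)))"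
      by (simp add: mult_ac add_ac)
    then show "ennreal (exp (- \<mu>) * \<mu> ^ k / fact k *
      ((1 - q) powr (\<nu> - 1 + 1 / 2 - \<nu>) * Gamma (real k + (\<nu> - 1) + 1 / 2 + 1) / Gamma (real k + \<nu> + 1)))
      = ennreal (1 / (sqrt (1 - q) * sqrt pi)) * ?J k"
      unfolding i using assms(3) by (simp only:) (intro ennreal_mult', simp)
  qed
  also have "\<dots> = ennreal (1 / (sqrt (1 - q) * sqrt pi)) * (\<integral>\<^sup>+u. (\<Sum>k. ennreal (exp (- \<mu>) * w u) * ennreal ((\<mu> * (1 - u)) ^ k / fact k)) \<partial>lborel)"
    unfolding ennreal_suminf_cmult by (subst nn_integral_suminf[symmetric]) simp_all
  also have "(\<integral>\<^sup>+u. (\<Sum>k. ennreal (exp (- \<mu>) * w u) * ennreal ((\<mu> * (1 - u)) ^ k / fact k)) \<partial>lborel) = half_mass \<nu> \<mu>"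
    unfolding half_mass_def
  proof (intro nn_integral_cong)
    fix u :: real
    show "(\<Sum>k. ennreal (exp (- \<mu>) * w u) * ennreal ((\<mu> * (1 - u)) ^ k / fact k))
      = ennreal (indicator {0<..<1} u * (u powr (- 1 / 2) * (1 - u) powr (\<nu> - 1 / 2) * exp (- (\<mu> * u))))"
    proof (cases "0 < u \<and> u < 1")
      case True
      have "(\<Sum>k. ennreal (exp (- \<mu>) * w u) * ennreal ((\<mu> * (1 - u)) ^ k / fact k)) = ennreal (exp (- \<mu>) * w u) * ennreal (exp (\<mu> * (1 - u)))"
        using True \<mu> by (simp only: ennreal_suminf_cmult) (simp add: suminf_exp_ennreal del: suminf_ennreal)
      also have "\<dots> = ennreal (w u * (exp (- \<mu>) * exp (\<mu> * (1 - u))))"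
        using w by (simp add: ennreal_mult[symmetric] mult_ac)
      also have "exp (- \<mu>) * exp (\<mu> * (1 - u)) = exp (- (\<mu> * u))"
        by (simp add: mult_exp_exp algebra_simps)
      finally show ?thesis by (simp add: w_def mult_ac)
    qed (auto simp: w_def)
  qed
  finally have "(\<integral>\<^sup>+y. ennreal (laguerre_kernel1 \<nu> q x y * sqrt y) \<partial>gamma_measure (\<nu> - 1))
     = ennreal (1 / (sqrt (1 - q) * sqrt pi)) * half_mass \<nu> \<mu>" .
  \<comment> \<open>Half of the factor q is used up in sqrt \<mu>; the other half becomes exp (-t/2)
    when q = exp (-t).\<close>
  moreover have "q * sqrt x * (1 / (sqrt (1 - q) * sqrt pi)) = sqrt q * sqrt (\<mu> / pi)"
    unfolding \<mu>_def using assms by (simp add: real_sqrt_divide real_sqrt_mult)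
  ultimately show ?thesis
    using assms(2,3,4) by (simp add: mult.assoc[symmetric] ennreal_mult[symmetric])
qed

lemma nn_integral_powr_half_exp:
  assumes "\<mu> > 0"
  shows "(\<integral>\<^sup>+u. ennreal (indicator {0<..} u * (u powr (- 1 / 2) * exp (- (\<mu> * u)))) \<partial>lborel) = ennreal (sqrt (pi / \<mu>))"
  using nn_integral_Gamma_scaled[of "1 / 2" \<mu>] assms
  by (simp add: Gamma_one_half_real powr_half_sqrt real_sqrt_divide)

lemma half_mass_le_1:
  assumes "\<nu> \<ge> 1 / 2" "\<mu> > 0"
  shows "ennreal (sqrt (\<mu> / pi)) * half_mass \<nu> \<mu> \<le> 1"
proof -
  have "half_mass \<nu> \<mu> \<le> (\<integral>\<^sup>+u. ennreal (indicator {0<..} u * (u powr (- 1 / 2) * exp (- (\<mu> * u)))) \<partial>lborel)"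
    unfolding half_mass_def
  proof (intro nn_integral_mono ennreal_leI)
    fix u :: real
    show "indicator {0<..<1} u * (u powr (- 1 / 2) * (1 - u) powr (\<nu> - 1 / 2) * exp (- (\<mu> * u)))
      \<le> indicator {0<..} u * (u powr (- 1 / 2) * exp (- (\<mu> * u)))"
      using assms by (auto split: split_indicator intro!: mult_left_le powr_le1)
  qed
  also have "\<dots> = ennreal (sqrt (pi / \<mu>))"
    by (rule nn_integral_powr_half_exp[OF assms(2)])
  finally have "ennreal (sqrt (\<mu> / pi)) * half_mass \<nu> \<mu> \<le> ennreal (sqrt (\<mu> / pi)) * ennreal (sqrt (pi / \<mu>))"
    by (rule mult_left_mono) simp
  also have "\<dots> = 1"
    using assms by (simp add: ennreal_mult[symmetric] real_sqrt_mult[symmetric])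
  finally show ?thesis .
qed

text \<open>For \<nu> < 1/2 the weight is singular at u = 1, but integrable. Below u = 1/2 the
  singular factor is at most 2, since its exponent exceeds -1. Above u = 1/2 the exponential is at
  most exp (-\<mu>/2), which absorbs the prefactor sqrt (\<mu>/pi) and leaves a Beta integral
  independent of \<mu>.\<close>

lemma half_mass_bounded:
  assumes "\<nu> > - 1 / 2"
  obtains c where "c > 1" "\<And>\<mu>. \<mu> > 0 \<Longrightarrow> ennreal (sqrt (\<mu> / pi)) * half_mass \<nu> \<mu> \<le> ennreal c"
proof (cases "\<nu> \<ge> 1 / 2")
  case True
  then show ?thesis
    by (intro that[of 2] order_trans[OF half_mass_le_1[OF True]]) simp_all
next
  case False
  define B where "B = Beta 1 (\<nu> + 1 / 2)"
  have B: "B > 0"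
    using assms unfolding B_def Beta_def by (intro divide_pos_pos mult_pos_pos Gamma_real_pos) auto
  have *: "ennreal (sqrt (\<mu> / pi)) * half_mass \<nu> \<mu> \<le> ennreal (2 + sqrt 2 * B)" if \<mu>: "\<mu> > 0" for \<mu>
  proof -
    have "half_mass \<nu> \<mu> \<le> (\<integral>\<^sup>+u. ennreal 2 * ennreal (indicator {0<..} u * (u powr (- 1 / 2) * exp (- (\<mu> * u))))
       + ennreal (sqrt 2 * exp (- (\<mu> / 2))) * ennreal (indicator {0<..<1} u * (u powr (1 - 1) * (1 - u) powr (\<nu> + 1 / 2 - 1))) \<partial>lborel)"
      unfolding half_mass_def
    proof (intro nn_integral_mono)
      fix u :: real
      have "indicator {0<..<1} u * (u powr (- 1 / 2) * (1 - u) powr (\<nu> - 1 / 2) * exp (- (\<mu> * u)))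
        \<le> 2 * (indicator {0<..} u * (u powr (- 1 / 2) * exp (- (\<mu> * u))))
        + sqrt 2 * exp (- (\<mu> / 2)) * (indicator {0<..<1} u * (u powr (1 - 1) * (1 - u) powr (\<nu> + 1 / 2 - 1)))"
      proof (cases "0 < u \<and> u < 1")
        case True
        show ?thesis
        proof (cases "u \<le> 1 / 2")
          case u: True
          have "(1 - u) powr (\<nu> - 1 / 2) \<le> (1 / 2) powr (\<nu> - 1 / 2)"
            using u \<open>\<not> \<nu> \<ge> 1 / 2\<close> by (intro powr_mono2') auto
          also have "\<dots> \<le> (1 / 2) powr (-1)"
            using assms by (intro powr_mono') auto
          finally have "(1 - u) powr (\<nu> - 1 / 2) \<le> 2" by (simp add: powr_minus)
          then have "u powr (- 1 / 2) * (1 - u) powr (\<nu> - 1 / 2) * exp (- (\<mu> * u)) \<le> u powr (- 1 / 2) * 2 * exp (- (\<mu> * u))"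
            by (intro mult_right_mono mult_left_mono) auto
          then show ?thesis using True by (simp add: add_increasing2)
        next
          case u: False
          have "u powr (- 1 / 2) \<le> (1 / 2) powr (- 1 / 2)"
            using u by (intro powr_mono2') auto
          also have "\<dots> = sqrt 2" by (simp add: powr_minus powr_half_sqrt powr_divide real_sqrt_divide)
          finally have "u powr (- 1 / 2) * (1 - u) powr (\<nu> - 1 / 2) * exp (- (\<mu> * u)) \<le> sqrt 2 * (1 - u) powr (\<nu> - 1 / 2) * exp (- (\<mu> / 2))"
            using u \<mu> by (intro mult_mono) (auto simp: field_simps)
          then show ?thesis using True by (simp add: add_increasing mult_ac)
        qed
      qed auto
      then show "ennreal (indicator {0<..<1} u * (u powr (- 1 / 2) * (1 - u) powr (\<nu> - 1 / 2) * exp (- (\<mu> * u))))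
        \<le> ennreal 2 * ennreal (indicator {0<..} u * (u powr (- 1 / 2) * exp (- (\<mu> * u))))
        + ennreal (sqrt 2 * exp (- (\<mu> / 2))) * ennreal (indicator {0<..<1} u * (u powr (1 - 1) * (1 - u) powr (\<nu> + 1 / 2 - 1)))"
        by (rule ennreal_le_linear_combination) auto
    qed
    also have "\<dots> = ennreal 2 * ennreal (sqrt (pi / \<mu>)) + ennreal (sqrt 2 * exp (- (\<mu> / 2))) * ennreal B"
    proof -
      have "(\<integral>\<^sup>+u. ennreal (indicator {0<..<1} u * (u powr (1 - 1) * (1 - u) powr (\<nu> + 1 / 2 - 1))) \<partial>lborel) = ennreal B"
        using assms unfolding B_def by (intro nn_integral_Beta) auto
      then show ?thesis
        by (subst nn_integral_add, simp, simp, subst (1 2) nn_integral_cmult, simp, simp)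
          (simp only: nn_integral_powr_half_exp[OF \<mu>])
    qed
    also have "\<dots> = ennreal (2 * sqrt (pi / \<mu>) + sqrt 2 * exp (- (\<mu> / 2)) * B)"
      using B \<mu> by (simp add: ennreal_mult'[symmetric] del: ennreal_numeral)
    finally have "ennreal (sqrt (\<mu> / pi)) * half_mass \<nu> \<mu> \<le> ennreal (sqrt (\<mu> / pi)) * ennreal (2 * sqrt (pi / \<mu>) + sqrt 2 * exp (- (\<mu> / 2)) * B)"
      by (rule mult_left_mono) simp
    also have "\<dots> = ennreal (sqrt (\<mu> / pi) * (2 * sqrt (pi / \<mu>) + sqrt 2 * exp (- (\<mu> / 2)) * B))"
      using \<mu> by (intro ennreal_mult'[symmetric]) simp
    also have "\<dots> \<le> ennreal (2 + sqrt 2 * B)"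
    proof (rule ennreal_leI)
      have "sqrt (\<mu> / pi) * sqrt (pi / \<mu>) = 1"
        using \<mu> by (simp add: real_sqrt_mult[symmetric])
      moreover have "sqrt (\<mu> / pi) * exp (- (\<mu> / 2)) \<le> 1"
      proof -
        have "\<mu> / pi \<le> \<mu> / 1" using \<mu> pi_ge_two by (intro divide_left_mono) auto
        then have "\<mu> / pi \<le> \<mu>" by simp
        also have "\<dots> \<le> exp \<mu>" using exp_ge_add_one_self[of \<mu>] by linarith
        also have "\<dots> = (exp (\<mu> / 2))\<^sup>2" by (simp add: exp_double[symmetric])
        finally have "sqrt (\<mu> / pi) \<le> exp (\<mu> / 2)" by (intro real_le_lsqrt) auto
        then show ?thesis by (simp add: exp_minus field_simps)
      qed
      then have "sqrt (\<mu> / pi) * exp (- (\<mu> / 2)) * (sqrt 2 * B) \<le> 1 * (sqrt 2 * B)"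
        using B by (intro mult_right_mono) auto
      ultimately show "sqrt (\<mu> / pi) * (2 * sqrt (pi / \<mu>) + sqrt 2 * exp (- (\<mu> / 2)) * B) \<le> 2 + sqrt 2 * B"
        by (simp add: distrib_left mult_ac)
    qed
    finally show ?thesis .
  qed
  have "0 < sqrt 2 * B" using B by simp
  then show ?thesis by (intro that[OF _ *]) linarith+
qed


text \<open>With a = 1/2 - \<nu>, (1 - u)^(-a) \<ge> exp (a u) \<ge> 1 + a u on (0,1). Over the
  whole half-line the minorant integrates, after normalisation, to 1 + a / (2 \<mu>); the part
  beyond u = 1 stands on the right as an error term, which avoids subtraction.\<close>

lemma half_mass_lower_bound:
  assumes "\<nu> < 1 / 2" "\<mu> \<ge> 1"
  shows "ennreal (1 + (1 / 2 - \<nu>) / (2 * \<mu>)) \<le> ennreal (sqrt (\<mu> / pi)) * half_mass \<nu> \<mu> + ennreal (max 1 (1 / 2 - \<nu>) * (sqrt \<mu> * exp (1 - \<mu>)))"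
proof -
  define a where "a = 1 / 2 - \<nu>"
  \<comment> \<open>Ensures 1 + a u \<le> 2 C u on the tail u \<ge> 1.\<close>
  define C where "C = max 1 a"
  have a: "a > 0" using assms by (simp add: a_def)
  have C: "C \<ge> 1" "C \<ge> a" by (simp_all add: C_def)
  have \<mu>: "\<mu> > 0" using assms by simp
  have G32: "Gamma (3 / 2 :: real) = sqrt pi / 2"
    using Gamma_plus1[of "1 / 2 :: real"] nonpos_Ints_nonpos[of "1 / 2 :: real"] by (auto simp: Gamma_one_half_real)
  let ?f = "\<lambda>u::real. indicator {0<..} u * (u powr (- 1 / 2) * exp (- (\<mu> * u)))"
  let ?g = "\<lambda>p u::real. indicator {0<..} u * (u powr (3 / 2 - 1) * exp (- (p * u)))"
  let ?h = "\<lambda>u. indicator {0<..<1} u * (u powr (- 1 / 2) * (1 - u) powr (\<nu> - 1 / 2) * exp (- (\<mu> * u)))"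
  have "ennreal (sqrt (pi / \<mu>)) + ennreal a * ennreal (sqrt pi / 2 / \<mu> powr (3 / 2))
      = (\<integral>\<^sup>+u. ennreal (?f u) + ennreal a * ennreal (?g \<mu> u) \<partial>lborel)"
  proof -
    have "(\<integral>\<^sup>+u. ennreal (?f u) \<partial>lborel) = ennreal (sqrt (pi / \<mu>))"
      using \<mu> by (rule nn_integral_powr_half_exp)
    moreover have "(\<integral>\<^sup>+u. ennreal (?g \<mu> u) \<partial>lborel) = ennreal (sqrt pi / 2 / \<mu> powr (3 / 2))"
      using \<mu> by (subst nn_integral_Gamma_scaled) (simp_all add: G32)
    ultimately show ?thesis
      by (subst nn_integral_add, simp, simp, subst nn_integral_cmult, simp) (simp only:)
  qed
  also have "\<dots> \<le> (\<integral>\<^sup>+u. ennreal (?h u) + ennreal (2 * C * exp (1 - \<mu>)) * ennreal (?g 1 u) \<partial>lborel)"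
  proof (rule nn_integral_mono)
    fix u :: real
    have "?f u + a * ?g \<mu> u \<le> ?h u + 2 * C * exp (1 - \<mu>) * ?g 1 u"
    proof (cases "u > 0")
      case u: True
      have "u powr (3 / 2 - 1) = u powr (- 1 / 2) * u"
        using u powr_add[of u "- 1 / 2" 1] by simp
      then have fg: "?f u + a * ?g \<mu> u = u powr (- 1 / 2) * (1 + a * u) * exp (- (\<mu> * u))"
        using u by (simp add: algebra_simps)
      show ?thesis
      proof (cases "u < 1")
        case True
        have "ln (1 - u) \<le> - u" using ln_le_minus_one[of "1 - u"] True by simp
        then have "a * ln (1 - u) \<le> a * (- u)" using a by (intro mult_left_mono) auto
        then have "a * u \<le> - a * ln (1 - u)" by simp
        then have "exp (a * u) \<le> (1 - u) powr (- a)" using True by (simp add: powr_def)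
        moreover have "- a = \<nu> - 1 / 2" by (simp add: a_def)
        ultimately have "exp (a * u) \<le> (1 - u) powr (\<nu> - 1 / 2)" by simp
        then have "1 + a * u \<le> (1 - u) powr (\<nu> - 1 / 2)"
          by (rule order_trans[OF exp_ge_add_one_self])
        then have "u powr (- 1 / 2) * (1 + a * u) * exp (- (\<mu> * u)) \<le> u powr (- 1 / 2) * (1 - u) powr (\<nu> - 1 / 2) * exp (- (\<mu> * u))"
          by (intro mult_right_mono mult_left_mono) auto
        also have "\<dots> = ?h u" using u True by simp
        also have "\<dots> \<le> ?h u + 2 * C * exp (1 - \<mu>) * ?g 1 u" using C by simp
        finally show ?thesis unfolding fg .
      next
        case False
        \<comment> \<open>On the tail, \<mu> u \<ge> (\<mu> - 1) + u: this splits off the small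
          factor exp (1 - \<mu>) and leaves an integrand of rate 1.\<close>
        have "(\<mu> - 1) * 1 \<le> (\<mu> - 1) * u" using False assms by (intro mult_left_mono) auto
        then have "exp (- (\<mu> * u)) \<le> exp (1 - \<mu>) * exp (- u)" by (simp add: mult_exp_exp algebra_simps)
        moreover have "1 + a * u \<le> 2 * C * u"
        proof -
          have "1 * 1 \<le> C * u" using C False by (intro mult_mono) auto
          moreover have "a * u \<le> C * u" using C u by (intro mult_right_mono) auto
          ultimately show ?thesis by (simp add: algebra_simps)
        qed
        ultimately have "u powr (- 1 / 2) * (1 + a * u) * exp (- (\<mu> * u)) \<le> u powr (- 1 / 2) * (2 * C * u) * (exp (1 - \<mu>) * exp (- u))"
          using u a C by (intro mult_mono) auto
        also have "\<dots> = 2 * C * exp (1 - \<mu>) * ?g 1 u"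
          using u \<open>u powr (3 / 2 - 1) = u powr (- 1 / 2) * u\<close> by (simp add: mult_ac)
        also have "\<dots> \<le> ?h u + 2 * C * exp (1 - \<mu>) * ?g 1 u"
          by simp
        finally show ?thesis unfolding fg .
      qed
    qed auto
    moreover have "?f u \<ge> 0" "?g p u \<ge> 0" "?h u \<ge> 0" for p by auto
    ultimately show "ennreal (?f u) + ennreal a * ennreal (?g \<mu> u) \<le> ennreal (?h u) + ennreal (2 * C * exp (1 - \<mu>)) * ennreal (?g 1 u)"
      using a C by (simp only: ennreal_mult[symmetric] ennreal_plus[symmetric] mult_nonneg_nonneg exp_ge_zero less_imp_le zero_le_numeral order_trans[OF zero_le_one] ennreal_leI)
  qed
  also have "\<dots> = half_mass \<nu> \<mu> + ennreal (2 * C * exp (1 - \<mu>)) * ennreal (sqrt pi / 2)"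
    unfolding half_mass_def by (subst nn_integral_add) (auto simp: nn_integral_cmult nn_integral_Gamma_scaled[of "3/2" 1, simplified] G32)
  finally have "ennreal (sqrt (\<mu> / pi)) * (ennreal (sqrt (pi / \<mu>)) + ennreal a * ennreal (sqrt pi / 2 / \<mu> powr (3 / 2)))
     \<le> ennreal (sqrt (\<mu> / pi)) * (half_mass \<nu> \<mu> + ennreal (2 * C * exp (1 - \<mu>)) * ennreal (sqrt pi / 2))"
    by (rule mult_left_mono) simp
  also have "\<dots> = ennreal (sqrt (\<mu> / pi)) * half_mass \<nu> \<mu> + ennreal (sqrt (\<mu> / pi)) * (ennreal (2 * C * exp (1 - \<mu>)) * ennreal (sqrt pi / 2))"
    by (rule distrib_left)
  also have "ennreal (sqrt (\<mu> / pi)) * (ennreal (2 * C * exp (1 - \<mu>)) * ennreal (sqrt pi / 2)) = ennreal (sqrt (\<mu> / pi) * (2 * C * exp (1 - \<mu>) * (sqrt pi / 2)))"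
    using C \<mu> by (simp add: ennreal_mult'[symmetric])
  also have "sqrt (\<mu> / pi) * (2 * C * exp (1 - \<mu>) * (sqrt pi / 2)) = C * (sqrt \<mu> * exp (1 - \<mu>))"
    by (simp add: real_sqrt_divide)
  also have "ennreal (sqrt (\<mu> / pi)) * (ennreal (sqrt (pi / \<mu>)) + ennreal a * ennreal (sqrt pi / 2 / \<mu> powr (3 / 2)))
     = ennreal (sqrt (\<mu> / pi) * (sqrt (pi / \<mu>) + a * (sqrt pi / 2 / \<mu> powr (3 / 2))))"
    using a \<mu> by (simp add: ennreal_mult'[symmetric] ennreal_plus[symmetric] del: ennreal_plus)
  also have "sqrt (\<mu> / pi) * (sqrt (pi / \<mu>) + a * (sqrt pi / 2 / \<mu> powr (3 / 2))) = 1 + a / (2 * \<mu>)"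
  proof -
    have "\<mu> powr (3 / 2) = \<mu> * sqrt \<mu>"
      using \<mu> powr_add[of \<mu> 1 "1 / 2"] by (simp add: powr_half_sqrt)
    then show ?thesis
      using \<mu> by (simp add: real_sqrt_divide distrib_left)
  qed
  finally show ?thesis unfolding a_def C_def .
qed

text \<open>For large \<mu> the error in \<open>half_mass_lower_bound\<close> is at most half of the
  gain a / (2 \<mu>); on the interval up to \<open>2 * \<mu>\<^sub>0\<close> the rest is at least
  \<open>a / (8 * \<mu>\<^sub>0)\<close>. A whole interval is wanted because the failure of
  contractivity must be seen on a set of positive measure.\<close>

lemma half_mass_gt_1:
  assumes "\<nu> < 1 / 2"
  obtains \<mu>\<^sub>0 \<delta> where "\<mu>\<^sub>0 > 0" "\<delta> > 0" "\<And>\<mu>. \<mu>\<^sub>0 \<le> \<mu> \<Longrightarrow> \<mu> \<le> 2 * \<mu>\<^sub>0 \<Longrightarrow> ennreal (1 + \<delta>) \<le> ennreal (sqrt (\<mu> / pi)) * half_mass \<nu> \<mu>"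
proof -
  define a where "a = 1 / 2 - \<nu>"
  define C where "C = max 1 a"
  have a: "a > 0" using assms by (simp add: a_def)
  have C: "C \<ge> 1" by (simp add: C_def)
  have "((\<lambda>\<mu>::real. \<mu> ^ 2 / exp \<mu>) \<longlongrightarrow> 0) at_top"
    by (rule tendsto_power_div_exp_0)
  \<comment> \<open>This threshold, multiplied by C exp 1 / \<mu>, is a / (4 \<mu>).\<close>
  then have "eventually (\<lambda>\<mu>::real. \<mu> ^ 2 / exp \<mu> < a / (4 * C * exp 1)) at_top"
    using a C by (intro order_tendstoD) auto
  then obtain N where N: "\<And>\<mu>::real. \<mu> \<ge> N \<Longrightarrow> \<mu> ^ 2 / exp \<mu> < a / (4 * C * exp 1)"
    by (auto simp: eventually_at_top_linorder)
  define \<mu>\<^sub>0 where "\<mu>\<^sub>0 = max 1 N"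
  have \<mu>0: "\<mu>\<^sub>0 \<ge> 1" by (simp add: \<mu>\<^sub>0_def)
  show ?thesis
  proof (rule that)
    show "\<mu>\<^sub>0 > 0" "a / (8 * \<mu>\<^sub>0) > 0" using a \<mu>0 by auto
    fix \<mu> assume m: "\<mu>\<^sub>0 \<le> \<mu>" "\<mu> \<le> 2 * \<mu>\<^sub>0"
    then have \<mu>: "\<mu> \<ge> 1" using \<mu>0 by simp
    have "sqrt \<mu> \<le> \<mu>" using \<mu> by (intro real_le_lsqrt) (auto simp: power2_eq_square)
    then have "\<mu> * sqrt \<mu> * exp (- \<mu>) \<le> \<mu> * \<mu> * exp (- \<mu>)"
      using \<mu> by (intro mult_right_mono mult_left_mono) auto
    also have "\<dots> = \<mu> ^ 2 / exp \<mu>" by (simp add: exp_minus field_simps power2_eq_square)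
    also have "\<dots> < a / (4 * C * exp 1)" using m by (intro N) (simp add: \<mu>\<^sub>0_def)
    finally have "C * exp 1 * (\<mu> * sqrt \<mu> * exp (- \<mu>)) \<le> C * exp 1 * (a / (4 * C * exp 1))"
      using C by (intro mult_left_mono) auto
    also have "\<dots> = a / 4" using C by simp
    also have "C * exp 1 * (\<mu> * sqrt \<mu> * exp (- \<mu>)) = \<mu> * (C * (sqrt \<mu> * exp (1 - \<mu>)))"
      by (simp add: exp_diff exp_minus field_simps)
    finally have small: "C * (sqrt \<mu> * exp (1 - \<mu>)) \<le> a / (4 * \<mu>)"
      using \<mu> by (simp add: field_simps)
    have "a / (8 * \<mu>\<^sub>0) \<le> a / (4 * \<mu>)"
      using a m \<mu> by (intro divide_left_mono) auto
    with small have *: "1 + a / (8 * \<mu>\<^sub>0) + C * (sqrt \<mu> * exp (1 - \<mu>)) \<le> 1 + a / (2 * \<mu>)"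
      by simp
    have "ennreal (1 + a / (8 * \<mu>\<^sub>0)) + ennreal (C * (sqrt \<mu> * exp (1 - \<mu>))) = ennreal (1 + a / (8 * \<mu>\<^sub>0) + C * (sqrt \<mu> * exp (1 - \<mu>)))"
      using a \<mu>0 \<mu> C by (intro ennreal_plus[symmetric]) auto
    also have "\<dots> \<le> ennreal (1 + a / (2 * \<mu>))"
      using * by (rule ennreal_leI)
    also have "\<dots> \<le> ennreal (sqrt (\<mu> / pi)) * half_mass \<nu> \<mu> + ennreal (C * (sqrt \<mu> * exp (1 - \<mu>)))"
      using half_mass_lower_bound[OF assms \<mu>] unfolding a_def C_def .
    finally show "ennreal (1 + a / (8 * \<mu>\<^sub>0)) \<le> ennreal (sqrt (\<mu> / pi)) * half_mass \<nu> \<mu>"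
      unfolding add.commute[of _ "ennreal (C * (sqrt \<mu> * exp (1 - \<mu>)))"]
      by (simp add: ennreal_add_left_cancel_le)
  qed
qed

section \<open>Symmetric kernel operators\<close>

text \<open>Holds for every f: when f is not integrable, the integral on the left takes its default
  value 0.\<close>

lemma ennreal_abs_lebesgue_integral_le:
  fixes f :: "'a \<Rightarrow> real"
  shows "ennreal \<bar>LINT x|M. f x\<bar> \<le> (\<integral>\<^sup>+x. ennreal \<bar>f x\<bar> \<partial>M)"
proof (cases "integrable M f")
  case True
  then show ?thesis using integral_norm_bound_ennreal[of M f] by simp
qed (simp add: not_integrable_integral_eq)

text \<open>Convexity of the power in tangent form at s, obtained from Young's inequality with
  weights 1/r and 1 - 1/r.\<close>

lemma powr_ge_tangent:
  fixes u s r :: real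
  assumes "u \<ge> 0" "s > 0" "r \<ge> 1"
  shows "r * s powr (r - 1) * u \<le> u powr r + (r - 1) * s powr r"
proof (cases "u = 0")
  case True
  then show ?thesis using assms by simp
next
  case False
  then have "(u powr r) powr (1 / r) * (s powr r) powr (1 - 1 / r) \<le> 1 / r * (u powr r) + (1 - 1 / r) * s powr r"
    using assms by (intro Youngs_inequality_0) auto
  then have "u * s powr (r - 1) \<le> 1 / r * (u powr r) + (1 - 1 / r) * s powr r"
    using assms False by (simp add: powr_powr right_diff_distrib)
  then have "r * (u * s powr (r - 1)) \<le> r * (1 / r * (u powr r) + (1 - 1 / r) * s powr r)"
    using assms by (intro mult_left_mono) auto
  then show ?thesis using assms by (simp add: algebra_simps)
qed

text \<open>Integrate the tangent line of \<open>u \<mapsto> u powr r\<close> at the weighted mean.\<close>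

lemma weighted_Jensen:
  fixes k u :: "'a \<Rightarrow> real"
  assumes [measurable]: "k \<in> borel_measurable M" "u \<in> borel_measurable M"
    and k: "\<And>y. y \<in> space M \<Longrightarrow> k y \<ge> 0"
    and C: "(\<integral>\<^sup>+y. ennreal (k y) \<partial>M) \<le> ennreal C" "C > 0" and r: "r \<ge> 1"
  shows "ennreal (\<bar>LINT y|M. k y * u y\<bar> powr r) \<le> ennreal (C powr (r - 1)) * (\<integral>\<^sup>+y. ennreal (k y * \<bar>u y\<bar> powr r) \<partial>M)"
proof (cases "(\<integral>\<^sup>+y. ennreal \<bar>k y * u y\<bar> \<partial>M)")
  case top
  \<comment> \<open>The Bochner integral is then 0 by convention and the bound is trivial.\<close>
  then have "\<not> integrable M (\<lambda>y. k y * u y)"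
    by (auto simp: integrable_iff_bounded)
  then show ?thesis using r by (simp add: not_integrable_integral_eq)
next
  case (real A)
  \<comment> \<open>The mean of |u| for the weight k normalised by C. C only dominates the mass of
    k, but the mass occurs in the tangent bound with the coefficient (r - 1) s^r \<ge> 0, so
    replacing it by C goes in the right direction.\<close>
  define s where "s = A / C"
  have le: "\<bar>LINT y|M. k y * u y\<bar> \<le> A"
    using ennreal_abs_lebesgue_integral_le[of M "\<lambda>y. k y * u y"] real by simp
  show ?thesis
  proof (cases "A = 0")
    case True
    then show ?thesis using le r by simp
  next
    case False
    with real C have s: "s > 0" by (simp add: s_def)
    define B where "B = (\<integral>\<^sup>+y. ennreal (k y * \<bar>u y\<bar> powr r) \<partial>M)"
    have rA: "ennreal (r * s powr (r - 1) * A) = (\<integral>\<^sup>+y. ennreal (r * s powr (r - 1)) * ennreal \<bar>k y * u y\<bar> \<partial>M)"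
      using r real by (simp add: nn_integral_cmult ennreal_mult')
    also have "\<dots> \<le> (\<integral>\<^sup>+y. ennreal (k y * \<bar>u y\<bar> powr r) + ennreal ((r - 1) * s powr r) * ennreal (k y) \<partial>M)"
    proof (rule nn_integral_mono)
      fix y assume y: "y \<in> space M"
      have "k y * (r * s powr (r - 1) * \<bar>u y\<bar>) \<le> k y * (\<bar>u y\<bar> powr r + (r - 1) * s powr r)"
        using r s k[OF y] by (intro mult_left_mono powr_ge_tangent) auto
      then have "r * s powr (r - 1) * \<bar>k y * u y\<bar> \<le> k y * \<bar>u y\<bar> powr r + (r - 1) * s powr r * k y"
        using k[OF y] by (simp add: abs_mult algebra_simps)
      then have "ennreal (r * s powr (r - 1) * \<bar>k y * u y\<bar>) \<le> ennreal (k y * \<bar>u y\<bar> powr r + (r - 1) * s powr r * k y)"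
        by (rule ennreal_leI)
      then show "ennreal (r * s powr (r - 1)) * ennreal \<bar>k y * u y\<bar> \<le> ennreal (k y * \<bar>u y\<bar> powr r) + ennreal ((r - 1) * s powr r) * ennreal (k y)"
        using k[OF y] r by (simp add: ennreal_mult)
    qed
    also have "\<dots> = B + ennreal ((r - 1) * s powr r) * (\<integral>\<^sup>+y. ennreal (k y) \<partial>M)"
      unfolding B_def by (simp add: nn_integral_add nn_integral_cmult)
    also have "\<dots> \<le> B + ennreal ((r - 1) * s powr r) * ennreal C"
      using C by (intro add_left_mono mult_left_mono) auto
    also have "\<dots> = B + ennreal ((r - 1) * s powr r * C)"
      using r C by (simp add: ennreal_mult)
    finally have *: "ennreal (r * s powr (r - 1) * A) \<le> B + ennreal ((r - 1) * s powr r * C)" .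
    have sA: "s powr (r - 1) * A = s powr r * C"
    proof -
      have "A = s * C" using C by (simp add: s_def)
      then show ?thesis using s by (simp add: powr_diff)
    qed
    have "r * s powr (r - 1) * A = s powr r * C + (r - 1) * s powr r * C"
      unfolding mult.assoc[of r] sA by (simp add: algebra_simps)
    with * have "ennreal (s powr r * C) + ennreal ((r - 1) * s powr r * C) \<le> B + ennreal ((r - 1) * s powr r * C)"
      using r C(2) by (subst ennreal_plus[symmetric]) auto
    then have sB: "ennreal (s powr r * C) \<le> B"
      unfolding add.commute[of _ "ennreal ((r - 1) * s powr r * C)"] by (simp add: ennreal_add_left_cancel_le)
    have "A powr r = C powr (r - 1) * (s powr r * C)"
    proof -
      have "A = s * C" using C by (simp add: s_def)
      then show ?thesis using s C by (simp add: powr_mult powr_diff)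
    qed
    then have "ennreal (\<bar>LINT y|M. k y * u y\<bar> powr r) \<le> ennreal (C powr (r - 1) * (s powr r * C))"
      using le r by (intro ennreal_leI) (metis abs_ge_zero order.trans powr_mono2 zero_le_one)
    also have "\<dots> = ennreal (C powr (r - 1)) * ennreal (s powr r * C)"
      by (simp add: ennreal_mult')
    also have "\<dots> \<le> ennreal (C powr (r - 1)) * B"
      using sB by (rule mult_left_mono) simp
    finally show ?thesis unfolding B_def .
  qed
qed

section \<open>L^p membership and norms through nonnegative integrals\<close>

lemma Lp_norm_finite_exponent:
  assumes "p < \<infinity>"
  shows "Lp_norm M p f = (if (\<integral>\<^sup>+x. ennreal (\<bar>f x\<bar> powr enn2real p) \<partial>M) = \<infinity> then \<infinity>
    else ennreal (enn2real (\<integral>\<^sup>+x. ennreal (\<bar>f x\<bar> powr enn2real p) \<partial>M) powr (1 / enn2real p)))"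
  using assms unfolding Lp_norm_def by (auto simp: Let_def)

lemma enn2real_ge_1: "1 \<le> p \<Longrightarrow> p < \<infinity> \<Longrightarrow> 1 \<le> enn2real p"
  by (cases p) (auto simp: top_unique)

lemma Lp_norm_less_top_iff:
  "p < \<infinity> \<Longrightarrow> Lp_norm M p f < \<infinity> \<longleftrightarrow> (\<integral>\<^sup>+x. ennreal (\<bar>f x\<bar> powr enn2real p) \<partial>M) < \<infinity>"
  by (simp add: Lp_norm_finite_exponent less_top)

lemma mem_Lp_2_iff:
  "f \<in> Lp M 2 \<longleftrightarrow> f \<in> borel_measurable M \<and> (\<integral>\<^sup>+x. ennreal ((f x)\<^sup>2) \<partial>M) < \<infinity>"
  unfolding Lp_def using Lp_norm_less_top_iff[of 2 M f] by simp

lemma Lp_top_bounded: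
  assumes "f \<in> Lp M \<infinity>"
  obtains E where "E \<ge> 0" "Lp_norm M \<infinity> f = ennreal E" "AE x in M. \<bar>f x\<bar> \<le> E"
proof -
  have "esssup M (\<lambda>x. ennreal \<bar>f x\<bar>) < \<infinity>"
    using assms by (simp add: Lp_def Lp_norm_def)
  then obtain E where E: "E \<ge> 0" "esssup M (\<lambda>x. ennreal \<bar>f x\<bar>) = ennreal E"
    by (cases "esssup M (\<lambda>x. ennreal \<bar>f x\<bar>)") auto
  have "AE x in M. \<bar>f x\<bar> \<le> E"
    using esssup_AE[of "\<lambda>x. ennreal \<bar>f x\<bar>" M] E by (auto elim!: eventually_mono)
  then show ?thesis using E by (intro that[of E]) (auto simp: Lp_norm_def)
qed

text \<open>\<open>Lp_norm\<close> takes the root through \<open>enn2real\<close>, which is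
  continuous only at finite values; the integrals are eventually finite because their limit
  is.\<close>

lemma tendsto_Lp_norm_2_zero:
  assumes "((\<lambda>t. \<integral>\<^sup>+x. ennreal ((h t x)\<^sup>2) \<partial>M) \<longlongrightarrow> 0) F"
  shows "((\<lambda>t. Lp_norm M 2 (h t)) \<longlongrightarrow> 0) F"
proof -
  define I where "I t = (\<integral>\<^sup>+x. ennreal ((h t x)\<^sup>2) \<partial>M)" for t
  have I: "(I \<longlongrightarrow> 0) F" using assms unfolding I_def .
  have "((\<lambda>t. enn2real (I t)) \<longlongrightarrow> 0) F"
    by (rule tendsto_enn2real[OF I[folded ennreal_0]]) simp
  then have "((\<lambda>t. ennreal (sqrt (enn2real (I t)))) \<longlongrightarrow> ennreal (sqrt 0)) F"
    by (intro tendsto_ennrealI tendsto_real_sqrt)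
  moreover have "eventually (\<lambda>t. ennreal (sqrt (enn2real (I t))) = Lp_norm M 2 (h t)) F"
  proof -
    have "eventually (\<lambda>t. I t < \<infinity>) F" by (rule order_tendstoD(2)[OF I]) simp
    then show ?thesis
      by eventually_elim (simp add: I_def Lp_norm_finite_exponent powr_half_sqrt)
  qed
  ultimately show ?thesis
    by (simp add: Lim_transform_eventually)
qed

lemma tendsto_ennreal_zero_le:
  fixes f g :: "'a \<Rightarrow> ennreal"
  assumes "(g \<longlongrightarrow> 0) F" "eventually (\<lambda>x. f x \<le> g x) F"
  shows "(f \<longlongrightarrow> 0) F"
  using assms by (intro tendsto_sandwich[of "\<lambda>_. 0" f F g]) auto

text \<open>The setting of the Schur test: by symmetry the bound on row masses is also one on column
  masses. Conditions at points are confined to \<open>space M\<close>, since the Laguerre kernels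
  are controlled on the open orthant only.\<close>

locale symmetric_kernel = sigma_finite_measure M for M :: "'a measure" +
  fixes K :: "'a \<Rightarrow> 'a \<Rightarrow> real" and C :: real
  assumes kernel_measurable: "case_prod K \<in> borel_measurable (M \<Otimes>\<^sub>M M)"
    and kernel_sym: "\<And>x y. x \<in> space M \<Longrightarrow> y \<in> space M \<Longrightarrow> K x y = K y x"
    and kernel_nonneg: "\<And>x y. x \<in> space M \<Longrightarrow> y \<in> space M \<Longrightarrow> 0 \<le> K x y"
    and kernel_mass: "\<And>x. x \<in> space M \<Longrightarrow> (\<integral>\<^sup>+y. ennreal (K x y) \<partial>M) \<le> ennreal C"
    and C_pos: "0 < C"
begin

sublocale pair: pair_sigma_finite M M ..

definition op :: "('a \<Rightarrow> real) \<Rightarrow> 'a \<Rightarrow> real" where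
  "op f x = (LINT y|M. K x y * f y)"

lemma kernel_measurable'[measurable]: "(\<lambda>z. K (fst z) (snd z)) \<in> borel_measurable (M \<Otimes>\<^sub>M M)"
  using kernel_measurable by (simp add: case_prod_unfold)

lemma kernel_measurable_row: "x \<in> space M \<Longrightarrow> K x \<in> borel_measurable M"
  using measurable_Pair2[OF kernel_measurable] by simp

lemma op_measurable:
  assumes [measurable]: "f \<in> borel_measurable M"
  shows "op f \<in> borel_measurable M"
  unfolding op_def[abs_def]
  by (rule borel_measurable_lebesgue_integral) (simp add: case_prod_unfold)

text \<open>Tonelli and symmetry turn the row bound into a column bound. This is where symmetry
  enters the L^p estimates.\<close>

lemma nn_integral_weighted_rows:
  fixes u :: "'a \<Rightarrow> ennreal"
  assumes [measurable]: "u \<in> borel_measurable M"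
  shows "(\<integral>\<^sup>+x. \<integral>\<^sup>+y. ennreal (K x y) * u y \<partial>M \<partial>M) \<le> ennreal C * (\<integral>\<^sup>+y. u y \<partial>M)"
proof -
  have "(\<integral>\<^sup>+x. \<integral>\<^sup>+y. ennreal (K x y) * u y \<partial>M \<partial>M) = (\<integral>\<^sup>+y. \<integral>\<^sup>+x. ennreal (K x y) * u y \<partial>M \<partial>M)"
    by (rule pair.Fubini'[symmetric]) (simp add: case_prod_unfold)
  also have "\<dots> = (\<integral>\<^sup>+y. (\<integral>\<^sup>+x. ennreal (K y x) \<partial>M) * u y \<partial>M)"
  proof (rule nn_integral_cong)
    fix y assume y: "y \<in> space M"
    note kernel_measurable_row[OF y, measurable]
    have "(\<integral>\<^sup>+x. ennreal (K x y) * u y \<partial>M) = (\<integral>\<^sup>+x. ennreal (K y x) * u y \<partial>M)"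
      using y by (intro nn_integral_cong) (simp add: kernel_sym)
    also have "\<dots> = (\<integral>\<^sup>+x. ennreal (K y x) \<partial>M) * u y"
      by (rule nn_integral_multc) simp
    finally show "(\<integral>\<^sup>+x. ennreal (K x y) * u y \<partial>M) = (\<integral>\<^sup>+x. ennreal (K y x) \<partial>M) * u y" .
  qed
  also have "\<dots> \<le> (\<integral>\<^sup>+y. ennreal C * u y \<partial>M)"
    by (intro nn_integral_mono mult_right_mono kernel_mass) auto
  also have "\<dots> = ennreal C * (\<integral>\<^sup>+y. u y \<partial>M)"
    by (rule nn_integral_cmult) simp
  finally show ?thesis .
qed

text \<open>Jensen's inequality at each x, then integration over x: the factors C^(r-1) and C
  combine. Jensen's bound covers divergent rows too, so no convergence has to be settled
  first.\<close>

lemma op_power_bound: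
  assumes [measurable]: "f \<in> borel_measurable M" and r: "r \<ge> 1"
  shows "(\<integral>\<^sup>+x. ennreal (\<bar>op f x\<bar> powr r) \<partial>M) \<le> ennreal (C powr r) * (\<integral>\<^sup>+x. ennreal (\<bar>f x\<bar> powr r) \<partial>M)"
proof -
  have "(\<integral>\<^sup>+x. ennreal (\<bar>op f x\<bar> powr r) \<partial>M)
     \<le> (\<integral>\<^sup>+x. ennreal (C powr (r - 1)) * (\<integral>\<^sup>+y. ennreal (K x y) * ennreal (\<bar>f y\<bar> powr r) \<partial>M) \<partial>M)"
  proof (rule nn_integral_mono)
    fix x assume x: "x \<in> space M"
    note kernel_measurable_row[OF x, measurable]
    have "ennreal (\<bar>op f x\<bar> powr r) \<le> ennreal (C powr (r - 1)) * (\<integral>\<^sup>+y. ennreal (K x y * \<bar>f y\<bar> powr r) \<partial>M)"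
      unfolding op_def using x r C_pos by (intro weighted_Jensen kernel_nonneg kernel_mass) auto
    also have "(\<integral>\<^sup>+y. ennreal (K x y * \<bar>f y\<bar> powr r) \<partial>M) = (\<integral>\<^sup>+y. ennreal (K x y) * ennreal (\<bar>f y\<bar> powr r) \<partial>M)"
      using x by (intro nn_integral_cong ennreal_mult kernel_nonneg) auto
    finally show "ennreal (\<bar>op f x\<bar> powr r) \<le> ennreal (C powr (r - 1)) * (\<integral>\<^sup>+y. ennreal (K x y) * ennreal (\<bar>f y\<bar> powr r) \<partial>M)" .
  qed
  also have "\<dots> = ennreal (C powr (r - 1)) * (\<integral>\<^sup>+x. \<integral>\<^sup>+y. ennreal (K x y) * ennreal (\<bar>f y\<bar> powr r) \<partial>M \<partial>M)"
    by (rule nn_integral_cmult) measurable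
  also have "\<dots> \<le> ennreal (C powr (r - 1)) * (ennreal C * (\<integral>\<^sup>+y. ennreal (\<bar>f y\<bar> powr r) \<partial>M))"
    by (intro mult_left_mono nn_integral_weighted_rows) auto
  also have "\<dots> = ennreal (C powr r) * (\<integral>\<^sup>+x. ennreal (\<bar>f x\<bar> powr r) \<partial>M)"
    using C_pos by (simp add: mult.assoc[symmetric] ennreal_mult[symmetric] powr_diff)
  finally show ?thesis .
qed

lemma op_sup_bound:
  assumes "AE y in M. \<bar>f y\<bar> \<le> E" "E \<ge> 0" "x \<in> space M"
  shows "\<bar>op f x\<bar> \<le> C * E"
proof -
  note kernel_measurable_row[OF assms(3), measurable]
  have "ennreal \<bar>op f x\<bar> \<le> (\<integral>\<^sup>+y. ennreal \<bar>K x y * f y\<bar> \<partial>M)"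
    unfolding op_def by (rule ennreal_abs_lebesgue_integral_le)
  also have "\<dots> \<le> (\<integral>\<^sup>+y. ennreal (K x y) * ennreal E \<partial>M)"
    using assms(1) AE_space
  proof (intro nn_integral_mono_AE, eventually_elim)
    fix y assume "\<bar>f y\<bar> \<le> E" "y \<in> space M"
    then show "ennreal \<bar>K x y * f y\<bar> \<le> ennreal (K x y) * ennreal E"
      using kernel_nonneg[OF assms(3), of y] assms(2)
      by (simp add: ennreal_mult[symmetric] abs_mult mult_left_mono ennreal_leI)
  qed
  also have "\<dots> \<le> ennreal C * ennreal E"
    using assms by (subst nn_integral_multc) (auto intro!: mult_right_mono kernel_mass)
  also have "\<dots> = ennreal (C * E)"
    using C_pos assms by (simp add: ennreal_mult)
  finally show ?thesis using C_pos assms by simp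
qed

lemma op_Lp_bound:
  assumes f: "f \<in> Lp M p" and p: "p \<ge> 1"
  shows "op f \<in> Lp M p" "Lp_norm M p (op f) \<le> ennreal C * Lp_norm M p f"
proof -
  have fm[measurable]: "f \<in> borel_measurable M" using f by (simp add: Lp_def)
  have om[measurable]: "op f \<in> borel_measurable M" by (rule op_measurable) fact
  show 1: "Lp_norm M p (op f) \<le> ennreal C * Lp_norm M p f"
  proof (cases "p = \<infinity>")
    case True
    obtain E where E: "E \<ge> 0" "Lp_norm M \<infinity> f = ennreal E" "AE x in M. \<bar>f x\<bar> \<le> E"
      using f unfolding True by (rule Lp_top_bounded)
    have "AE x in M. ennreal \<bar>op f x\<bar> \<le> ennreal (C * E)"
      by (rule AE_I2) (intro ennreal_leI op_sup_bound[OF E(3,1)])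
    then have "esssup M (\<lambda>x. ennreal \<bar>op f x\<bar>) \<le> ennreal (C * E)"
      by (intro esssup_I) simp
    then show ?thesis
      using E C_pos by (simp add: True Lp_norm_def ennreal_mult)
  next
    case False
    then have pf: "p < \<infinity>" by (simp add: less_top)
    define r where "r = enn2real p"
    have r: "r \<ge> 1" unfolding r_def by (rule enn2real_ge_1[OF p pf])
    obtain I where I: "I \<ge> 0" "(\<integral>\<^sup>+x. ennreal (\<bar>f x\<bar> powr r) \<partial>M) = ennreal I"
      using f Lp_norm_less_top_iff[OF pf, of M f] unfolding Lp_def r_def
      by (cases "\<integral>\<^sup>+x. ennreal (\<bar>f x\<bar> powr enn2real p) \<partial>M") auto
    have le: "(\<integral>\<^sup>+x. ennreal (\<bar>op f x\<bar> powr r) \<partial>M) \<le> ennreal (C powr r * I)"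
      using op_power_bound[OF fm r] I by (simp add: ennreal_mult)
    then obtain J where J: "J \<ge> 0" "(\<integral>\<^sup>+x. ennreal (\<bar>op f x\<bar> powr r) \<partial>M) = ennreal J"
      by (cases "\<integral>\<^sup>+x. ennreal (\<bar>op f x\<bar> powr r) \<partial>M") (auto simp: top_unique)
    have "J \<le> C powr r * I" using le J I by simp
    then have "J powr (1 / r) \<le> (C powr r * I) powr (1 / r)"
      using J r by (intro powr_mono2) auto
    also have "\<dots> = C * I powr (1 / r)"
      using r C_pos I by (simp add: powr_mult powr_powr)
    finally have "ennreal (J powr (1 / r)) \<le> ennreal C * ennreal (I powr (1 / r))"
      using C_pos by (simp add: ennreal_mult[symmetric] ennreal_leI)
    then show ?thesis
      using I J unfolding Lp_norm_finite_exponent[OF pf] r_def by simp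
  qed
  have "ennreal C * Lp_norm M p f < \<infinity>"
    using f by (auto simp: Lp_def ennreal_mult_less_top)
  with 1 show "op f \<in> Lp M p"
    by (auto simp: Lp_def intro: le_less_trans)
qed

text \<open>For finite p use |f| \<le> 1 + |f|^r: the constant meets the finite row mass, the power
  meets the bound \<open>B\<close>. The Schur estimate alone would give convergence at almost every
  x, whereas \<open>modified_laguerre_domain\<close> asks for every x in the orthant.\<close>

lemma integrable_rows_subset_domain:
  assumes "f \<in> Lp M p" "p \<ge> 1" "x \<in> space M" and B: "\<And>y. y \<in> space M \<Longrightarrow> K x y \<le> B"
  shows "integrable M (\<lambda>y. K x y * f y)"
proof (rule integrableI_bounded)
  note kernel_measurable_row[OF assms(3), measurable]
  have [measurable]: "f \<in> borel_measurable M" using assms by (simp add: Lp_def)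
  show "(\<lambda>y. K x y * f y) \<in> borel_measurable M" by measurable
  have mass: "(\<integral>\<^sup>+y. ennreal (K x y) \<partial>M) < \<infinity>"
    using kernel_mass[OF assms(3)] by (auto intro: le_less_trans)
  show "(\<integral>\<^sup>+y. ennreal (norm (K x y * f y)) \<partial>M) < \<infinity>"
  proof (cases "p = \<infinity>")
    case True
    obtain E where E: "E \<ge> 0" "AE x in M. \<bar>f x\<bar> \<le> E"
      using assms(1) unfolding True by (rule Lp_top_bounded)
    have "(\<integral>\<^sup>+y. ennreal (norm (K x y * f y)) \<partial>M) \<le> (\<integral>\<^sup>+y. ennreal (K x y) * ennreal E \<partial>M)"
      using E(2) AE_space
    proof (intro nn_integral_mono_AE, eventually_elim)
      fix y assume "\<bar>f y\<bar> \<le> E" "y \<in> space M"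
      then show "ennreal (norm (K x y * f y)) \<le> ennreal (K x y) * ennreal E"
        using kernel_nonneg[OF assms(3), of y] E
        by (simp add: ennreal_mult[symmetric] abs_mult mult_left_mono ennreal_leI)
    qed
    also have "\<dots> < \<infinity>"
      using mass by (simp add: nn_integral_multc ennreal_mult_less_top)
    finally show ?thesis .
  next
    case False
    then have pf: "p < \<infinity>" by (simp add: less_top)
    define r where "r = enn2real p"
    have r: "r \<ge> 1" unfolding r_def by (rule enn2real_ge_1[OF assms(2) pf])
    have fin: "(\<integral>\<^sup>+y. ennreal (\<bar>f y\<bar> powr r) \<partial>M) < \<infinity>"
      using assms(1) Lp_norm_less_top_iff[OF pf, of M f] unfolding Lp_def r_def by simp
    have "(\<integral>\<^sup>+y. ennreal (norm (K x y * f y)) \<partial>M) \<le> (\<integral>\<^sup>+y. ennreal (K x y) + ennreal \<bar>B\<bar> * ennreal (\<bar>f y\<bar> powr r) \<partial>M)"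
    proof (rule nn_integral_mono)
      fix y assume y: "y \<in> space M"
      have k: "0 \<le> K x y" "K x y \<le> \<bar>B\<bar>"
        using kernel_nonneg[OF assms(3) y] B[OF y] by auto
      have "\<bar>f y\<bar> \<le> 1 + \<bar>f y\<bar> powr r"
      proof (cases "\<bar>f y\<bar> \<le> 1")
        case False
        then have "\<bar>f y\<bar> powr 1 \<le> \<bar>f y\<bar> powr r" using r by (intro powr_mono) auto
        then show ?thesis using False by simp
      qed (simp add: add_increasing2)
      then have "K x y * \<bar>f y\<bar> \<le> K x y * (1 + \<bar>f y\<bar> powr r)"
        using k by (intro mult_left_mono) auto
      also have "\<dots> \<le> K x y + \<bar>B\<bar> * \<bar>f y\<bar> powr r"
        using k by (simp add: distrib_left mult_right_mono)
      finally have "ennreal (norm (K x y * f y)) \<le> ennreal (K x y + \<bar>B\<bar> * \<bar>f y\<bar> powr r)"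
        using k by (intro ennreal_leI) (simp add: abs_mult)
      then show "ennreal (norm (K x y * f y)) \<le> ennreal (K x y) + ennreal \<bar>B\<bar> * ennreal (\<bar>f y\<bar> powr r)"
        using k by (simp add: ennreal_mult)
    qed
    also have "\<dots> = (\<integral>\<^sup>+y. ennreal (K x y) \<partial>M) + ennreal \<bar>B\<bar> * (\<integral>\<^sup>+y. ennreal (\<bar>f y\<bar> powr r) \<partial>M)"
      by (simp add: nn_integral_add nn_integral_cmult)
    also have "\<dots> < \<infinity>"
      using mass fin by (auto simp: ennreal_mult_less_top)
    finally show ?thesis .
  qed
qed

lemma op_nonneg:
  assumes "AE y in M. 0 \<le> f y" "x \<in> space M"
  shows "0 \<le> op f x"
  unfolding op_def using assms(1) AE_space
  by (intro integral_nonneg_AE, eventually_elim) (use assms(2) in \<open>auto intro!: mult_nonneg_nonneg kernel_nonneg\<close>)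

lemma op_cong_AE:
  assumes "AE y in M. f y = g y" "f \<in> borel_measurable M" "g \<in> borel_measurable M" "x \<in> space M"
  shows "op f x = op g x"
  unfolding op_def using assms kernel_measurable_row[OF assms(4)]
  by (intro integral_cong_AE) (auto elim!: eventually_mono)

text \<open>Fubini and symmetry. Absolute convergence follows from |f y g x| \<le> (f y)^2 + (g
  x)^2, one term being controlled by the column masses and the other by the row masses.\<close>

lemma op_selfadjoint:
  assumes f: "f \<in> Lp M 2" and g: "g \<in> Lp M 2"
  shows "(LINT x|M. op f x * g x) = (LINT x|M. f x * op g x)"
proof -
  let ?F = "\<integral>\<^sup>+x. \<integral>\<^sup>+y. ennreal (K x y) * ennreal ((f y)\<^sup>2) \<partial>M \<partial>M"
  let ?G = "\<integral>\<^sup>+x. \<integral>\<^sup>+y. ennreal (K x y) * ennreal ((g x)\<^sup>2) \<partial>M \<partial>M"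
  have [measurable]: "f \<in> borel_measurable M" "g \<in> borel_measurable M"
    and fin: "(\<integral>\<^sup>+x. ennreal ((f x)\<^sup>2) \<partial>M) < \<infinity>" "(\<integral>\<^sup>+x. ennreal ((g x)\<^sup>2) \<partial>M) < \<infinity>"
    using f g by (auto simp: mem_Lp_2_iff)
  have int: "integrable (M \<Otimes>\<^sub>M M) (\<lambda>(x, y). K x y * f y * g x)"
  proof (rule integrableI_bounded)
    show "(\<lambda>(x, y). K x y * f y * g x) \<in> borel_measurable (M \<Otimes>\<^sub>M M)"
      by (simp add: case_prod_unfold)
    have "(\<integral>\<^sup>+z. ennreal (norm (case z of (x, y) \<Rightarrow> K x y * f y * g x)) \<partial>(M \<Otimes>\<^sub>M M))
      = (\<integral>\<^sup>+x. \<integral>\<^sup>+y. ennreal \<bar>K x y * f y * g x\<bar> \<partial>M \<partial>M)"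
      using nn_integral_fst[of "\<lambda>z. ennreal (norm (case z of (x, y) \<Rightarrow> K x y * f y * g x))" M]
      by (simp add: case_prod_unfold)
    also have "\<dots> \<le> (\<integral>\<^sup>+x. \<integral>\<^sup>+y. ennreal (K x y) * ennreal ((f y)\<^sup>2) + ennreal (K x y) * ennreal ((g x)\<^sup>2) \<partial>M \<partial>M)"
    proof (intro nn_integral_mono)
      fix x y assume "x \<in> space M" "y \<in> space M"
      then have k: "K x y \<ge> 0" by (rule kernel_nonneg)
      have "\<bar>f y * g x\<bar> \<le> (f y)\<^sup>2 + (g x)\<^sup>2"
        unfolding abs_mult using sum_squares_bound[of "\<bar>f y\<bar>" "\<bar>g x\<bar>", unfolded power2_abs]
          mult_nonneg_nonneg[OF abs_ge_zero abs_ge_zero, of "f y" "g x"] by linarith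
      then have "K x y * \<bar>f y * g x\<bar> \<le> K x y * ((f y)\<^sup>2 + (g x)\<^sup>2)"
        using k by (rule mult_left_mono)
      then have "ennreal \<bar>K x y * f y * g x\<bar> \<le> ennreal (K x y * (f y)\<^sup>2 + K x y * (g x)\<^sup>2)"
        using k by (intro ennreal_leI) (simp add: abs_mult mult.assoc distrib_left)
      then show "ennreal \<bar>K x y * f y * g x\<bar> \<le> ennreal (K x y) * ennreal ((f y)\<^sup>2) + ennreal (K x y) * ennreal ((g x)\<^sup>2)"
        using k by (simp add: ennreal_mult)
    qed
    also have "\<dots> = ?F + ?G"
    proof -
      have "(\<integral>\<^sup>+x. \<integral>\<^sup>+y. ennreal (K x y) * ennreal ((f y)\<^sup>2) + ennreal (K x y) * ennreal ((g x)\<^sup>2) \<partial>M \<partial>M)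
        = (\<integral>\<^sup>+x. (\<integral>\<^sup>+y. ennreal (K x y) * ennreal ((f y)\<^sup>2) \<partial>M) + (\<integral>\<^sup>+y. ennreal (K x y) * ennreal ((g x)\<^sup>2) \<partial>M) \<partial>M)"
        by (intro nn_integral_cong nn_integral_add borel_measurable_times_ennreal
            measurable_compose[OF kernel_measurable_row measurable_ennreal]) simp_all
      also have "\<dots> = ?F + ?G"
        by (rule nn_integral_add) measurable
      finally show ?thesis .
    qed
    also have "\<dots> \<le> ennreal C * (\<integral>\<^sup>+x. ennreal ((f x)\<^sup>2) \<partial>M) + ennreal C * (\<integral>\<^sup>+x. ennreal ((g x)\<^sup>2) \<partial>M)"
    proof (intro add_mono nn_integral_weighted_rows)
      have "?G = (\<integral>\<^sup>+x. (\<integral>\<^sup>+y. ennreal (K x y) \<partial>M) * ennreal ((g x)\<^sup>2) \<partial>M)"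
        by (intro nn_integral_cong nn_integral_multc
            measurable_compose[OF kernel_measurable_row measurable_ennreal])
      also have "\<dots> \<le> (\<integral>\<^sup>+x. ennreal C * ennreal ((g x)\<^sup>2) \<partial>M)"
        by (intro nn_integral_mono mult_right_mono kernel_mass) auto
      also have "\<dots> = ennreal C * (\<integral>\<^sup>+x. ennreal ((g x)\<^sup>2) \<partial>M)"
        by (rule nn_integral_cmult) simp
      finally show "?G \<le> ennreal C * (\<integral>\<^sup>+x. ennreal ((g x)\<^sup>2) \<partial>M)" .
    qed simp
    also have "\<dots> < \<infinity>"
      using fin by (auto simp: ennreal_mult_less_top)
    finally show "(\<integral>\<^sup>+z. ennreal (norm (case z of (x, y) \<Rightarrow> K x y * f y * g x)) \<partial>(M \<Otimes>\<^sub>M M)) < \<infinity>" .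
  qed
  have "(LINT x|M. op f x * g x) = (LINT x|M. LINT y|M. K x y * f y * g x)"
    by (simp add: op_def)
  also have "\<dots> = (LINT y|M. LINT x|M. K x y * f y * g x)"
    using pair.Fubini_integral[OF int] by simp
  also have "\<dots> = (LINT y|M. LINT x|M. f y * (K y x * g x))"
    by (intro Bochner_Integration.integral_cong refl) (simp add: kernel_sym mult_ac)
  also have "\<dots> = (LINT x|M. f x * op g x)"
    by (simp add: op_def)
  finally show ?thesis .
qed

lemma linear_operator_op:
  assumes D: "operator_domain M D"
    and int: "\<And>f x. f \<in> D \<Longrightarrow> x \<in> space M \<Longrightarrow> integrable M (\<lambda>y. K x y * f y)"
  shows "linear_operator M D op"
  unfolding linear_operator_def
proof (intro conjI ballI allI impI)
  have Dm: "f \<in> borel_measurable M" if "f \<in> D" for f using D that by (auto simp: operator_domain_def)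
  show "operator_domain M D" by fact
  show "op f \<in> borel_measurable M" if "f \<in> D" for f
    using Dm[OF that] by (rule op_measurable)
  show "AE x in M. op f x = op g x" if "f \<in> D" "g \<in> D" "AE x in M. f x = g x" for f g
    by (rule AE_I2) (rule op_cong_AE[OF that(3) Dm[OF that(1)] Dm[OF that(2)]])
  show "AE x in M. op (\<lambda>y. a * f y + b * g y) x = a * op f x + b * op g x" if "f \<in> D" "g \<in> D" for f g a b
  proof (rule AE_I2)
    fix x assume x: "x \<in> space M"
    have "op (\<lambda>y. a * f y + b * g y) x = (LINT y|M. a * (K x y * f y) + b * (K x y * g y))"
      unfolding op_def by (intro Bochner_Integration.integral_cong refl) (simp add: algebra_simps)
    also have "\<dots> = a * op f x + b * op g x"
      using int[OF that(1) x] int[OF that(2) x] by (simp add: op_def)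
    finally show "op (\<lambda>y. a * f y + b * g y) x = a * op f x + b * op g x" .
  qed
qed

lemma op_norm_op_le:
  assumes "linear_operator M D op" "p \<ge> 1"
  shows "op_norm M D p op \<le> ennreal C"
proof -
  have "Lp_norm M p (op f) \<le> ennreal C" if "f \<in> Lp M p" "Lp_norm M p f \<le> 1" for f
  proof -
    have "Lp_norm M p (op f) \<le> ennreal C * Lp_norm M p f"
      using that assms by (intro op_Lp_bound)
    also have "\<dots> \<le> ennreal C * 1"
      using that by (intro mult_left_mono) auto
    finally show ?thesis by simp
  qed
  then show ?thesis
    unfolding op_norm_def using assms by (auto intro!: SUP_least)
qed

end

text \<open>The kernels being nonnegative, Tonelli reduces the absolute double integral to that of
  |K3 x y f y|. Convergence for the composed kernel therefore justifies Fubini, and at the given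
  point x rather than almost everywhere.\<close>

lemma kernel_composition:
  fixes K1 K2 K3 :: "'a \<Rightarrow> 'a \<Rightarrow> real"
  assumes k1: "symmetric_kernel M K1 C1" and k2: "symmetric_kernel M K2 C2"
    and K3: "\<And>y. y \<in> space M \<Longrightarrow> (\<integral>\<^sup>+z. ennreal (K1 x z * K2 z y) \<partial>M) = ennreal (K3 x y)" "\<And>y. y \<in> space M \<Longrightarrow> 0 \<le> K3 x y"
    and x: "x \<in> space M" and int: "integrable M (\<lambda>y. K3 x y * f y)"
    and [measurable]: "f \<in> borel_measurable M"
  shows "(LINT y|M. K3 x y * f y) = (LINT z|M. K1 x z * (LINT y|M. K2 z y * f y))"
proof -
  interpret k1: symmetric_kernel M K1 C1 by fact
  interpret k2: symmetric_kernel M K2 C2 by fact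
  note k1.kernel_measurable_row[OF x, measurable] k2.kernel_measurable'[measurable]
  have nn: "0 \<le> K1 x z * K2 z y" if "z \<in> space M" "y \<in> space M" for z y
    using that x by (intro mult_nonneg_nonneg k1.kernel_nonneg k2.kernel_nonneg)
  have K2col: "(\<lambda>z. K2 z y) \<in> borel_measurable M" if "y \<in> space M" for y
    using measurable_Pair1[OF k2.kernel_measurable that] by simp
  have int2: "integrable (M \<Otimes>\<^sub>M M) (\<lambda>(z, y). K1 x z * K2 z y * f y)"
  proof (rule integrableI_bounded)
    show "(\<lambda>(z, y). K1 x z * K2 z y * f y) \<in> borel_measurable (M \<Otimes>\<^sub>M M)"
      by (simp add: case_prod_unfold)
    have "(\<integral>\<^sup>+w. ennreal (norm (case w of (z, y) \<Rightarrow> K1 x z * K2 z y * f y)) \<partial>(M \<Otimes>\<^sub>M M))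
       = (\<integral>\<^sup>+y. \<integral>\<^sup>+z. ennreal \<bar>K1 x z * K2 z y * f y\<bar> \<partial>M \<partial>M)"
      by (subst k1.pair.nn_integral_snd[symmetric]) (auto simp: case_prod_unfold)
    also have "\<dots> = (\<integral>\<^sup>+y. ennreal \<bar>K3 x y * f y\<bar> \<partial>M)"
    proof (rule nn_integral_cong)
      fix y assume y: "y \<in> space M"
      note K2col[OF y, measurable]
      have "(\<integral>\<^sup>+z. ennreal \<bar>K1 x z * K2 z y * f y\<bar> \<partial>M) = (\<integral>\<^sup>+z. ennreal (K1 x z * K2 z y) * ennreal \<bar>f y\<bar> \<partial>M)"
        using y by (intro nn_integral_cong) (simp add: nn ennreal_mult[symmetric] abs_mult k1.kernel_nonneg k2.kernel_nonneg x)
      also have "\<dots> = ennreal \<bar>K3 x y * f y\<bar>"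
        using y K3 by (simp add: nn_integral_multc abs_mult ennreal_mult[symmetric])
      finally show "(\<integral>\<^sup>+z. ennreal \<bar>K1 x z * K2 z y * f y\<bar> \<partial>M) = ennreal \<bar>K3 x y * f y\<bar>" .
    qed
    also have "\<dots> < \<infinity>" using int by (auto simp: integrable_iff_bounded)
    finally show "(\<integral>\<^sup>+w. ennreal (norm (case w of (z, y) \<Rightarrow> K1 x z * K2 z y * f y)) \<partial>(M \<Otimes>\<^sub>M M)) < \<infinity>" .
  qed
  have "(LINT z|M. K1 x z * (LINT y|M. K2 z y * f y)) = (LINT z|M. LINT y|M. K1 x z * K2 z y * f y)"
    by (simp add: mult.assoc)
  also have "\<dots> = (LINT y|M. LINT z|M. K1 x z * K2 z y * f y)"
    using k1.pair.Fubini_integral[OF int2] by simp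
  also have "\<dots> = (LINT y|M. K3 x y * f y)"
  proof (intro Bochner_Integration.integral_cong refl)
    fix y assume y: "y \<in> space M"
    note K2col[OF y, measurable]
    have "(LINT z|M. K1 x z * K2 z y) = K3 x y"
      using y nn K3 by (subst integral_eq_nn_integral) auto
    then show "(LINT z|M. K1 x z * K2 z y * f y) = K3 x y * f y" by simp
  qed
  finally show ?thesis ..
qed

section \<open>Strong continuity of symmetric Markov kernels\<close>

text \<open>The energy
  \<open>\<integral>\<integral> G t x y (f x - f y)\<^sup>2\<close> dominates the squared distance of \<open>f\<close> to its image and is a
  squared seminorm bounded by \<open>4 \<parallel>f\<parallel>\<^sup>2\<close>; hence the functions with vanishing energy form a closed
  subspace, and it suffices to treat Lipschitz functions.\<close>

locale markov_kernel_family = finite_measure M for M :: "'a::metric_space measure" +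
  fixes G :: "real \<Rightarrow> 'a \<Rightarrow> 'a \<Rightarrow> real"
  assumes measurable_ident: "(\<lambda>x. x) \<in> M \<rightarrow>\<^sub>M borel"
    and sets_subset: "sets M \<subseteq> sets borel"
    and kernel: "\<And>t. 0 < t \<Longrightarrow> symmetric_kernel M (G t) 1"
    and markov: "\<And>t x. 0 < t \<Longrightarrow> x \<in> space M \<Longrightarrow> (\<integral>\<^sup>+y. ennreal (G t x y) \<partial>M) = 1"
    and Lipschitz_energy: "\<And>g L. (\<And>x y. \<bar>g x - g y\<bar> \<le> L * dist x y) \<Longrightarrow>
      ((\<lambda>t. \<integral>\<^sup>+x. \<integral>\<^sup>+y. ennreal (G t x y * (g x - g y)\<^sup>2) \<partial>M \<partial>M) \<longlongrightarrow> 0) (at_right 0)"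
begin

definition energy :: "real \<Rightarrow> ('a \<Rightarrow> real) \<Rightarrow> ennreal" where
  "energy t f = (\<integral>\<^sup>+x. \<integral>\<^sup>+y. ennreal (G t x y * (f x - f y)\<^sup>2) \<partial>M \<partial>M)"

definition vanishing :: "('a \<Rightarrow> real) \<Rightarrow> bool" where
  "vanishing f \<longleftrightarrow> ((\<lambda>t. energy t f) \<longlongrightarrow> 0) (at_right 0)"

text \<open>From (a - b)^2 \<le> 2 a^2 + 2 b^2: the first square meets row mass 1, the second column
  mass at most 1, hence 2 + 2.\<close>

lemma energy_le:
  assumes t: "t > 0" and [measurable]: "f \<in> borel_measurable M"
  shows "energy t f \<le> 4 * (\<integral>\<^sup>+x. ennreal ((f x)\<^sup>2) \<partial>M)"
proof -
  interpret k: symmetric_kernel M "G t" 1 by (rule kernel[OF t])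
  have row: "(\<lambda>y. ennreal (G t x y)) \<in> borel_measurable M" if "x \<in> space M" for x
    using k.kernel_measurable_row[OF that] by simp
  have "energy t f \<le> (\<integral>\<^sup>+x. \<integral>\<^sup>+y. ennreal (G t x y) * ennreal (2 * (f x)\<^sup>2) + ennreal (G t x y) * ennreal (2 * (f y)\<^sup>2) \<partial>M \<partial>M)"
    unfolding energy_def
  proof (intro nn_integral_mono)
    fix x y assume "x \<in> space M" "y \<in> space M"
    then have nn: "G t x y \<ge> 0" by (rule k.kernel_nonneg)
    have "(f x - f y)\<^sup>2 \<le> 2 * (f x)\<^sup>2 + 2 * (f y)\<^sup>2"
      using zero_le_power2[of "f x + f y"] by (simp add: power2_eq_square algebra_simps)
    then have "G t x y * (f x - f y)\<^sup>2 \<le> G t x y * (2 * (f x)\<^sup>2 + 2 * (f y)\<^sup>2)"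
      using nn by (rule mult_left_mono)
    then have "ennreal (G t x y * (f x - f y)\<^sup>2) \<le> ennreal (G t x y * (2 * (f x)\<^sup>2) + G t x y * (2 * (f y)\<^sup>2))"
      by (intro ennreal_leI) (simp add: distrib_left)
    also have "\<dots> = ennreal (G t x y) * ennreal (2 * (f x)\<^sup>2) + ennreal (G t x y) * ennreal (2 * (f y)\<^sup>2)"
      using nn by (simp only: ennreal_plus ennreal_mult mult_nonneg_nonneg zero_le_numeral zero_le_power2)
    finally show "ennreal (G t x y * (f x - f y)\<^sup>2) \<le> ennreal (G t x y) * ennreal (2 * (f x)\<^sup>2) + ennreal (G t x y) * ennreal (2 * (f y)\<^sup>2)" .
  qed
  also have "\<dots> = (\<integral>\<^sup>+x. (\<integral>\<^sup>+y. ennreal (G t x y) * ennreal (2 * (f x)\<^sup>2) \<partial>M) + (\<integral>\<^sup>+y. ennreal (G t x y) * ennreal (2 * (f y)\<^sup>2) \<partial>M) \<partial>M)"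
    by (intro nn_integral_cong nn_integral_add borel_measurable_times_ennreal row) simp_all
  also have "\<dots> = (\<integral>\<^sup>+x. ennreal (2 * (f x)\<^sup>2) + (\<integral>\<^sup>+y. ennreal (G t x y) * ennreal (2 * (f y)\<^sup>2) \<partial>M) \<partial>M)"
    using t by (intro nn_integral_cong arg_cong2[where f="(+)"] refl) (simp add: nn_integral_multc row markov)
  also have "\<dots> = (\<integral>\<^sup>+x. ennreal (2 * (f x)\<^sup>2) \<partial>M) + (\<integral>\<^sup>+x. \<integral>\<^sup>+y. ennreal (G t x y) * ennreal (2 * (f y)\<^sup>2) \<partial>M \<partial>M)"
    using k.kernel_measurable' by (intro nn_integral_add) measurable
  also have "\<dots> \<le> (\<integral>\<^sup>+x. ennreal (2 * (f x)\<^sup>2) \<partial>M) + ennreal 1 * (\<integral>\<^sup>+x. ennreal (2 * (f x)\<^sup>2) \<partial>M)"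
    by (intro add_left_mono k.nn_integral_weighted_rows) simp
  also have "(\<integral>\<^sup>+x. ennreal (2 * (f x)\<^sup>2) \<partial>M) = 2 * (\<integral>\<^sup>+x. ennreal ((f x)\<^sup>2) \<partial>M)"
    by (subst nn_integral_cmult[symmetric]) (auto simp: ennreal_mult)
  also have "2 * (\<integral>\<^sup>+x. ennreal ((f x)\<^sup>2) \<partial>M) + ennreal 1 * (2 * (\<integral>\<^sup>+x. ennreal ((f x)\<^sup>2) \<partial>M)) = 4 * (\<integral>\<^sup>+x. ennreal ((f x)\<^sup>2) \<partial>M)"
    by (simp flip: distrib_right)
  finally show ?thesis .
qed

lemma energy_add_le:
  assumes t: "t > 0" and [measurable]: "f \<in> borel_measurable M" "g \<in> borel_measurable M"
  shows "energy t (\<lambda>x. f x + g x) \<le> 2 * energy t f + 2 * energy t g"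
proof -
  interpret k: symmetric_kernel M "G t" 1 by (rule kernel[OF t])
  note k.kernel_measurable'[measurable]
  have row[measurable (raw)]: "G t x \<in> borel_measurable M" if "x \<in> space M" for x
    using k.kernel_measurable_row[OF that] by simp
  have "energy t (\<lambda>x. f x + g x) \<le> (\<integral>\<^sup>+x. \<integral>\<^sup>+y. 2 * ennreal (G t x y * (f x - f y)\<^sup>2) + 2 * ennreal (G t x y * (g x - g y)\<^sup>2) \<partial>M \<partial>M)"
    unfolding energy_def
  proof (intro nn_integral_mono)
    fix x y assume "x \<in> space M" "y \<in> space M"
    then have nn: "G t x y \<ge> 0" by (rule k.kernel_nonneg)
    have "(f x + g x - (f y + g y))\<^sup>2 \<le> 2 * (f x - f y)\<^sup>2 + 2 * (g x - g y)\<^sup>2"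
      using zero_le_power2[of "(f x - f y) - (g x - g y)"] by (simp add: power2_eq_square algebra_simps)
    then have "G t x y * (f x + g x - (f y + g y))\<^sup>2 \<le> G t x y * (2 * (f x - f y)\<^sup>2 + 2 * (g x - g y)\<^sup>2)"
      using nn by (rule mult_left_mono)
    then have "ennreal (G t x y * (f x + g x - (f y + g y))\<^sup>2) \<le> ennreal (2 * (G t x y * (f x - f y)\<^sup>2) + 2 * (G t x y * (g x - g y)\<^sup>2))"
      by (intro ennreal_leI) (simp add: distrib_left mult_ac)
    also have "\<dots> = 2 * ennreal (G t x y * (f x - f y)\<^sup>2) + 2 * ennreal (G t x y * (g x - g y)\<^sup>2)"
      using nn by (simp add: ennreal_mult')
    finally show "ennreal (G t x y * (f x + g x - (f y + g y))\<^sup>2) \<le> 2 * ennreal (G t x y * (f x - f y)\<^sup>2) + 2 * ennreal (G t x y * (g x - g y)\<^sup>2)" .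
  qed
  also have "\<dots> = (\<integral>\<^sup>+x. 2 * (\<integral>\<^sup>+y. ennreal (G t x y * (f x - f y)\<^sup>2) \<partial>M) + 2 * (\<integral>\<^sup>+y. ennreal (G t x y * (g x - g y)\<^sup>2) \<partial>M) \<partial>M)"
  proof (rule nn_integral_cong)
    fix x assume x[simp]: "x \<in> space M"
    show "(\<integral>\<^sup>+y. 2 * ennreal (G t x y * (f x - f y)\<^sup>2) + 2 * ennreal (G t x y * (g x - g y)\<^sup>2) \<partial>M)
      = 2 * (\<integral>\<^sup>+y. ennreal (G t x y * (f x - f y)\<^sup>2) \<partial>M) + 2 * (\<integral>\<^sup>+y. ennreal (G t x y * (g x - g y)\<^sup>2) \<partial>M)"
      using row[OF x] by (simp add: nn_integral_add nn_integral_cmult)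
  qed
  also have "\<dots> = 2 * energy t f + 2 * energy t g"
    unfolding energy_def by (simp add: nn_integral_add nn_integral_cmult)
  finally show ?thesis .
qed

lemma energy_cmult:
  assumes t: "t > 0" and [measurable]: "f \<in> borel_measurable M"
  shows "energy t (\<lambda>x. c * f x) = ennreal (c\<^sup>2) * energy t f"
proof -
  interpret k: symmetric_kernel M "G t" 1 by (rule kernel[OF t])
  note k.kernel_measurable'[measurable]
  have row: "G t x \<in> borel_measurable M" if "x \<in> space M" for x
    using k.kernel_measurable_row[OF that] by simp
  have "energy t (\<lambda>x. c * f x) = (\<integral>\<^sup>+x. \<integral>\<^sup>+y. ennreal (c\<^sup>2) * ennreal (G t x y * (f x - f y)\<^sup>2) \<partial>M \<partial>M)"
    unfolding energy_def
    by (intro nn_integral_cong) (simp add: ennreal_mult'[symmetric] power_mult_distrib mult_ac flip: right_diff_distrib)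
  also have "\<dots> = (\<integral>\<^sup>+x. ennreal (c\<^sup>2) * (\<integral>\<^sup>+y. ennreal (G t x y * (f x - f y)\<^sup>2) \<partial>M) \<partial>M)"
    using row by (intro nn_integral_cong nn_integral_cmult) simp
  also have "\<dots> = ennreal (c\<^sup>2) * energy t f"
    unfolding energy_def by (rule nn_integral_cmult) measurable
  finally show ?thesis .
qed

lemma vanishing_add:
  assumes "vanishing f" "vanishing g" "f \<in> borel_measurable M" "g \<in> borel_measurable M"
  shows "vanishing (\<lambda>x. f x + g x)"
  unfolding vanishing_def
proof (rule tendsto_ennreal_zero_le)
  have "((\<lambda>t. 2 * energy t f + 2 * energy t g) \<longlongrightarrow> 2 * 0 + 2 * 0) (at_right 0)"
    using assms(1,2) unfolding vanishing_def by (intro tendsto_add ennreal_tendsto_cmult) auto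
  then show "((\<lambda>t. 2 * energy t f + 2 * energy t g) \<longlongrightarrow> 0) (at_right 0)" by simp
  show "eventually (\<lambda>t. energy t (\<lambda>x. f x + g x) \<le> 2 * energy t f + 2 * energy t g) (at_right 0)"
    using eventually_at_right_less[of 0] by eventually_elim (intro energy_add_le assms)
qed

lemma vanishing_cmult:
  assumes "vanishing f" "f \<in> borel_measurable M"
  shows "vanishing (\<lambda>x. c * f x)"
  unfolding vanishing_def
proof (rule tendsto_ennreal_zero_le)
  have "((\<lambda>t. ennreal (c\<^sup>2) * energy t f) \<longlongrightarrow> ennreal (c\<^sup>2) * 0) (at_right 0)"
    using assms(1) unfolding vanishing_def by (intro ennreal_tendsto_cmult) auto
  then show "((\<lambda>t. ennreal (c\<^sup>2) * energy t f) \<longlongrightarrow> 0) (at_right 0)" by simp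
  show "eventually (\<lambda>t. energy t (\<lambda>x. c * f x) \<le> ennreal (c\<^sup>2) * energy t f) (at_right 0)"
    using eventually_at_right_less[of 0] by eventually_elim (simp add: energy_cmult assms)
qed

lemma vanishing_Lipschitz:
  assumes "\<And>x y. \<bar>g x - g y\<bar> \<le> L * dist x y"
  shows "vanishing g"
  unfolding vanishing_def energy_def using assms by (rule Lipschitz_energy)

lemma vanishing_L2_limit:
  assumes u[measurable]: "\<And>n. u n \<in> borel_measurable M" and f[measurable]: "f \<in> borel_measurable M"
    and van: "\<And>n. vanishing (u n)"
    and lim: "(\<lambda>n::nat. \<integral>\<^sup>+x. ennreal ((f x - u n x)\<^sup>2) \<partial>M) \<longlonglongrightarrow> 0"
  shows "vanishing f"
  unfolding vanishing_def order_tendsto_iff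
proof (intro conjI allI impI)
  fix e :: ennreal assume e: "0 < e"
  \<comment> \<open>A neighbourhood of 0 in \<open>ennreal\<close> may be given by e = top; d is a
    finite substitute for e.\<close>
  define d where "d = (if e = top then 1 else e)"
  have d: "0 < d" "d \<le> e" "d \<noteq> top" using e by (auto simp: d_def)
  then obtain d' where d': "d = ennreal d'" "d' > 0" by (cases d) (auto simp: ennreal_less_zero_iff)
  \<comment> \<open>Budget: 2 (d'/8) + 2 (4 (d'/16)) = 3 d'/4 < d', the 4 coming from
    \<open>energy_le\<close>.\<close>
  have "eventually (\<lambda>n. (\<integral>\<^sup>+x. ennreal ((f x - u n x)\<^sup>2) \<partial>M) < ennreal (d' / 16)) sequentially"
    using d' by (intro order_tendstoD(2)[OF lim]) auto
  then obtain n where n: "(\<integral>\<^sup>+x. ennreal ((f x - u n x)\<^sup>2) \<partial>M) < ennreal (d' / 16)"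
    by (auto simp: eventually_sequentially)
  have "eventually (\<lambda>t. energy t (u n) < ennreal (d' / 8)) (at_right 0)"
    using d' van[of n] unfolding vanishing_def by (intro order_tendstoD(2)) auto
  then show "eventually (\<lambda>t. energy t f < e) (at_right 0)"
    using eventually_at_right_less[of 0]
  proof eventually_elim
    fix t :: real assume t: "energy t (u n) < ennreal (d' / 8)" "0 < t"
    have "energy t f = energy t (\<lambda>x. u n x + (f x - u n x))" by simp
    also have "\<dots> \<le> 2 * energy t (u n) + 2 * energy t (\<lambda>x. f x - u n x)"
      using t by (intro energy_add_le) auto
    also have "\<dots> \<le> 2 * energy t (u n) + 2 * (4 * (\<integral>\<^sup>+x. ennreal ((f x - u n x)\<^sup>2) \<partial>M))"
      using t by (intro add_left_mono mult_left_mono energy_le) auto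
    also have "\<dots> \<le> ennreal 2 * ennreal (d' / 8) + ennreal 2 * (ennreal 4 * ennreal (d' / 16))"
      unfolding ennreal_numeral using t(1) n by (intro add_mono mult_left_mono) (auto intro: less_imp_le)
    also have "\<dots> = ennreal (2 * (d' / 8) + 2 * (4 * (d' / 16)))"
      using d' by (simp only: ennreal_mult[symmetric] ennreal_plus[symmetric] zero_le_numeral mult_nonneg_nonneg divide_nonneg_nonneg less_imp_le)
    also have "\<dots> < ennreal d'" using d' by (intro ennreal_lessI) auto
    finally show "energy t f < e" using d d' by (auto intro: less_le_trans)
  qed
qed simp

lemma vanishing_dominated_limit:
  assumes u[measurable]: "\<And>n. u n \<in> borel_measurable M" and f[measurable]: "f \<in> borel_measurable M"
    and van: "\<And>n. vanishing (u n)"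
    and w[measurable]: "w \<in> borel_measurable M" "(\<integral>\<^sup>+x. ennreal ((w x)\<^sup>2) \<partial>M) < \<infinity>"
    and bound: "\<And>n x. x \<in> space M \<Longrightarrow> \<bar>f x - u n x\<bar> \<le> w x"
    and lim: "\<And>x. x \<in> space M \<Longrightarrow> (\<lambda>n. u n x) \<longlonglongrightarrow> f x"
  shows "vanishing f"
proof (rule vanishing_L2_limit[OF u f van])
  have "(\<lambda>n. \<integral>\<^sup>+x. ennreal ((f x - u n x)\<^sup>2) \<partial>M) \<longlonglongrightarrow> (\<integral>\<^sup>+x. 0 \<partial>M)"
  proof (rule nn_integral_dominated_convergence[where w = "\<lambda>x. ennreal ((w x)\<^sup>2)"])
    show "AE x in M. ennreal ((f x - u n x)\<^sup>2) \<le> ennreal ((w x)\<^sup>2)" for n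
    proof (rule AE_I2)
      fix x assume "x \<in> space M"
      then have "\<bar>f x - u n x\<bar>\<^sup>2 \<le> (w x)\<^sup>2"
        using bound[of x n] by (intro power_mono) auto
      then show "ennreal ((f x - u n x)\<^sup>2) \<le> ennreal ((w x)\<^sup>2)" by (simp add: ennreal_leI)
    qed
    show "AE x in M. (\<lambda>n. ennreal ((f x - u n x)\<^sup>2)) \<longlonglongrightarrow> 0"
    proof (rule AE_I2)
      fix x assume "x \<in> space M"
      then have "(\<lambda>n. (f x - u n x)\<^sup>2) \<longlonglongrightarrow> (f x - f x)\<^sup>2"
        by (intro tendsto_intros lim)
      then show "(\<lambda>n. ennreal ((f x - u n x)\<^sup>2)) \<longlonglongrightarrow> 0"
        using tendsto_ennrealI by fastforce
    qed
  qed (use w in auto)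
  then show "(\<lambda>n. \<integral>\<^sup>+x. ennreal ((f x - u n x)\<^sup>2) \<partial>M) \<longlonglongrightarrow> 0" by simp
qed

lemma indicator_measurable:
  "B \<in> sets borel \<Longrightarrow> (indicator B :: 'a \<Rightarrow> real) \<in> borel_measurable M"
  using measurable_compose[OF measurable_ident borel_measurable_indicator[of B borel]] by simp

lemma finite_const_square: "(\<integral>\<^sup>+x. ennreal (c\<^sup>2) \<partial>M) < \<infinity>"
  by (simp add: ennreal_mult_less_top) (simp flip: less_top)

text \<open>The Lipschitz functions max 0 (1 - n dist(x, A)) decrease to the indicator of A, because
  A is closed; finiteness of the measure makes the constant 1 a dominating function.\<close>

lemma vanishing_closed:
  assumes "closed A"
  shows "vanishing (indicator A)"
\<comment> \<open>By convention \<open>infdist\<close> to the empty set is 0, so the cut-offs below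
  would be constantly 1.\<close>
proof (cases "A = {}")
  case True
  then show ?thesis by (intro vanishing_Lipschitz[of _ 0]) auto
next
  case False
  define g where "g n x = max 0 (1 - real n * infdist x A)" for n x
  show ?thesis
  proof (rule vanishing_dominated_limit[where u = g and w = "\<lambda>_. 1"])
    have lip: "\<bar>g n x - g n y\<bar> \<le> real n * dist x y" for n x y
    proof -
      have "\<bar>g n x - g n y\<bar> \<le> \<bar>real n * infdist x A - real n * infdist y A\<bar>"
        unfolding g_def by (auto simp: max_def)
      also have "\<dots> = real n * \<bar>infdist x A - infdist y A\<bar>"
        by (simp add: abs_mult flip: right_diff_distrib)
      also have "\<dots> \<le> real n * dist x y"
        by (intro mult_left_mono infdist_triangle_abs) auto
      finally show ?thesis .
    qed
    then show "vanishing (g n)" for n by (rule vanishing_Lipschitz)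
    have "continuous_on UNIV (g n)" for n
      unfolding g_def by (intro continuous_intros)
    then have "g n \<in> borel_measurable borel" for n
      by (rule borel_measurable_continuous_onI)
    from measurable_compose[OF measurable_ident this] show "g n \<in> borel_measurable M" for n .
    show "(indicator A :: 'a \<Rightarrow> real) \<in> borel_measurable M"
      using assms by (intro indicator_measurable) auto
    show "(\<integral>\<^sup>+x. ennreal (1\<^sup>2) \<partial>M) < \<infinity>" by (rule finite_const_square)
    show "\<bar>indicator A x - g n x\<bar> \<le> 1" for n x
      using infdist_nonneg[of x A] by (auto simp: g_def max_def split: split_indicator)
    show "(\<lambda>n. g n x) \<longlonglongrightarrow> indicator A x" for x
    proof (cases "x \<in> A")
      case True
      then show ?thesis by (simp add: g_def)
    next
      case F: False
      then have pos: "infdist x A > 0"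
        using in_closed_iff_infdist_zero[OF assms False, of x] infdist_nonneg[of x A] by auto
      obtain N :: nat where N: "1 / infdist x A < real N" using reals_Archimedean2 by blast
      have "g n x = 0" if "n \<ge> N" for n
      proof -
        have "1 / infdist x A \<le> real n" using N that by simp
        then have "1 \<le> real n * infdist x A" using pos by (simp add: field_simps)
        then show ?thesis by (simp add: g_def)
      qed
      then have "eventually (\<lambda>n. g n x = 0) sequentially"
        by (auto simp: eventually_sequentially)
      then show ?thesis using F by (simp add: tendsto_eventually)
    qed
  qed simp
qed

text \<open>Dynkin's theorem for the intersection-stable generator of closed sets. Disjointness
  makes the indicator of a finite union a sum, to which \<open>vanishing_add\<close>
  applies.\<close>

lemma vanishing_borel:
  assumes "B \<in> sets (borel :: 'a measure)"
  shows "vanishing (indicator B)"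
proof -
  have "Int_stable (Collect closed :: 'a set set)" "Collect closed \<subseteq> Pow (UNIV :: 'a set)"
    "B \<in> sigma_sets UNIV (Collect closed)"
    using assms by (auto simp: Int_stable_def borel_eq_closed)
  then show ?thesis
  proof (induction rule: sigma_sets_induct_disjoint)
    case (basic A) then show ?case by (auto intro: vanishing_closed)
  next
    case empty show ?case by (rule vanishing_closed) simp
  next
    case (compl A)
    have "A \<in> sets borel" using compl by (simp add: borel_eq_closed)
    then have m: "(indicator A :: 'a \<Rightarrow> real) \<in> borel_measurable M" by (rule indicator_measurable)
    have "vanishing (\<lambda>x. 1 + (-1) * indicator A x)"
      using m compl by (intro vanishing_add vanishing_cmult vanishing_Lipschitz[of "\<lambda>_. 1" 0]) auto
    moreover have "1 + (-1) * indicator A x = (indicator (UNIV - A) x :: real)" for x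
      by (auto split: split_indicator)
    ultimately show ?case by simp
  next
    case (union A)
    have A: "A i \<in> sets borel" for i using union by (auto simp: borel_eq_closed)
    define u where "u n = (\<lambda>x. \<Sum>i<n. indicator (A i) x :: real)" for n :: nat
    have um: "u n \<in> borel_measurable M" for n
      unfolding u_def by (intro borel_measurable_sum indicator_measurable A)
    have u_eq: "u n = indicator (\<Union>i<n. A i)" for n
      unfolding u_def using union(1)
      by (intro ext) (auto simp: indicator_UN_disjoint disjoint_family_on_def)
    show ?case
    proof (rule vanishing_dominated_limit[where u = u and w = "\<lambda>_. 1"])
      show "u n \<in> borel_measurable M" for n by (rule um)
      show "(indicator (\<Union>i. A i) :: 'a \<Rightarrow> real) \<in> borel_measurable M"
        using A by (intro indicator_measurable) auto
      show "vanishing (u n)" for n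
      proof (induction n)
        case 0
        show ?case unfolding u_def by (intro vanishing_Lipschitz[of _ 0]) auto
      next
        case (Suc n)
        then have "vanishing (\<lambda>x. u n x + indicator (A n) x)"
          using union um A by (intro vanishing_add indicator_measurable)
        then show ?case by (simp add: u_def)
      qed
      show "(\<integral>\<^sup>+x. ennreal (1\<^sup>2) \<partial>M) < \<infinity>" by (rule finite_const_square)
      show "\<bar>indicator (\<Union>i. A i) x - u n x\<bar> \<le> 1" for n x
        unfolding u_eq by (auto split: split_indicator)
      show "(\<lambda>n. u n x) \<longlonglongrightarrow> indicator (\<Union>i. A i) x" for x
        unfolding u_eq by (rule LIMSEQ_indicator_UN)
    qed simp
  qed
qed

lemma vanishing_nonneg:
  assumes "f \<in> borel_measurable M" "\<And>x. 0 \<le> f x" "(\<integral>\<^sup>+x. ennreal ((f x)\<^sup>2) \<partial>M) < \<infinity>"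
  shows "vanishing f"
proof -
  \<comment> \<open>Square integrability is part of the induction predicate, since each case must
    hand it down to its constituents.\<close>
  have "(\<integral>\<^sup>+x. ennreal ((f x)\<^sup>2) \<partial>M) < \<infinity> \<longrightarrow> vanishing f"
    using assms(1,2)
  proof (induction rule: borel_measurable_induct_real)
    case (set A)
    then show ?case using sets_subset by (auto intro: vanishing_borel)
  next
    case (mult u c)
    show ?case
    \<comment> \<open>For c = 0 the square integrability of c u says nothing about u, so the
      induction hypothesis cannot be applied.\<close>
    proof (cases "c = 0")
      case True
      then show ?thesis by (auto intro!: vanishing_Lipschitz[of _ 0])
    next
      case False
      have "(\<integral>\<^sup>+x. ennreal ((c * u x)\<^sup>2) \<partial>M) = ennreal (c\<^sup>2) * (\<integral>\<^sup>+x. ennreal ((u x)\<^sup>2) \<partial>M)"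
        using mult by (subst nn_integral_cmult[symmetric]) (auto simp: power_mult_distrib ennreal_mult)
      then show ?thesis
        using mult False by (auto simp: ennreal_mult_less_top intro!: vanishing_cmult)
    qed
  next
    case (add u v)
    have "(\<integral>\<^sup>+x. ennreal ((u x)\<^sup>2) \<partial>M) \<le> (\<integral>\<^sup>+x. ennreal ((v x + u x)\<^sup>2) \<partial>M)"
      "(\<integral>\<^sup>+x. ennreal ((v x)\<^sup>2) \<partial>M) \<le> (\<integral>\<^sup>+x. ennreal ((v x + u x)\<^sup>2) \<partial>M)"
      using add by (auto intro!: nn_integral_mono ennreal_leI power_mono)
    then show ?case
      using add by (auto intro!: vanishing_add intro: le_less_trans)
  next
    case (seq U)
    have le: "U i x \<le> f x" if "x \<in> space M" for i x
      using seq.hyps(3,4) that by (intro incseq_le) (auto simp: incseq_def le_fun_def)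
    show ?case
    proof
      assume fin: "(\<integral>\<^sup>+x. ennreal ((f x)\<^sup>2) \<partial>M) < \<infinity>"
      have "vanishing (U i)" for i
      proof -
        have "(\<integral>\<^sup>+x. ennreal ((U i x)\<^sup>2) \<partial>M) \<le> (\<integral>\<^sup>+x. ennreal ((f x)\<^sup>2) \<partial>M)"
          using seq.hyps(2) le by (intro nn_integral_mono ennreal_leI power_mono) auto
        then show ?thesis using seq.IH[of i] fin by (auto intro: le_less_trans)
      qed
      then show "vanishing f"
        by (rule vanishing_dominated_limit[OF seq.hyps(1) assms(1) _ assms(1) fin _ seq.hyps(4)])
          (use le seq.hyps(2) in auto)
    qed
  qed
  then show ?thesis using assms by simp
qed

lemma vanishing_L2:
  assumes [measurable]: "f \<in> borel_measurable M" and "(\<integral>\<^sup>+x. ennreal ((f x)\<^sup>2) \<partial>M) < \<infinity>"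
  shows "vanishing f"
proof -
  have 1: "vanishing (\<lambda>x. max 0 (f x))"
  proof (rule vanishing_nonneg)
    have "(\<integral>\<^sup>+x. ennreal ((max 0 (f x))\<^sup>2) \<partial>M) \<le> (\<integral>\<^sup>+x. ennreal ((f x)\<^sup>2) \<partial>M)"
      by (intro nn_integral_mono ennreal_leI) (auto simp: max_def)
    then show "(\<integral>\<^sup>+x. ennreal ((max 0 (f x))\<^sup>2) \<partial>M) < \<infinity>" using assms(2) by (rule le_less_trans)
  qed auto
  have 2: "vanishing (\<lambda>x. max 0 (- f x))"
  proof (rule vanishing_nonneg)
    have "(\<integral>\<^sup>+x. ennreal ((max 0 (- f x))\<^sup>2) \<partial>M) \<le> (\<integral>\<^sup>+x. ennreal ((f x)\<^sup>2) \<partial>M)"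
      by (intro nn_integral_mono ennreal_leI) (auto simp: max_def)
    then show "(\<integral>\<^sup>+x. ennreal ((max 0 (- f x))\<^sup>2) \<partial>M) < \<infinity>" using assms(2) by (rule le_less_trans)
  qed auto
  have "vanishing (\<lambda>x. max 0 (f x) + (-1) * max 0 (- f x))"
    by (intro vanishing_add vanishing_cmult 1 2) auto
  moreover have "max 0 (f x) + (-1) * max 0 (- f x) = f x" for x by (simp add: max_def)
  ultimately show ?thesis by simp
qed

text \<open>Row mass exactly 1 allows f x to be moved under the integral; then Jensen with exponent
  2. The modified kernel lacks this exact mass, hence the passage to the Markovian one.\<close>

lemma op_diff_le_energy:
  assumes t: "t > 0" and [measurable]: "f \<in> borel_measurable M"
    and int: "\<And>x. x \<in> space M \<Longrightarrow> integrable M (\<lambda>y. G t x y * f y)"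
  shows "(\<integral>\<^sup>+x. ennreal (((LINT y|M. G t x y * f y) - f x)\<^sup>2) \<partial>M) \<le> energy t f"
  unfolding energy_def
proof (rule nn_integral_mono)
  interpret k: symmetric_kernel M "G t" 1 by (rule kernel[OF t])
  fix x assume x: "x \<in> space M"
  note k.kernel_measurable_row[OF x, measurable]
  have intG: "integrable M (G t x)"
    using markov[OF t x] k.kernel_nonneg[OF x]
    by (intro integrableI_nonneg) auto
  have one: "(LINT y|M. G t x y) = 1"
    using markov[OF t x] k.kernel_nonneg[OF x] by (subst integral_eq_nn_integral) auto
  have "(LINT y|M. G t x y * (f y - f x)) = (LINT y|M. G t x y * f y) - f x"
    using int[OF x] intG one by (simp add: right_diff_distrib)
  moreover have "ennreal (\<bar>LINT y|M. G t x y * (f y - f x)\<bar> powr 2) \<le> ennreal (1 powr (2 - 1)) * (\<integral>\<^sup>+y. ennreal (G t x y * \<bar>f y - f x\<bar> powr 2) \<partial>M)"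
    using x by (intro weighted_Jensen k.kernel_nonneg k.kernel_mass) auto
  ultimately show "ennreal (((LINT y|M. G t x y * f y) - f x)\<^sup>2) \<le> (\<integral>\<^sup>+y. ennreal (G t x y * (f x - f y)\<^sup>2) \<partial>M)"
    by (simp add: power2_commute)
qed

lemma L2_continuity:
  assumes "f \<in> borel_measurable M" and "(\<integral>\<^sup>+x. ennreal ((f x)\<^sup>2) \<partial>M) < \<infinity>"
    and "\<And>t x. t > 0 \<Longrightarrow> x \<in> space M \<Longrightarrow> integrable M (\<lambda>y. G t x y * f y)"
  shows "((\<lambda>t. \<integral>\<^sup>+x. ennreal (((LINT y|M. G t x y * f y) - f x)\<^sup>2) \<partial>M) \<longlongrightarrow> 0) (at_right 0)"
proof (rule tendsto_ennreal_zero_le)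
  show "((\<lambda>t. energy t f) \<longlongrightarrow> 0) (at_right 0)"
    using vanishing_L2[OF assms(1,2)] by (simp add: vanishing_def)
  show "eventually (\<lambda>t. (\<integral>\<^sup>+x. ennreal (((LINT y|M. G t x y * f y) - f x)\<^sup>2) \<partial>M) \<le> energy t f) (at_right 0)"
    using eventually_at_right_less[of 0] by eventually_elim (intro op_diff_le_energy assms)
qed

end

section \<open>Products over the coordinates\<close>

text \<open>The one-coordinate form of \<open>laguerre_measure_add_axis\<close>; it absorbs the
  factor z_j arising when two modified kernels are composed.\<close>

lemma nn_integral_gamma_measure_Suc:
  fixes f :: "real \<Rightarrow> ennreal"
  assumes [measurable]: "f \<in> borel_measurable borel"
  shows "(\<integral>\<^sup>+z. ennreal z * f z \<partial>gamma_measure a) = (\<integral>\<^sup>+z. f z \<partial>gamma_measure (a + 1))"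
proof -
  have "ennreal (indicator {0<..} z * (z powr a * exp (- z))) * ennreal z
      = ennreal (indicator {0<..} z * (z powr (a + 1) * exp (- z)))" for z
    by (cases "0 < z") (auto simp: ennreal_mult[symmetric] powr_add mult_ac)
  then show ?thesis
    unfolding gamma_measure_def by (simp add: nn_integral_density mult.assoc[symmetric])
qed

lemma emeasure_gamma_measure_pos:
  assumes "0 < u" "u < v"
  shows "emeasure (gamma_measure a) {u<..<v} > 0"
proof (rule ccontr)
  assume "\<not> 0 < emeasure (gamma_measure a) {u<..<v}"
  then have "(\<integral>\<^sup>+x. ennreal (indicator {0<..} x * (x powr a * exp (- x))) * indicator {u<..<v} x \<partial>lborel) = 0"
    by (simp add: gamma_measure_def emeasure_density)
  then have "AE x in lborel. ennreal (indicator {0<..} x * (x powr a * exp (- x))) * indicator {u<..<v} x = 0"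
    by (subst (asm) nn_integral_0_iff_AE) auto
  then have "AE x in lborel. x \<notin> {u<..<v}"
    using assms by (auto split: split_indicator elim!: eventually_mono)
  then have "emeasure lborel {u<..<v} = 0"
    by (subst (asm) AE_iff_measurable[of "{u<..<v}"]) auto
  then show False using assms by simp
qed

lemma bessel_I_eq_bessel_series:
  assumes "\<nu> > -1" "z > 0"
  shows "bessel_I \<nu> z = (z / 2) powr \<nu> * bessel_series \<nu> ((z / 2)\<^sup>2)"
proof -
  have "(z / 2) powr (2 * real k + \<nu>) * rGamma (real k + \<nu> + 1) / fact k
      = (z / 2) powr \<nu> * (((z / 2)\<^sup>2) ^ k / (fact k * Gamma (real k + \<nu> + 1)))" for k
  proof -
    have "(z / 2) powr (2 * real k + \<nu>) = (z / 2) powr real (2 * k) * (z / 2) powr \<nu>"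
      by (simp add: powr_add)
    also have "(z / 2) powr real (2 * k) = ((z / 2)\<^sup>2) ^ k"
      using assms by (subst powr_realpow) (auto simp: power_mult)
    finally show ?thesis
      by (simp add: rGamma_inverse_Gamma inverse_eq_divide mult_ac)
  qed
  then show ?thesis
    unfolding bessel_I_def bessel_series_def using assms
    by (simp only:) (intro suminf_mult summable_bessel_series, auto)
qed

text \<open>The dictionary is q = exp (-t) and 2 sinh (t/2) = exp (t/2) (1 - q). The fractional
  powers of x y cancel, and exp (t (\<nu> + 1) / 2) cancels against the same power of exp (t/2) in
  S^(-\<nu> - 1).\<close>

lemma laguerre_kernel1_eq_bessel_I:
  assumes "\<nu> > -1" "t > 0" "x > 0" "y > 0"
  shows "exp (t * (\<nu> + 1) / 2) / (2 * sinh (t / 2)) * exp (- (exp (- t / 2) / (2 * sinh (t / 2))) * (x + y))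
      * ((x * y) powr (- \<nu> / 2) * bessel_I \<nu> (sqrt (x * y) / sinh (t / 2)))
    = laguerre_kernel1 \<nu> (exp (- t)) x y"
proof -
  define q where "q = exp (- t)"
  define S where "S = 2 * sinh (t / 2)"
  have q: "0 < q" "q < 1" using assms by (auto simp: q_def)
  have S: "S = exp (t / 2) * (1 - q)"
    unfolding S_def q_def sinh_field_def by (simp add: right_diff_distrib mult_exp_exp)
  have S_pos: "S > 0" using q by (simp add: S)
  have sinh: "sinh (t / 2) = S / 2" by (simp add: S_def)
  have xy: "x * y > 0" using assms by simp
  have z: "sqrt (x * y) / sinh (t / 2) / 2 = sqrt (x * y) / S" unfolding sinh by simp
  have e2: "exp (- t / 2) = q * exp (t / 2)" by (simp add: q_def mult_exp_exp)
  have SS: "S\<^sup>2 = (1 - q)\<^sup>2 / q"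
  proof -
    have "(exp (t / 2))\<^sup>2 = 1 / q"
      by (simp add: exp_double[symmetric] q_def exp_minus inverse_eq_divide)
    then show ?thesis unfolding S power_mult_distrib by simp
  qed
  have "bessel_I \<nu> (sqrt (x * y) / sinh (t / 2)) = (sqrt (x * y) / S) powr \<nu> * bessel_series \<nu> ((sqrt (x * y) / S)\<^sup>2)"
    using assms S_pos sinh by (subst bessel_I_eq_bessel_series) (auto simp: z)
  also have "(sqrt (x * y) / S)\<^sup>2 = q * x * y / (1 - q)\<^sup>2"
    using assms(3,4) xy unfolding power_divide SS by simp
  also have "(sqrt (x * y) / S) powr \<nu> = (x * y) powr (\<nu> / 2) * S powr (- \<nu>)"
    using assms(3,4) S_pos by (simp add: powr_divide powr_minus powr_half_sqrt[symmetric] powr_powr divide_inverse[symmetric])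
  finally have I: "bessel_I \<nu> (sqrt (x * y) / sinh (t / 2)) = (x * y) powr (\<nu> / 2) * S powr (- \<nu>) * bessel_series \<nu> (q * x * y / (1 - q)\<^sup>2)" .
  have p1: "(x * y) powr (- \<nu> / 2) * (x * y) powr (\<nu> / 2) = 1"
    using assms(3,4) by (simp flip: powr_add)
  have p2: "exp (t * (\<nu> + 1) / 2) / S * S powr (- \<nu>) = (1 - q) powr (- \<nu> - 1)"
  proof -
    have "exp (t * (\<nu> + 1) / 2) = exp (t / 2) powr (\<nu> + 1)"
      by (simp add: powr_def algebra_simps)
    moreover have "S powr (- \<nu>) / S = S powr (- (\<nu> + 1))"
      using S_pos powr_diff[of S "- \<nu>" 1] by simp
    moreover have "S powr (- (\<nu> + 1)) = inverse (exp (t / 2) powr (\<nu> + 1)) * (1 - q) powr (- (\<nu> + 1))"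
      unfolding S using q by (simp only: powr_mult exp_ge_zero diff_ge_0_iff_ge less_imp_le powr_minus inverse_mult_distrib)
    moreover have "exp (t / 2) powr (\<nu> + 1) \<noteq> 0" by simp
    moreover have "- (\<nu> + 1) = - \<nu> - 1" by simp
    ultimately show ?thesis
      by (metis (no_types, lifting) mult.assoc mult.commute mult.left_neutral right_inverse times_divide_eq_left)
  qed
  have p3: "- (exp (- t / 2) / S) * (x + y) = - (q * (x + y) / (1 - q))"
    unfolding e2 S by simp
  have "e * X * (a * (b * c * B)) = (e * c) * X * ((a * b) * B)" for e X a b c B :: real
    by (simp add: mult_ac)
  then have "exp (t * (\<nu> + 1) / 2) / S * exp (- (exp (- t / 2) / S) * (x + y))
      * ((x * y) powr (- \<nu> / 2) * ((x * y) powr (\<nu> / 2) * S powr (- \<nu>) * bessel_series \<nu> (q * x * y / (1 - q)\<^sup>2)))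
    = (1 - q) powr (- \<nu> - 1) * exp (- (q * (x + y) / (1 - q))) * bessel_series \<nu> (q * x * y / (1 - q)\<^sup>2)"
    by (simp only: p1 p2 p3 mult_1)
  then show ?thesis
    unfolding I laguerre_kernel1_def q_def S_def by simp
qed

section \<open>The measure on the orthant and its product structure\<close>

lemma pos_orthant_borel[measurable]: "pos_orthant \<in> sets (borel :: (real ^ 'n) measure)"
proof -
  have "pos_orthant = (\<Inter>i\<in>UNIV. {x :: real ^ 'n. 0 < x $ i})"
    by (auto simp: pos_orthant_def)
  moreover have "open (\<Inter>i\<in>UNIV. {x :: real ^ 'n. 0 < x $ i})"
    by (intro open_INT ballI open_Collect_less continuous_intros) simp
  ultimately have "open (pos_orthant :: (real ^ 'n) set)" by simp
  then show ?thesis by auto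
qed

lemma space_laguerre_measure[simp]: "space (laguerre_measure \<alpha>) = pos_orthant"
  by (simp add: laguerre_measure_def space_restrict_space)

lemma sets_laguerre_measure: "sets (laguerre_measure \<alpha>) = sets (restrict_space borel pos_orthant)"
  by (simp add: laguerre_measure_def sets_restrict_space)

lemma ident_measurable_laguerre_measure: "(\<lambda>x. x) \<in> laguerre_measure \<alpha> \<rightarrow>\<^sub>M borel"
  unfolding measurable_cong_sets[OF sets_laguerre_measure refl]
  by (intro measurable_restrict_space1) simp

lemma borel_measurable_vec_nth[measurable (raw)]:
  fixes f :: "'a \<Rightarrow> real ^ 'n"
  assumes "f \<in> N \<rightarrow>\<^sub>M borel"
  shows "(\<lambda>w. f w $ i) \<in> borel_measurable N"
proof -
  have "(\<lambda>x :: real ^ 'n. x $ i) \<in> borel_measurable borel"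
    by (intro borel_measurable_continuous_onI continuous_intros)
  from measurable_compose[OF assms this] show ?thesis .
qed

lemma nn_integral_laguerre_measure:
  fixes \<alpha> :: "real ^ 'n"
  assumes "f \<in> borel_measurable (laguerre_measure \<alpha>)"
  shows "(\<integral>\<^sup>+x. f x \<partial>laguerre_measure \<alpha>)
    = (\<integral>\<^sup>+x. ennreal (\<Prod>i\<in>UNIV. x $ i powr (\<alpha> $ i) * exp (- (x $ i))) * f x * indicator pos_orthant x \<partial>lborel)"
proof -
  have f: "f \<in> borel_measurable (restrict_space lborel pos_orthant)"
    using assms by (simp add: laguerre_measure_def)
  have "(\<lambda>x :: real ^ 'n. ennreal (\<Prod>i\<in>UNIV. x $ i powr (\<alpha> $ i) * exp (- (x $ i)))) \<in> borel_measurable (restrict_space lborel pos_orthant)"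
    by (intro measurable_restrict_space1) measurable
  then show ?thesis
    unfolding laguerre_measure_def using f
    by (simp add: nn_integral_density nn_integral_restrict_space)
qed

lemma prod_Basis_vec:
  fixes g :: "real ^ 'n \<Rightarrow> 'b::comm_monoid_mult"
  shows "(\<Prod>b\<in>Basis. g b) = (\<Prod>i\<in>UNIV. g (axis i 1))"
proof -
  have "bij_betw (\<lambda>i. axis i (1::real)) UNIV (Basis :: (real ^ 'n) set)"
    unfolding bij_betw_def by (auto simp: inj_on_def axis_eq_axis Basis_vec_def)
  from prod.reindex_bij_betw[OF this] show ?thesis by metis
qed

text \<open>Tonelli over the coordinates. The density and the indicator of the orthant factor too
  and are absorbed in \<open>h\<close>; \<open>axis_index\<close> passes from the basis vectors,
  which index the product formula for \<open>lborel\<close>, to coordinates.\<close>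

lemma nn_integral_laguerre_measure_prod:
  fixes \<alpha> :: "real ^ 'n" and f :: "'n \<Rightarrow> real \<Rightarrow> ennreal"
  assumes f[measurable]: "\<And>i. f i \<in> borel_measurable borel"
  shows "(\<integral>\<^sup>+x. (\<Prod>i\<in>UNIV. f i (x $ i)) \<partial>laguerre_measure \<alpha>) = (\<Prod>i\<in>UNIV. \<integral>\<^sup>+u. f i u \<partial>gamma_measure (\<alpha> $ i))"
proof -
  define h where "h i u = ennreal (indicator {0<..} u * (u powr (\<alpha> $ i) * exp (- u))) * f i u" for i u
  have hm[measurable]: "h i \<in> borel_measurable borel" for i unfolding h_def by measurable
  note ident_measurable_laguerre_measure[measurable]
  have "(\<integral>\<^sup>+x. (\<Prod>i\<in>UNIV. f i (x $ i)) \<partial>laguerre_measure \<alpha>)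
    = (\<integral>\<^sup>+x. ennreal (\<Prod>i\<in>UNIV. x $ i powr (\<alpha> $ i) * exp (- (x $ i))) * (\<Prod>i\<in>UNIV. f i (x $ i)) * indicator pos_orthant x \<partial>lborel)"
    by (rule nn_integral_laguerre_measure) measurable
  also have "\<dots> = (\<integral>\<^sup>+x. (\<Prod>i\<in>UNIV. h i (x $ i)) \<partial>lborel)"
  proof (rule nn_integral_cong)
    fix x :: "real ^ 'n"
    show "ennreal (\<Prod>i\<in>UNIV. x $ i powr (\<alpha> $ i) * exp (- (x $ i))) * (\<Prod>i\<in>UNIV. f i (x $ i)) * indicator pos_orthant x = (\<Prod>i\<in>UNIV. h i (x $ i))"
    proof (cases "x \<in> pos_orthant")
      case True
      have "(\<Prod>i\<in>UNIV. h i (x $ i)) = (\<Prod>i\<in>UNIV. ennreal (x $ i powr (\<alpha> $ i) * exp (- (x $ i)))) * (\<Prod>i\<in>UNIV. f i (x $ i))"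
        unfolding prod.distrib[symmetric] using True by (intro prod.cong) (auto simp: h_def pos_orthant_def)
      also have "(\<Prod>i\<in>UNIV. ennreal (x $ i powr (\<alpha> $ i) * exp (- (x $ i)))) = ennreal (\<Prod>i\<in>UNIV. x $ i powr (\<alpha> $ i) * exp (- (x $ i)))"
        by (rule prod_ennreal) simp
      finally show ?thesis using True by simp
    next
      case False
      then obtain i where "\<not> 0 < x $ i" by (auto simp: pos_orthant_def)
      then have "h i (x $ i) = 0" by (simp add: h_def)
      then have "(\<Prod>i\<in>UNIV. h i (x $ i)) = 0" by (intro prod_zero) auto
      then show ?thesis using False by simp
    qed
  qed
  also have "\<dots> = (\<integral>\<^sup>+x. (\<Prod>b\<in>(Basis :: (real ^ 'n) set). h (axis_index b) (x \<bullet> b)) \<partial>lborel)"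
    by (simp add: prod_Basis_vec axis_index_axis inner_axis)
  also have "\<dots> = (\<Prod>b\<in>(Basis :: (real ^ 'n) set). \<integral>\<^sup>+u. h (axis_index b) u \<partial>lborel)"
    by (rule nn_integral_lborel_prod) auto
  also have "\<dots> = (\<Prod>i\<in>UNIV. \<integral>\<^sup>+u. h i u \<partial>lborel)"
    by (simp add: prod_Basis_vec axis_index_axis)
  also have "\<dots> = (\<Prod>i\<in>UNIV. \<integral>\<^sup>+u. f i u \<partial>gamma_measure (\<alpha> $ i))"
    unfolding gamma_measure_def h_def by (intro prod.cong refl) (simp add: nn_integral_density)
  finally show ?thesis .
qed

lemma sigma_finite_laguerre_measure: "sigma_finite_measure (laguerre_measure (\<alpha> :: real ^ 'n))"
proof -
  have s: "sigma_finite_measure (restrict_space lborel (pos_orthant :: (real ^ 'n) set))"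
    by (intro sigma_finite_measure_restrict_space lborel.sigma_finite_measure_axioms) simp
  have "(\<lambda>x :: real ^ 'n. ennreal (\<Prod>i\<in>UNIV. x $ i powr (\<alpha> $ i) * exp (- (x $ i)))) \<in> borel_measurable (restrict_space lborel pos_orthant)"
    by (intro measurable_restrict_space1) measurable
  then show ?thesis
    unfolding laguerre_measure_def
    by (subst sigma_finite_measure.sigma_finite_iff_density_finite[OF s]) auto
qed

lemma laguerre_measure_add_axis:
  "laguerre_measure (\<alpha> + axis j 1 :: real ^ 'n) = density (laguerre_measure \<alpha>) (\<lambda>x. ennreal (x $ j))"
proof -
  let ?w = "\<lambda>\<alpha> x :: real ^ 'n. \<Prod>i\<in>UNIV. x $ i powr (\<alpha> $ i) * exp (- (x $ i))"
  have w: "?w (\<alpha> + axis j 1) x = ?w \<alpha> x * x $ j" if "x \<in> pos_orthant" for x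
  proof -
    have "?w (\<alpha> + axis j 1) x = (\<Prod>i\<in>UNIV. x $ i powr (\<alpha> $ i) * exp (- (x $ i)) * (if i = j then x $ i else 1))"
      using that by (intro prod.cong refl) (auto simp: axis_def powr_add pos_orthant_def abs_of_pos)
    also have "\<dots> = ?w \<alpha> x * x $ j"
      by (simp add: prod.distrib)
    finally show ?thesis .
  qed
  have [measurable]: "(\<lambda>x :: real ^ 'n. ennreal (?w \<beta> x)) \<in> borel_measurable (restrict_space lborel pos_orthant)"
    "(\<lambda>x :: real ^ 'n. ennreal (x $ j)) \<in> borel_measurable (restrict_space lborel pos_orthant)" for \<beta>
    by (intro measurable_restrict_space1; measurable)+
  have "density (laguerre_measure \<alpha>) (\<lambda>x. ennreal (x $ j)) = density (restrict_space lborel pos_orthant) (\<lambda>x. ennreal (?w \<alpha> x) * ennreal (x $ j))"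
    unfolding laguerre_measure_def by (rule density_density_eq) measurable
  also have "\<dots> = laguerre_measure (\<alpha> + axis j 1)"
    unfolding laguerre_measure_def
  proof (rule density_cong)
    show "AE x in restrict_space lborel pos_orthant. ennreal (?w \<alpha> x) * ennreal (x $ j) = ennreal (?w (\<alpha> + axis j 1) x)"
    proof (rule AE_I2)
      fix x :: "real ^ 'n" assume "x \<in> space (restrict_space lborel pos_orthant)"
      then have x: "x \<in> pos_orthant" by (simp add: space_restrict_space)
      have "?w \<alpha> x \<ge> 0" by (intro prod_nonneg) auto
      then show "ennreal (?w \<alpha> x) * ennreal (x $ j) = ennreal (?w (\<alpha> + axis j 1) x)"
        unfolding w[OF x] by (intro ennreal_mult'[symmetric])
    qed
  qed measurable
  finally show ?thesis ..
qed

section \<open>The heat kernel as a product, and its Markov property\<close>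

lemma laguerre_kernel_eq_prod:
  fixes \<gamma> :: "real ^ 'n"
  assumes "\<And>i. \<gamma> $ i > -1" "t > 0" "x \<in> pos_orthant" "y \<in> pos_orthant"
  shows "laguerre_kernel \<gamma> t x y = (\<Prod>i\<in>UNIV. laguerre_kernel1 (\<gamma> $ i) (exp (- t)) (x $ i) (y $ i))"
proof -
  have "exp (t * ((\<Sum>i\<in>UNIV. \<gamma> $ i) + real CARD('n)) / 2) = (\<Prod>i\<in>UNIV. exp (t * (\<gamma> $ i + 1) / 2))"
    by (simp add: exp_sum[symmetric] sum.distrib sum_distrib_left[symmetric] sum_divide_distrib[symmetric])
  moreover have "exp (- (exp (- t / 2) / (2 * sinh (t / 2))) * (\<Sum>i\<in>UNIV. x $ i + y $ i))
    = (\<Prod>i\<in>UNIV. exp (- (exp (- t / 2) / (2 * sinh (t / 2))) * (x $ i + y $ i)))"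
    by (simp add: exp_sum[symmetric] sum_distrib_left)
  moreover have "(2 * sinh (t / 2)) ^ CARD('n) = (\<Prod>i\<in>(UNIV :: 'n set). 2 * sinh (t / 2))"
    by (simp add: prod_constant)
  ultimately have "laguerre_kernel \<gamma> t x y = (\<Prod>i\<in>UNIV. exp (t * (\<gamma> $ i + 1) / 2) / (2 * sinh (t / 2))
      * exp (- (exp (- t / 2) / (2 * sinh (t / 2))) * (x $ i + y $ i))
      * ((x $ i * y $ i) powr (- \<gamma> $ i / 2) * bessel_I (\<gamma> $ i) (sqrt (x $ i * y $ i) / sinh (t / 2))))"
    unfolding laguerre_kernel_def by (simp only: prod.distrib prod_dividef)
  also have "\<dots> = (\<Prod>i\<in>UNIV. laguerre_kernel1 (\<gamma> $ i) (exp (- t)) (x $ i) (y $ i))"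
    using assms by (intro prod.cong refl laguerre_kernel1_eq_bessel_I) (auto simp: pos_orthant_def)
  finally show ?thesis .
qed

lemma measurable_fst_snd_laguerre:
  fixes \<alpha> :: "real ^ 'n"
  shows "fst \<in> laguerre_measure \<alpha> \<Otimes>\<^sub>M laguerre_measure \<alpha> \<rightarrow>\<^sub>M borel"
    "snd \<in> laguerre_measure \<alpha> \<Otimes>\<^sub>M laguerre_measure \<alpha> \<rightarrow>\<^sub>M borel"
  by (rule measurable_compose[OF measurable_fst ident_measurable_laguerre_measure]
      measurable_compose[OF measurable_snd ident_measurable_laguerre_measure])+

lemma laguerre_kernel_measurable:
  fixes \<alpha> \<gamma> :: "real ^ 'n"
  assumes "\<And>i. \<gamma> $ i > -1" "t > 0"
  shows "(\<lambda>z. laguerre_kernel \<gamma> t (fst z) (snd z)) \<in> borel_measurable (laguerre_measure \<alpha> \<Otimes>\<^sub>M laguerre_measure \<alpha>)"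
proof -
  note measurable_fst_snd_laguerre[measurable]
  have "(\<lambda>z. \<Prod>i\<in>UNIV. laguerre_kernel1 (\<gamma> $ i) (exp (- t)) (fst z $ i) (snd z $ i))
      \<in> borel_measurable (laguerre_measure \<alpha> \<Otimes>\<^sub>M laguerre_measure \<alpha>)"
    by measurable
  then show ?thesis
    using assms
    by (subst measurable_cong[where g = "\<lambda>z. \<Prod>i\<in>UNIV. laguerre_kernel1 (\<gamma> $ i) (exp (- t)) (fst z $ i) (snd z $ i)"])
      (auto simp: space_pair_measure laguerre_kernel_eq_prod)
qed

lemma laguerre_kernel_nonneg:
  fixes \<gamma> :: "real ^ 'n"
  assumes "\<And>i. \<gamma> $ i > -1" "t > 0" "x \<in> pos_orthant" "y \<in> pos_orthant"
  shows "laguerre_kernel \<gamma> t x y \<ge> 0"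
  using assms by (subst laguerre_kernel_eq_prod) (auto simp: pos_orthant_def intro!: prod_nonneg laguerre_kernel1_nonneg)

lemma laguerre_kernel_sym: "laguerre_kernel \<gamma> t x y = laguerre_kernel \<gamma> t y x"
  unfolding laguerre_kernel_def by (simp add: add.commute mult.commute)

lemma laguerre_kernel_markov:
  fixes \<gamma> :: "real ^ 'n"
  assumes "\<And>i. \<gamma> $ i > -1" "t > 0" "x \<in> pos_orthant"
  shows "(\<integral>\<^sup>+y. ennreal (laguerre_kernel \<gamma> t x y) \<partial>laguerre_measure \<gamma>) = 1"
proof -
  have x: "x $ i > 0" for i using assms by (auto simp: pos_orthant_def)
  have "(\<integral>\<^sup>+y. ennreal (laguerre_kernel \<gamma> t x y) \<partial>laguerre_measure \<gamma>)
    = (\<integral>\<^sup>+y. (\<Prod>i\<in>UNIV. ennreal (laguerre_kernel1 (\<gamma> $ i) (exp (- t)) (x $ i) (y $ i))) \<partial>laguerre_measure \<gamma>)"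
  proof (rule nn_integral_cong)
    fix y :: "real ^ 'n" assume "y \<in> space (laguerre_measure \<gamma>)"
    then show "ennreal (laguerre_kernel \<gamma> t x y) = (\<Prod>i\<in>UNIV. ennreal (laguerre_kernel1 (\<gamma> $ i) (exp (- t)) (x $ i) (y $ i)))"
      using assms by (subst prod_ennreal) (auto simp: laguerre_kernel_eq_prod pos_orthant_def intro!: laguerre_kernel1_nonneg)
  qed
  also have "\<dots> = (\<Prod>i\<in>UNIV. \<integral>\<^sup>+u. ennreal (laguerre_kernel1 (\<gamma> $ i) (exp (- t)) (x $ i) u) \<partial>gamma_measure (\<gamma> $ i))"
    by (rule nn_integral_laguerre_measure_prod) measurable
  also have "\<dots> = 1"
    using assms x by (simp add: nn_integral_laguerre_kernel1)
  finally show ?thesis .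
qed

lemma finite_laguerre_measure:
  fixes \<gamma> :: "real ^ 'n"
  assumes "\<And>i. \<gamma> $ i > -1"
  shows "finite_measure (laguerre_measure \<gamma>)"
proof
  have "emeasure (laguerre_measure \<gamma>) (space (laguerre_measure \<gamma>)) = (\<integral>\<^sup>+x. (\<Prod>i\<in>(UNIV :: 'n set). 1) \<partial>laguerre_measure \<gamma>)"
    by simp
  also have "\<dots> = (\<Prod>i\<in>UNIV. \<integral>\<^sup>+u. 1 \<partial>gamma_measure (\<gamma> $ i))"
    by (rule nn_integral_laguerre_measure_prod) measurable
  also have "\<dots> = (\<Prod>i\<in>UNIV. ennreal (Gamma (\<gamma> $ i + 1)))"
  proof (intro prod.cong refl)
    fix i show "(\<integral>\<^sup>+u. 1 \<partial>gamma_measure (\<gamma> $ i)) = ennreal (Gamma (\<gamma> $ i + 1))"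
      using nn_integral_gamma_measure_power[of "\<gamma> $ i" 0] assms[of i] by simp
  qed
  also have "\<dots> = ennreal (\<Prod>i\<in>UNIV. Gamma (\<gamma> $ i + 1))"
  proof (rule prod_ennreal)
    fix i show "0 \<le> Gamma (\<gamma> $ i + 1)" using assms[of i] by (intro Gamma_real_nonneg) simp
  qed
  finally show "emeasure (laguerre_measure \<gamma>) (space (laguerre_measure \<gamma>)) \<noteq> \<infinity>" by simp
qed

text \<open>Coordinate k contributes the bound of
  \<open>nn_integral_laguerre_kernel1_square_diff\<close>; each other coordinate contributes its
  total mass Gamma (\<gamma>_i + 1).\<close>

lemma nn_integral_laguerre_kernel_coordinate_diff:
  fixes \<gamma> :: "real ^ 'n"
  assumes \<gamma>: "\<And>i. \<gamma> $ i > -1"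
  obtains c where "\<And>t. t > 0 \<Longrightarrow> (\<integral>\<^sup>+x. \<integral>\<^sup>+y. ennreal (laguerre_kernel \<gamma> t x y * (x $ k - y $ k)\<^sup>2) \<partial>laguerre_measure \<gamma> \<partial>laguerre_measure \<gamma>)
    \<le> ennreal (c * (1 - exp (- t)))" "c \<ge> 0"
proof -
  define c where "c = 2 * Gamma (\<gamma> $ k + 3) * (\<Prod>i\<in>UNIV - {k}. Gamma (\<gamma> $ i + 1))"
  have G: "0 \<le> Gamma (\<gamma> $ i + 1)" for i using \<gamma>[of i] by (intro Gamma_real_nonneg) simp
  have G3: "0 \<le> Gamma (\<gamma> $ k + 3)" using \<gamma>[of k] by (intro Gamma_real_nonneg) simp
  have "(\<integral>\<^sup>+x. \<integral>\<^sup>+y. ennreal (laguerre_kernel \<gamma> t x y * (x $ k - y $ k)\<^sup>2) \<partial>laguerre_measure \<gamma> \<partial>laguerre_measure \<gamma>)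
    \<le> ennreal (c * (1 - exp (- t)))" if t: "t > 0" for t
  proof -
    let ?g = "\<lambda>i u v. laguerre_kernel1 (\<gamma> $ i) (exp (- t)) u v"
    have q: "0 < exp (- t)" "exp (- t) < 1" using t by auto
    define F where "F i u v = (if i = k then ennreal (?g i u v * (u - v)\<^sup>2) else ennreal (?g i u v))" for i u v
    have [measurable]: "(\<lambda>v. F i u v) \<in> borel_measurable borel" for i u
      unfolding F_def by (cases "i = k") (simp_all, measurable)
    have [measurable]: "(\<lambda>u. \<integral>\<^sup>+v. F i u v \<partial>gamma_measure (\<gamma> $ i)) \<in> borel_measurable borel" for i
    proof -
      interpret sigma_finite_measure "gamma_measure (\<gamma> $ i)" by (rule sigma_finite_gamma_measure)
      show ?thesis
        unfolding F_def by (rule borel_measurable_nn_integral) (cases "i = k"; simp add: case_prod_unfold)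
    qed
    have "(\<integral>\<^sup>+x. \<integral>\<^sup>+y. ennreal (laguerre_kernel \<gamma> t x y * (x $ k - y $ k)\<^sup>2) \<partial>laguerre_measure \<gamma> \<partial>laguerre_measure \<gamma>)
      = (\<integral>\<^sup>+x. \<integral>\<^sup>+y. (\<Prod>i\<in>UNIV. F i (x $ i) (y $ i)) \<partial>laguerre_measure \<gamma> \<partial>laguerre_measure \<gamma>)"
    proof (intro nn_integral_cong)
      fix x y :: "real ^ 'n"
      assume "x \<in> space (laguerre_measure \<gamma>)" "y \<in> space (laguerre_measure \<gamma>)"
      then have xy: "x \<in> pos_orthant" "y \<in> pos_orthant" by auto
      then have nn: "0 \<le> ?g i (x $ i) (y $ i)" for i
        using \<gamma> q by (intro laguerre_kernel1_nonneg) (auto simp: pos_orthant_def)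
      have "(\<Prod>i\<in>UNIV. F i (x $ i) (y $ i)) = (\<Prod>i\<in>UNIV. ennreal (?g i (x $ i) (y $ i) * (if i = k then (x $ k - y $ k)\<^sup>2 else 1)))"
        unfolding F_def by (intro prod.cong refl) auto
      also have "\<dots> = ennreal (\<Prod>i\<in>UNIV. ?g i (x $ i) (y $ i) * (if i = k then (x $ k - y $ k)\<^sup>2 else 1))"
        using nn by (intro prod_ennreal) auto
      also have "(\<Prod>i\<in>UNIV. ?g i (x $ i) (y $ i) * (if i = k then (x $ k - y $ k)\<^sup>2 else 1)) = laguerre_kernel \<gamma> t x y * (x $ k - y $ k)\<^sup>2"
        using \<gamma> t xy by (simp add: prod.distrib laguerre_kernel_eq_prod)
      finally show "ennreal (laguerre_kernel \<gamma> t x y * (x $ k - y $ k)\<^sup>2) = (\<Prod>i\<in>UNIV. F i (x $ i) (y $ i))" ..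
    qed
    also have "\<dots> = (\<integral>\<^sup>+x. (\<Prod>i\<in>UNIV. \<integral>\<^sup>+v. F i (x $ i) v \<partial>gamma_measure (\<gamma> $ i)) \<partial>laguerre_measure \<gamma>)"
      by (intro nn_integral_cong nn_integral_laguerre_measure_prod) measurable
    also have "\<dots> = (\<Prod>i\<in>UNIV. \<integral>\<^sup>+u. \<integral>\<^sup>+v. F i u v \<partial>gamma_measure (\<gamma> $ i) \<partial>gamma_measure (\<gamma> $ i))"
      by (rule nn_integral_laguerre_measure_prod) measurable
    also have "\<dots> = (\<integral>\<^sup>+u. \<integral>\<^sup>+v. F k u v \<partial>gamma_measure (\<gamma> $ k) \<partial>gamma_measure (\<gamma> $ k))
       * (\<Prod>i\<in>UNIV - {k}. \<integral>\<^sup>+u. \<integral>\<^sup>+v. F i u v \<partial>gamma_measure (\<gamma> $ i) \<partial>gamma_measure (\<gamma> $ i))"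
      by (rule prod.remove) auto
    also have "(\<Prod>i\<in>UNIV - {k}. \<integral>\<^sup>+u. \<integral>\<^sup>+v. F i u v \<partial>gamma_measure (\<gamma> $ i) \<partial>gamma_measure (\<gamma> $ i)) = (\<Prod>i\<in>UNIV - {k}. ennreal (Gamma (\<gamma> $ i + 1)))"
    proof (intro prod.cong refl)
      fix i assume i: "i \<in> UNIV - {k}"
      have "(\<integral>\<^sup>+u. \<integral>\<^sup>+v. F i u v \<partial>gamma_measure (\<gamma> $ i) \<partial>gamma_measure (\<gamma> $ i)) = (\<integral>\<^sup>+u. ennreal (u ^ 0) \<partial>gamma_measure (\<gamma> $ i))"
        using AE_gamma_measure_pos[of "\<gamma> $ i"]
      proof (intro nn_integral_cong_AE, eventually_elim)
        fix u :: real assume "0 < u"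
        then show "(\<integral>\<^sup>+v. F i u v \<partial>gamma_measure (\<gamma> $ i)) = ennreal (u ^ 0)"
          using i \<gamma> q by (simp add: F_def nn_integral_laguerre_kernel1)
      qed
      also have "\<dots> = ennreal (Gamma (\<gamma> $ i + real 0 + 1))"
        using \<gamma>[of i] by (intro nn_integral_gamma_measure_power) simp
      finally show "(\<integral>\<^sup>+u. \<integral>\<^sup>+v. F i u v \<partial>gamma_measure (\<gamma> $ i) \<partial>gamma_measure (\<gamma> $ i)) = ennreal (Gamma (\<gamma> $ i + 1))" by simp
    qed
    also have "\<dots> = ennreal (\<Prod>i\<in>UNIV - {k}. Gamma (\<gamma> $ i + 1))"
      using G by (intro prod_ennreal)
    also have "(\<integral>\<^sup>+u. \<integral>\<^sup>+v. F k u v \<partial>gamma_measure (\<gamma> $ k) \<partial>gamma_measure (\<gamma> $ k)) * ennreal (\<Prod>i\<in>UNIV - {k}. Gamma (\<gamma> $ i + 1))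
      \<le> ennreal (2 * (1 - exp (- t)) * Gamma (\<gamma> $ k + 3)) * ennreal (\<Prod>i\<in>UNIV - {k}. Gamma (\<gamma> $ i + 1))"
      unfolding F_def using nn_integral_laguerre_kernel1_square_diff[OF \<gamma>[of k] q] by (intro mult_right_mono) simp_all
    also have "\<dots> = ennreal (c * (1 - exp (- t)))"
    proof -
      have "2 * (1 - exp (- t)) * Gamma (\<gamma> $ k + 3) * (\<Prod>i\<in>UNIV - {k}. Gamma (\<gamma> $ i + 1)) = c * (1 - exp (- t))"
        by (simp only: c_def mult_ac)
      then show ?thesis
        using G by (subst ennreal_mult''[symmetric]) (auto intro!: prod_nonneg)
    qed
    finally show ?thesis .
  qed
  moreover have "c \<ge> 0" unfolding c_def using G G3 by (intro mult_nonneg_nonneg prod_nonneg) auto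
  ultimately show ?thesis by (rule that)
qed

text \<open>The substantial point is the Lipschitz energy: (g x - g y)^2 is at most L^2 times the
  sum of the squared coordinate differences, whose energies are O(1 - exp (-t)).\<close>

lemma markov_kernel_family_laguerre:
  fixes \<gamma> :: "real ^ 'n"
  assumes \<gamma>: "\<And>i. \<gamma> $ i > -1"
  shows "markov_kernel_family (laguerre_measure \<gamma>) (laguerre_kernel \<gamma>)"
proof -
  let ?M = "laguerre_measure \<gamma>"
  let ?E = "\<lambda>t k. \<integral>\<^sup>+x. \<integral>\<^sup>+y. ennreal (laguerre_kernel \<gamma> t x y * (x $ k - y $ k)\<^sup>2) \<partial>?M \<partial>?M"
  interpret finite_measure ?M by (rule finite_laguerre_measure[OF \<gamma>])
  show ?thesis
  proof (intro markov_kernel_family.intro markov_kernel_family_axioms.intro)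
    show "finite_measure ?M" by (rule finite_laguerre_measure[OF \<gamma>])
    show "(\<lambda>x. x) \<in> ?M \<rightarrow>\<^sub>M borel" by (rule ident_measurable_laguerre_measure)
    show "sets ?M \<subseteq> sets borel"
      by (auto simp: sets_laguerre_measure sets_restrict_space)
    show kern: "symmetric_kernel ?M (laguerre_kernel \<gamma> t) 1" if t: "0 < t" for t
      using laguerre_kernel_measurable[OF \<gamma> t, of \<gamma>] t
      by unfold_locales
        (auto simp: case_prod_unfold laguerre_kernel_markov[OF \<gamma>] intro: laguerre_kernel_sym laguerre_kernel_nonneg[OF \<gamma>])
    show "(\<integral>\<^sup>+y. ennreal (laguerre_kernel \<gamma> t x y) \<partial>?M) = 1" if "0 < t" "x \<in> space ?M" for t x
      using that by (simp add: laguerre_kernel_markov[OF \<gamma>])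
    fix g :: "real ^ 'n \<Rightarrow> real" and L :: real
    assume g: "\<And>x y. \<bar>g x - g y\<bar> \<le> L * dist x y"
    have "\<forall>k. \<exists>c\<ge>0. \<forall>t>0. ?E t k \<le> ennreal (c * (1 - exp (- t)))"
    proof
      fix k
      obtain c where c: "\<And>t. t > 0 \<Longrightarrow> ?E t k
          \<le> ennreal (c * (1 - exp (- t)))" "c \<ge> 0"
        by (rule nn_integral_laguerre_kernel_coordinate_diff[OF \<gamma>, of k]) blast
      show "\<exists>c\<ge>0. \<forall>t>0. ?E t k
          \<le> ennreal (c * (1 - exp (- t)))"
        by (rule exI[of _ c], intro conjI allI impI c)
    qed
    from choice[OF this] obtain c where "\<forall>k. c k \<ge> 0 \<and> (\<forall>t>0. ?E t k
          \<le> ennreal (c k * (1 - exp (- t))))" ..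
    then have c: "\<And>k. c k \<ge> 0"
      "\<And>k t. t > 0 \<Longrightarrow> ?E t k \<le> ennreal (c k * (1 - exp (- t)))"
      by simp_all
    show "((\<lambda>t. \<integral>\<^sup>+x. \<integral>\<^sup>+y. ennreal (laguerre_kernel \<gamma> t x y * (g x - g y)\<^sup>2) \<partial>?M \<partial>?M) \<longlongrightarrow> 0) (at_right 0)"
    proof (rule tendsto_ennreal_zero_le)
      have "((\<lambda>t. ennreal (L\<^sup>2 * (\<Sum>k\<in>UNIV. c k) * (1 - exp (- t)))) \<longlongrightarrow> ennreal (L\<^sup>2 * (\<Sum>k\<in>UNIV. c k) * (1 - exp (- 0)))) (at_right 0)"
        by (intro tendsto_ennrealI tendsto_intros)
      then show "((\<lambda>t. ennreal (L\<^sup>2 * (\<Sum>k\<in>UNIV. c k) * (1 - exp (- t)))) \<longlongrightarrow> 0) (at_right 0)" by simp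
      show "eventually (\<lambda>t. (\<integral>\<^sup>+x. \<integral>\<^sup>+y. ennreal (laguerre_kernel \<gamma> t x y * (g x - g y)\<^sup>2) \<partial>?M \<partial>?M)
          \<le> ennreal (L\<^sup>2 * (\<Sum>k\<in>UNIV. c k) * (1 - exp (- t)))) (at_right 0)"
        using eventually_at_right_less[of 0]
      proof eventually_elim
        fix t :: real assume t: "0 < t"
        interpret k: symmetric_kernel ?M "laguerre_kernel \<gamma> t" 1 by (rule kern[OF t])
        note k.kernel_measurable'[measurable] measurable_fst_snd_laguerre[measurable] ident_measurable_laguerre_measure[measurable]
        have row: "laguerre_kernel \<gamma> t x \<in> borel_measurable ?M" if "x \<in> space ?M" for x
          using k.kernel_measurable_row[OF that] by simp
        have "(\<integral>\<^sup>+x. \<integral>\<^sup>+y. ennreal (laguerre_kernel \<gamma> t x y * (g x - g y)\<^sup>2) \<partial>?M \<partial>?M)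
          \<le> (\<integral>\<^sup>+x. \<integral>\<^sup>+y. ennreal (L\<^sup>2) * (\<Sum>k\<in>UNIV. ennreal (laguerre_kernel \<gamma> t x y * (x $ k - y $ k)\<^sup>2)) \<partial>?M \<partial>?M)"
        proof (intro nn_integral_mono)
          fix x y assume xy: "x \<in> space ?M" "y \<in> space ?M"
          have nn: "0 \<le> laguerre_kernel \<gamma> t x y" using xy by (rule k.kernel_nonneg)
          have "(g x - g y)\<^sup>2 = \<bar>g x - g y\<bar>\<^sup>2" by simp
          also have "\<dots> \<le> (L * dist x y)\<^sup>2"
            using g by (intro power_mono) auto
          also have "\<dots> = L\<^sup>2 * (\<Sum>k\<in>UNIV. (x $ k - y $ k)\<^sup>2)"
            by (simp add: power_mult_distrib dist_vec_def L2_set_def dist_real_def sum_nonneg)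
          finally have "laguerre_kernel \<gamma> t x y * (g x - g y)\<^sup>2 \<le> laguerre_kernel \<gamma> t x y * (L\<^sup>2 * (\<Sum>k\<in>UNIV. (x $ k - y $ k)\<^sup>2))"
            using nn by (rule mult_left_mono)
          also have "\<dots> = L\<^sup>2 * (\<Sum>k\<in>UNIV. laguerre_kernel \<gamma> t x y * (x $ k - y $ k)\<^sup>2)"
            by (simp add: sum_distrib_left mult_ac)
          finally have "ennreal (laguerre_kernel \<gamma> t x y * (g x - g y)\<^sup>2) \<le> ennreal (L\<^sup>2 * (\<Sum>k\<in>UNIV. laguerre_kernel \<gamma> t x y * (x $ k - y $ k)\<^sup>2))"
            by (rule ennreal_leI)
          also have "\<dots> = ennreal (L\<^sup>2) * (\<Sum>k\<in>UNIV. ennreal (laguerre_kernel \<gamma> t x y * (x $ k - y $ k)\<^sup>2))"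
            using nn by (subst sum_ennreal) (auto simp only: ennreal_mult' zero_le_power2 mult_nonneg_nonneg)
          finally show "ennreal (laguerre_kernel \<gamma> t x y * (g x - g y)\<^sup>2) \<le> ennreal (L\<^sup>2) * (\<Sum>k\<in>UNIV. ennreal (laguerre_kernel \<gamma> t x y * (x $ k - y $ k)\<^sup>2))" .
        qed
        also have "\<dots> = (\<integral>\<^sup>+x. ennreal (L\<^sup>2) * (\<Sum>k\<in>UNIV. \<integral>\<^sup>+y. ennreal (laguerre_kernel \<gamma> t x y * (x $ k - y $ k)\<^sup>2) \<partial>?M) \<partial>?M)"
          by (rule nn_integral_cong) (use row in \<open>simp add: nn_integral_cmult nn_integral_sum\<close>)
        also have "\<dots> = ennreal (L\<^sup>2) * (\<Sum>k\<in>UNIV. \<integral>\<^sup>+x. \<integral>\<^sup>+y. ennreal (laguerre_kernel \<gamma> t x y * (x $ k - y $ k)\<^sup>2) \<partial>?M \<partial>?M)"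
          by (simp add: nn_integral_cmult nn_integral_sum)
        also have "\<dots> \<le> ennreal (L\<^sup>2) * (\<Sum>k\<in>UNIV. ennreal (c k * (1 - exp (- t))))"
          by (intro mult_left_mono sum_mono c t) simp
        also have "\<dots> = ennreal (L\<^sup>2 * (\<Sum>k\<in>UNIV. c k) * (1 - exp (- t)))"
          using c t by (simp add: ennreal_mult'[symmetric] sum_distrib_right mult.assoc)
        finally show "(\<integral>\<^sup>+x. \<integral>\<^sup>+y. ennreal (laguerre_kernel \<gamma> t x y * (g x - g y)\<^sup>2) \<partial>?M \<partial>?M)
          \<le> ennreal (L\<^sup>2 * (\<Sum>k\<in>UNIV. c k) * (1 - exp (- t)))" .
      qed
    qed
  qed
qed

text \<open>The open cube with sides (u, v) has positive measure, being a product of intervals of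
  positive measure, so it is not contained in a null set.\<close>

lemma AE_laguerre_measureE:
  fixes \<alpha> :: "real ^ 'n"
  assumes "AE x in laguerre_measure \<alpha>. P x" "0 < u" "u < v"
  obtains x where "\<And>i. u < x $ i" "\<And>i. x $ i < v" "P x"
proof -
  define F :: "real \<Rightarrow> ennreal" where "F = indicator {u<..<v}"
  note ident_measurable_laguerre_measure[measurable]
  have "(\<integral>\<^sup>+x. (\<Prod>i\<in>UNIV. F (x $ i)) \<partial>laguerre_measure \<alpha>) = (\<Prod>i\<in>UNIV. \<integral>\<^sup>+w. F w \<partial>gamma_measure (\<alpha> $ i))"
    by (rule nn_integral_laguerre_measure_prod) (simp add: F_def)
  also have "\<dots> = (\<Prod>i\<in>UNIV. emeasure (gamma_measure (\<alpha> $ i)) {u<..<v})"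
    by (simp add: F_def)
  also have "\<dots> \<noteq> 0"
    using emeasure_gamma_measure_pos[OF assms(2,3)] by (simp add: less_imp_neq[symmetric])
  finally have "\<not> (AE x in laguerre_measure \<alpha>. (\<Prod>i\<in>UNIV. F (x $ i)) = 0)"
    unfolding F_def by (subst (asm) nn_integral_0_iff_AE) auto
  moreover have "AE x in laguerre_measure \<alpha>. (\<Prod>i\<in>UNIV. F (x $ i)) = 0" if "\<And>x. P x \<Longrightarrow> (\<Prod>i\<in>UNIV. F (x $ i)) = 0"
    using assms(1) that by (rule eventually_mono)
  ultimately obtain x where "P x" "(\<Prod>i\<in>UNIV. F (x $ i)) \<noteq> 0" by blast
  then have "x $ i \<in> {u<..<v}" for i
    using prod_zero[of UNIV "\<lambda>i. F (x $ i)"] by (auto simp: F_def indicator_eq_0_iff)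
  with \<open>P x\<close> show ?thesis
    by (intro that[of x]) auto
qed

section \<open>The modified Laguerre semigroup\<close>

locale modified_laguerre =
  fixes \<alpha> :: "real ^ 'n" and j :: 'n
  assumes alpha_j: "\<alpha> $ j > - 3 / 2"
    and alpha_other: "\<And>i. i \<noteq> j \<Longrightarrow> \<alpha> $ i > -1"
begin

abbreviation "M \<equiv> laguerre_measure \<alpha>"
abbreviation "D \<equiv> modified_laguerre_domain \<alpha> j"
abbreviation "T \<equiv> modified_laguerre_semigroup \<alpha> j"

text \<open>The parameter of the heat kernel inside the modified semigroup. Its entries exceed -1,
  the range of the one-dimensional kernel, and its j-th entry exceeds -1/2, the range of the half
  moment.\<close>

definition \<gamma> :: "real ^ 'n" where "\<gamma> = \<alpha> + axis j 1"

lemma gamma_nth: "\<gamma> $ i = (if i = j then \<alpha> $ i + 1 else \<alpha> $ i)"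
  by (simp add: \<gamma>_def axis_def)

lemma gamma_j: "\<gamma> $ j > - 1 / 2"
  using alpha_j by (simp add: gamma_nth)

lemma gamma_gt: "\<gamma> $ i > -1"
  using alpha_j alpha_other[of i] by (auto simp: gamma_nth)

definition K :: "real \<Rightarrow> real ^ 'n \<Rightarrow> real ^ 'n \<Rightarrow> real" where
  "K t x y = exp (- t) * (sqrt (x $ j * y $ j) * laguerre_kernel \<gamma> t x y)"

lemma semigroup_eq_kernel:
  assumes "t > 0"
  shows "T t f = (\<lambda>x. LINT y|M. K t x y * f y)"
proof
  fix x
  have "T t f x = (LINT y|M. exp (- t) * (sqrt (x $ j * y $ j) * laguerre_kernel \<gamma> t x y * f y))"
    using assms by (simp add: modified_laguerre_semigroup_def \<gamma>_def)
  then show "T t f x = (LINT y|M. K t x y * f y)"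
    by (simp add: K_def mult.assoc)
qed

lemma domain_eq_kernel:
  "D = {f \<in> borel_measurable M. \<forall>t>0. \<forall>x\<in>pos_orthant. integrable M (\<lambda>y. K t x y * f y)}"
proof -
  have "integrable M (\<lambda>y. K t x y * f y) \<longleftrightarrow> integrable M (\<lambda>y. exp (- t) * (sqrt (x $ j * y $ j) * laguerre_kernel \<gamma> t x y * f y))" for t x f
    by (simp add: K_def mult.assoc)
  also have "\<dots> t x f \<longleftrightarrow> integrable M (\<lambda>y. sqrt (x $ j * y $ j) * laguerre_kernel \<gamma> t x y * f y)" for t x f
    by (simp add: integrable_mult_right_iff)
  finally show ?thesis
    unfolding modified_laguerre_domain_def \<gamma>_def[symmetric] by simp
qed

lemma kernel_eq_prod:
  assumes "t > 0" "x \<in> pos_orthant" "y \<in> pos_orthant"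
  shows "K t x y = exp (- t) * sqrt (x $ j)
    * (\<Prod>i\<in>UNIV. laguerre_kernel1 (\<gamma> $ i) (exp (- t)) (x $ i) (y $ i) * (if i = j then sqrt (y $ i) else 1))"
  using assms by (simp add: K_def laguerre_kernel_eq_prod[OF gamma_gt] prod.distrib real_sqrt_mult)

lemma kernel_factor_nonneg:
  assumes "t > 0" "x \<in> pos_orthant" "y \<in> pos_orthant"
  shows "0 \<le> laguerre_kernel1 (\<gamma> $ i) (exp (- t)) (x $ i) (y $ i)"
  using assms gamma_gt[of i] by (intro laguerre_kernel1_nonneg) (auto simp: pos_orthant_def)

lemma kernel_nonneg: "t > 0 \<Longrightarrow> x \<in> pos_orthant \<Longrightarrow> y \<in> pos_orthant \<Longrightarrow> 0 \<le> K t x y"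
  unfolding K_def
  by (intro mult_nonneg_nonneg laguerre_kernel_nonneg gamma_gt real_sqrt_ge_zero)
    (auto simp: pos_orthant_def intro: less_imp_le)

text \<open>Off j, kernel and measure share their parameter and the factor integrates to 1. In
  coordinate j the measure parameter is smaller by 1 and the weight sqrt y_j is present, the
  situation of \<open>nn_integral_laguerre_kernel1_sqrt\<close>.\<close>

lemma kernel_mass:
  assumes t: "t > 0" and x: "x \<in> pos_orthant"
  defines "\<mu> \<equiv> exp (- t) * x $ j / (1 - exp (- t))"
  shows "(\<integral>\<^sup>+y. ennreal (K t x y) \<partial>M) = ennreal (exp (- t / 2)) * (ennreal (sqrt (\<mu> / pi)) * half_mass (\<gamma> $ j) \<mu>)"
proof -
  let ?q = "exp (- t)"
  have q: "0 < ?q" "?q < 1" using t by auto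
  have xi: "x $ i > 0" for i using x by (simp add: pos_orthant_def)
  define F where "F i u = ennreal (laguerre_kernel1 (\<gamma> $ i) ?q (x $ i) u * (if i = j then sqrt u else 1))" for i u
  have Fm[measurable]: "F i \<in> borel_measurable borel" for i
    unfolding F_def by (cases "i = j") (simp_all, measurable)
  note ident_measurable_laguerre_measure[measurable]
  have "(\<integral>\<^sup>+y. ennreal (K t x y) \<partial>M) = (\<integral>\<^sup>+y. ennreal (?q * sqrt (x $ j)) * (\<Prod>i\<in>UNIV. F i (y $ i)) \<partial>M)"
  proof (rule nn_integral_cong)
    fix y assume "y \<in> space M"
    then have y: "y \<in> pos_orthant" by simp
    then have yi: "y $ i > 0" for i by (simp add: pos_orthant_def)
    have "(\<Prod>i\<in>UNIV. F i (y $ i)) = ennreal (\<Prod>i\<in>UNIV. laguerre_kernel1 (\<gamma> $ i) ?q (x $ i) (y $ i) * (if i = j then sqrt (y $ i) else 1))"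
      unfolding F_def using kernel_factor_nonneg[OF t x y] yi
      by (intro prod_ennreal mult_nonneg_nonneg) (auto intro: less_imp_le)
    then show "ennreal (K t x y) = ennreal (?q * sqrt (x $ j)) * (\<Prod>i\<in>UNIV. F i (y $ i))"
      unfolding kernel_eq_prod[OF t x y] using xi[of j] by (simp only:) (intro ennreal_mult', simp)
  qed
  also have "\<dots> = ennreal (?q * sqrt (x $ j)) * (\<Prod>i\<in>UNIV. \<integral>\<^sup>+u. F i u \<partial>gamma_measure (\<alpha> $ i))"
    by (subst nn_integral_cmult) (auto simp: nn_integral_laguerre_measure_prod[OF Fm])
  also have "(\<Prod>i\<in>UNIV. \<integral>\<^sup>+u. F i u \<partial>gamma_measure (\<alpha> $ i)) = (\<integral>\<^sup>+u. F j u \<partial>gamma_measure (\<alpha> $ j)) * (\<Prod>i\<in>UNIV - {j}. \<integral>\<^sup>+u. F i u \<partial>gamma_measure (\<alpha> $ i))"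
    by (rule prod.remove) auto
  also have "(\<Prod>i\<in>UNIV - {j}. \<integral>\<^sup>+u. F i u \<partial>gamma_measure (\<alpha> $ i)) = 1"
  proof (rule prod.neutral, rule ballI)
    fix i assume "i \<in> UNIV - {j}"
    then show "(\<integral>\<^sup>+u. F i u \<partial>gamma_measure (\<alpha> $ i)) = 1"
      using nn_integral_laguerre_kernel1[OF gamma_gt q xi, of i] by (simp add: F_def gamma_nth)
  qed
  also have "ennreal (?q * sqrt (x $ j)) * ((\<integral>\<^sup>+u. F j u \<partial>gamma_measure (\<alpha> $ j)) * 1) = ennreal (sqrt ?q * sqrt (\<mu> / pi)) * half_mass (\<gamma> $ j) \<mu>"
  proof -
    have "\<alpha> $ j = \<gamma> $ j - 1" by (simp add: gamma_nth)
    then show ?thesis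
      using nn_integral_laguerre_kernel1_sqrt[OF gamma_j q xi[of j]] by (simp add: F_def \<mu>_def)
  qed
  also have "sqrt ?q = exp (- t / 2)"
    by (rule real_sqrt_unique) (auto simp: exp_double[symmetric])
  finally show ?thesis
    by (simp add: ennreal_mult' mult.assoc)
qed

lemma kernel_measurable:
  assumes "t > 0"
  shows "(\<lambda>z. K t (fst z) (snd z)) \<in> borel_measurable (M \<Otimes>\<^sub>M M)"
  using laguerre_kernel_measurable[OF gamma_gt assms, of \<alpha>] measurable_fst_snd_laguerre[of \<alpha>]
  unfolding K_def by measurable

lemma symmetric_kernel_K:
  assumes t: "t > 0" and c: "c > 0"
    and bound: "\<And>\<mu>. \<mu> > 0 \<Longrightarrow> ennreal (sqrt (\<mu> / pi)) * half_mass (\<gamma> $ j) \<mu> \<le> ennreal c"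
  shows "symmetric_kernel M (K t) (c * exp (- t / 2))"
proof (intro symmetric_kernel.intro symmetric_kernel_axioms.intro)
  show "sigma_finite_measure M" by (rule sigma_finite_laguerre_measure)
  show "case_prod (K t) \<in> borel_measurable (M \<Otimes>\<^sub>M M)"
    using kernel_measurable[OF t] by (simp add: case_prod_unfold)
  show "K t x y = K t y x" for x y
    unfolding K_def by (subst laguerre_kernel_sym) (simp add: mult.commute)
  show "0 \<le> K t x y" if "x \<in> space M" "y \<in> space M" for x y
    using that t by (simp add: kernel_nonneg)
  show "0 < c * exp (- t / 2)" using c by simp
  fix x assume "x \<in> space M"
  then have x: "x \<in> pos_orthant" by simp
  define \<mu> where "\<mu> = exp (- t) * x $ j / (1 - exp (- t))"
  have \<mu>: "\<mu> > 0" unfolding \<mu>_def using x t by (auto simp: pos_orthant_def)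
  have "(\<integral>\<^sup>+y. ennreal (K t x y) \<partial>M) = ennreal (exp (- t / 2)) * (ennreal (sqrt (\<mu> / pi)) * half_mass (\<gamma> $ j) \<mu>)"
    unfolding \<mu>_def by (rule kernel_mass[OF t x])
  also have "\<dots> \<le> ennreal (exp (- t / 2)) * ennreal c"
    by (intro mult_left_mono bound \<mu>) simp
  also have "\<dots> = ennreal (c * exp (- t / 2))"
    using c by (simp add: ennreal_mult'[symmetric] mult.commute)
  finally show "(\<integral>\<^sup>+y. ennreal (K t x y) \<partial>M) \<le> ennreal (c * exp (- t / 2))" .
qed

text \<open>The bound is a product of coordinate bounds, so sqrt y_j has to be bounded together with
  the j-th kernel factor; this is the purpose of the second estimate in
  \<open>laguerre_kernel1_bounded\<close>.\<close>

lemma kernel_row_bounded: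
  assumes t: "t > 0" and x: "x \<in> pos_orthant"
  obtains B where "\<And>y. y \<in> pos_orthant \<Longrightarrow> K t x y \<le> B"
proof -
  let ?q = "exp (- t)"
  have q: "0 < ?q" "?q < 1" using t by auto
  have "\<exists>b. \<forall>u>0. laguerre_kernel1 (\<gamma> $ i) ?q (x $ i) u * (if i = j then sqrt u else 1) \<le> b" for i
  proof -
    have "x $ i > 0" using x by (simp add: pos_orthant_def)
    then obtain b where "\<And>u. u > 0 \<Longrightarrow> laguerre_kernel1 (\<gamma> $ i) ?q (x $ i) u \<le> b"
      "\<And>u. u > 0 \<Longrightarrow> laguerre_kernel1 (\<gamma> $ i) ?q (x $ i) u * sqrt u \<le> b"
      using laguerre_kernel1_bounded[OF gamma_gt q] by blast
    then show ?thesis by (intro exI[of _ b]) auto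
  qed
  then have "\<forall>i. \<exists>b. \<forall>u>0. laguerre_kernel1 (\<gamma> $ i) ?q (x $ i) u * (if i = j then sqrt u else 1) \<le> b" ..
  from choice[OF this] obtain b where b: "\<And>i u. u > 0 \<Longrightarrow> laguerre_kernel1 (\<gamma> $ i) ?q (x $ i) u * (if i = j then sqrt u else 1) \<le> b i"
    by blast
  show ?thesis
  proof (rule that)
    fix y :: "real ^ 'n" assume y: "y \<in> pos_orthant"
    then have yi: "y $ i > 0" for i by (simp add: pos_orthant_def)
    have xj: "x $ j > 0" using x by (simp add: pos_orthant_def)
    have "(\<Prod>i\<in>UNIV. laguerre_kernel1 (\<gamma> $ i) ?q (x $ i) (y $ i) * (if i = j then sqrt (y $ i) else 1)) \<le> (\<Prod>i\<in>UNIV. b i)"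
    proof (intro prod_mono conjI)
      fix i
      show "0 \<le> laguerre_kernel1 (\<gamma> $ i) ?q (x $ i) (y $ i) * (if i = j then sqrt (y $ i) else 1)"
        using kernel_factor_nonneg[OF t x y, of i] yi[of i] by (intro mult_nonneg_nonneg) auto
      show "laguerre_kernel1 (\<gamma> $ i) ?q (x $ i) (y $ i) * (if i = j then sqrt (y $ i) else 1) \<le> b i"
        by (rule b[OF yi])
    qed
    then show "K t x y \<le> exp (- t) * sqrt (x $ j) * (\<Prod>i\<in>UNIV. b i)"
      unfolding kernel_eq_prod[OF t x y] using xj by (intro mult_left_mono) auto
  qed
qed

lemma Lp_subset_domain:
  assumes f: "f \<in> Lp M p" and p: "p \<ge> 1"
  shows "f \<in> D"
  unfolding domain_eq_kernel
proof (intro CollectI conjI allI impI ballI)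
  show "f \<in> borel_measurable M" using f by (simp add: Lp_def)
  fix t :: real and x :: "real ^ 'n" assume t: "t > 0" and x: "x \<in> pos_orthant"
  obtain c where c: "c > 1" "\<And>\<mu>. \<mu> > 0 \<Longrightarrow> ennreal (sqrt (\<mu> / pi)) * half_mass (\<gamma> $ j) \<mu> \<le> ennreal c"
    using half_mass_bounded[OF gamma_j] by blast
  interpret k: symmetric_kernel M "K t" "c * exp (- t / 2)"
    using c t by (intro symmetric_kernel_K) auto
  obtain B where "\<And>y. y \<in> pos_orthant \<Longrightarrow> K t x y \<le> B"
    by (rule kernel_row_bounded[OF t x]) blast
  then show "integrable M (\<lambda>y. K t x y * f y)"
    using x by (intro k.integrable_rows_subset_domain[OF f p]) auto
qed

lemma operator_domain_modified_laguerre: "operator_domain M (D)"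
  unfolding operator_domain_def
proof (intro conjI ballI allI impI)
  show "D \<subseteq> borel_measurable M" by (auto simp: domain_eq_kernel)
  show "Lp M p \<subseteq> D" if "p \<ge> 1" for p
    using that by (auto intro: Lp_subset_domain)
  fix f g and a b :: real assume fg: "f \<in> D" "g \<in> D"
  have "integrable M (\<lambda>y. K t x y * (a * f y + b * g y))" if "t > 0" "x \<in> pos_orthant" for t x
  proof -
    have "integrable M (\<lambda>y. a * (K t x y * f y) + b * (K t x y * g y))"
      using fg that by (intro Bochner_Integration.integrable_add integrable_mult_right) (auto simp: domain_eq_kernel)
    then show ?thesis by (simp add: algebra_simps)
  qed
  then show "(\<lambda>x. a * f x + b * g x) \<in> D"
    using fg by (auto simp: domain_eq_kernel)
qed

text \<open>The two weights multiply to sqrt (x_j y_j) z_j, and z_j shifts the measure from \<alpha>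
  to \<gamma>; the one-dimensional identity then applies in every coordinate.\<close>

lemma kernel_Chapman_Kolmogorov:
  assumes s: "s > 0" and t: "t > 0" and x: "x \<in> pos_orthant" and y: "y \<in> pos_orthant"
  shows "(\<integral>\<^sup>+z. ennreal (K s x z * K t z y) \<partial>M) = ennreal (K (s + t) x y)"
proof -
  let ?q = "exp (- s)" and ?r = "exp (- t)"
  have q: "0 < ?q" "?q < 1" "0 < ?r" "?r < 1" using s t by auto
  have xi: "x $ i > 0" and yi: "y $ i > 0" for i using x y by (auto simp: pos_orthant_def)
  let ?C = "exp (- (s + t)) * sqrt (x $ j * y $ j)"
  let ?k = "\<lambda>i u. laguerre_kernel1 (\<gamma> $ i) ?q (x $ i) u * laguerre_kernel1 (\<gamma> $ i) ?r u (y $ i)"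
  define F where "F i u = (if i = j then ennreal u else 1) * ennreal (?k i u)" for i u
  have Fm[measurable]: "F i \<in> borel_measurable borel" for i
    unfolding F_def by (cases "i = j") (simp_all, measurable)
  note ident_measurable_laguerre_measure[measurable]
  have "(\<integral>\<^sup>+z. ennreal (K s x z * K t z y) \<partial>M) = (\<integral>\<^sup>+z. ennreal ?C * (\<Prod>i\<in>UNIV. F i (z $ i)) \<partial>M)"
  proof (rule nn_integral_cong)
    fix z assume "z \<in> space M"
    then have z: "z \<in> pos_orthant" by simp
    then have zi: "z $ i > 0" for i by (simp add: pos_orthant_def)
    have nn: "0 \<le> ?k i (z $ i)" for i
      using kernel_factor_nonneg[OF s x z, of i] kernel_factor_nonneg[OF t z y, of i] by simp
    have "(\<Prod>i\<in>UNIV. F i (z $ i)) = (\<Prod>i\<in>UNIV. ennreal ((if i = j then z $ i else 1) * ?k i (z $ i)))"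
      unfolding F_def using zi nn by (intro prod.cong refl) (auto simp: ennreal_mult less_imp_le)
    also have "\<dots> = ennreal (\<Prod>i\<in>UNIV. (if i = j then z $ i else 1) * ?k i (z $ i))"
      using zi nn by (intro prod_ennreal) (auto simp: less_imp_le)
    also have "(\<Prod>i\<in>UNIV. (if i = j then z $ i else 1) * ?k i (z $ i)) = z $ j * (laguerre_kernel \<gamma> s x z * laguerre_kernel \<gamma> t z y)"
      using s t x y z by (simp add: prod.distrib laguerre_kernel_eq_prod[OF gamma_gt])
    finally have P: "(\<Prod>i\<in>UNIV. F i (z $ i)) = ennreal (z $ j * (laguerre_kernel \<gamma> s x z * laguerre_kernel \<gamma> t z y))" .
    have e1: "sqrt (x $ j * z $ j) * sqrt (z $ j * y $ j) = sqrt (x $ j * y $ j) * z $ j"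
      using zi[of j] by (simp add: real_sqrt_mult)
    have e2: "exp (- (s + t)) = exp (- s) * exp (- t)" by (simp add: mult_exp_exp)
    have "a * (b * c) * (d * (e * f)) = a * d * ((b * e) * (c * f))" for a b c d e f :: real
      by (simp add: mult_ac)
    then have "K s x z * K t z y = exp (- s) * exp (- t) * ((sqrt (x $ j * z $ j) * sqrt (z $ j * y $ j)) * (laguerre_kernel \<gamma> s x z * laguerre_kernel \<gamma> t z y))"
      unfolding K_def .
    also have "\<dots> = ?C * (z $ j * (laguerre_kernel \<gamma> s x z * laguerre_kernel \<gamma> t z y))"
      unfolding e1 e2 by (simp only: mult.assoc)
    finally have "K s x z * K t z y = ?C * (z $ j * (laguerre_kernel \<gamma> s x z * laguerre_kernel \<gamma> t z y))" .
    then show "ennreal (K s x z * K t z y) = ennreal ?C * (\<Prod>i\<in>UNIV. F i (z $ i))"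
      unfolding P using xi[of j] yi[of j] by (simp only:) (intro ennreal_mult', simp)
  qed
  also have "\<dots> = ennreal ?C * (\<Prod>i\<in>UNIV. \<integral>\<^sup>+u. F i u \<partial>gamma_measure (\<alpha> $ i))"
    by (subst nn_integral_cmult) (auto simp: nn_integral_laguerre_measure_prod[OF Fm])
  also have "(\<Prod>i\<in>UNIV. \<integral>\<^sup>+u. F i u \<partial>gamma_measure (\<alpha> $ i)) = (\<Prod>i\<in>UNIV. ennreal (laguerre_kernel1 (\<gamma> $ i) (exp (- (s + t))) (x $ i) (y $ i)))"
  proof (intro prod.cong refl)
    fix i
    have "(\<integral>\<^sup>+u. F i u \<partial>gamma_measure (\<alpha> $ i)) = (\<integral>\<^sup>+u. ennreal (?k i u) \<partial>gamma_measure (\<gamma> $ i))"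
      unfolding F_def by (cases "i = j") (auto simp: gamma_nth nn_integral_gamma_measure_Suc)
    also have "\<dots> = ennreal (laguerre_kernel1 (\<gamma> $ i) (?q * ?r) (x $ i) (y $ i))"
      by (rule laguerre_kernel1_Chapman_Kolmogorov[OF gamma_gt q xi yi])
    also have "?q * ?r = exp (- (s + t))" by (simp add: mult_exp_exp)
    finally show "(\<integral>\<^sup>+u. F i u \<partial>gamma_measure (\<alpha> $ i)) = ennreal (laguerre_kernel1 (\<gamma> $ i) (exp (- (s + t))) (x $ i) (y $ i))" .
  qed
  also have "\<dots> = ennreal (laguerre_kernel \<gamma> (s + t) x y)"
    using s t x y kernel_factor_nonneg[of "s + t", OF _ x y]
    by (subst prod_ennreal) (auto simp: laguerre_kernel_eq_prod[OF gamma_gt])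
  also have "ennreal ?C * ennreal (laguerre_kernel \<gamma> (s + t) x y) = ennreal (K (s + t) x y)"
    unfolding K_def using xi[of j] yi[of j] by (subst ennreal_mult'[symmetric]) (auto simp: mult.assoc)
  finally show ?thesis .
qed

lemma nn_integral_shifted:
  assumes "f \<in> borel_measurable M"
  shows "(\<integral>\<^sup>+x. f x \<partial>laguerre_measure \<gamma>) = (\<integral>\<^sup>+x. ennreal (x $ j) * f x \<partial>M)"
  unfolding \<gamma>_def laguerre_measure_add_axis using assms ident_measurable_laguerre_measure[of \<alpha>]
  by (subst nn_integral_density) auto

text \<open>The map \<open>f \<mapsto> f / sqrt y\<^sub>j\<close> is unitary from \<open>L\<^sup>2(m\<^sub>\<alpha>)\<close> onto \<open>L\<^sup>2(m\<^sub>\<gamma>)\<close> and conjugates the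
  semigroup into \<open>exp (-t)\<close> times the Markovian one with parameter \<open>\<gamma>\<close>.\<close>

lemma semigroup_strongly_continuous:
  assumes f: "f \<in> Lp M 2"
  shows "((\<lambda>t. Lp_norm M 2 (\<lambda>x. T t f x - f x)) \<longlongrightarrow> 0) (at_right 0)"
proof (rule tendsto_Lp_norm_2_zero)
  let ?M' = "laguerre_measure \<gamma>"
  note ident_measurable_laguerre_measure[measurable]
  interpret g: markov_kernel_family ?M' "laguerre_kernel \<gamma>"
    by (rule markov_kernel_family_laguerre[OF gamma_gt])
  have fm[measurable]: "f \<in> borel_measurable M" and fin: "(\<integral>\<^sup>+x. ennreal ((f x)\<^sup>2) \<partial>M) < \<infinity>"
    using f by (auto simp: mem_Lp_2_iff)
  have sets_eq: "sets ?M' = sets M" by (simp add: sets_laguerre_measure)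
  define h where "h x = f x / sqrt (x $ j)" for x
  have hm[measurable]: "h \<in> borel_measurable M" unfolding h_def by measurable
  have hm': "h \<in> borel_measurable ?M'" using hm by (simp add: measurable_cong_sets[OF sets_eq refl])
  have fh: "f x = sqrt (x $ j) * h x" if "x \<in> pos_orthant" for x
    using that by (auto simp: h_def pos_orthant_def less_imp_neq[symmetric])
  have h2: "(\<integral>\<^sup>+x. ennreal ((h x)\<^sup>2) \<partial>?M') = (\<integral>\<^sup>+x. ennreal ((f x)\<^sup>2) \<partial>M)"
    by (subst nn_integral_shifted)
      (auto intro!: nn_integral_cong simp: fh power_mult_distrib ennreal_mult' pos_orthant_def less_imp_le)
  have fD: "integrable M (\<lambda>y. K t x y * f y)" if "t > 0" "x \<in> pos_orthant" for t x
    using Lp_subset_domain[OF f] that by (auto simp: domain_eq_kernel)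
  define S where "S t x = (LINT y|?M'. laguerre_kernel \<gamma> t x y * h y)" for t x
  let ?N = "\<lambda>t. \<integral>\<^sup>+x. ennreal ((S t x - h x)\<^sup>2) \<partial>?M'"
  have rowm: "laguerre_kernel \<gamma> t x \<in> borel_measurable M" if "t > 0" "x \<in> pos_orthant" for t x
  proof -
    interpret k: symmetric_kernel ?M' "laguerre_kernel \<gamma> t" 1 by (rule g.kernel[OF that(1)])
    show ?thesis using k.kernel_measurable_row[of x] that(2) by (simp add: measurable_cong_sets[OF sets_eq refl])
  qed
  \<comment> \<open>One factor sqrt y_j belongs to \<open>K\<close>, the other to f = sqrt y_j h;
    together they are the density of the shifted measure.\<close>
  have cK: "y $ j * (laguerre_kernel \<gamma> t x y * h y) * (exp (- t) * sqrt (x $ j)) = K t x y * f y"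
    if "x \<in> pos_orthant" "y \<in> pos_orthant" for t x y
  proof -
    have "y $ j > 0" using that by (simp add: pos_orthant_def)
    then have "y $ j * (laguerre_kernel \<gamma> t x y * h y) * (exp (- t) * sqrt (x $ j))
      = sqrt (y $ j) * sqrt (y $ j) * (laguerre_kernel \<gamma> t x y * h y) * (exp (- t) * sqrt (x $ j))"
      by simp
    also have "\<dots> = exp (- t) * (sqrt (x $ j) * sqrt (y $ j) * laguerre_kernel \<gamma> t x y) * (sqrt (y $ j) * h y)"
      by (simp only: mult_ac)
    finally show ?thesis
      unfolding K_def fh[OF that(2)] real_sqrt_mult .
  qed
  have nnj: "AE y in M. 0 \<le> y $ j" by (rule AE_I2) (auto simp: pos_orthant_def less_imp_le)
  have int: "integrable ?M' (\<lambda>y. laguerre_kernel \<gamma> t x y * h y)" if t: "t > 0" and x: "x \<in> pos_orthant" for t x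
  proof -
    note rowm[OF t x, measurable]
    have c: "exp (- t) * sqrt (x $ j) \<noteq> 0" using x by (auto simp: pos_orthant_def less_imp_neq[symmetric])
    have "integrable M (\<lambda>y. y $ j * (laguerre_kernel \<gamma> t x y * h y) * (exp (- t) * sqrt (x $ j)))"
      using fD[OF t x] x cK by (subst Bochner_Integration.integrable_cong[OF refl]) auto
    then have "integrable M (\<lambda>y. y $ j * (laguerre_kernel \<gamma> t x y * h y))"
      using c by simp
    then show ?thesis
      unfolding \<gamma>_def[symmetric] laguerre_measure_add_axis[of \<alpha> j, folded \<gamma>_def]
      by (subst integrable_density) (use nnj in auto)
  qed
  have TS: "T t f x = sqrt (x $ j) * (exp (- t) * S t x)"
    if t: "t > 0" and x: "x \<in> pos_orthant" for t x
  proof -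
    note rowm[OF t x, measurable]
    have "S t x = (LINT y|M. y $ j * (laguerre_kernel \<gamma> t x y * h y))"
      unfolding S_def laguerre_measure_add_axis[of \<alpha> j, folded \<gamma>_def]
      by (subst integral_density) (use nnj in auto)
    then have "sqrt (x $ j) * (exp (- t) * S t x) = (LINT y|M. y $ j * (laguerre_kernel \<gamma> t x y * h y)) * (exp (- t) * sqrt (x $ j))"
      by (simp only: mult_ac)
    also have "\<dots> = (LINT y|M. y $ j * (laguerre_kernel \<gamma> t x y * h y) * (exp (- t) * sqrt (x $ j)))"
      by (rule integral_mult_left_zero[symmetric])
    also have "\<dots> = (LINT y|M. K t x y * f y)"
      using x cK by (intro Bochner_Integration.integral_cong refl) auto
    finally show ?thesis using t by (simp add: semigroup_eq_kernel)
  qed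
  show "((\<lambda>t. \<integral>\<^sup>+x. ennreal ((T t f x - f x)\<^sup>2) \<partial>M) \<longlongrightarrow> 0) (at_right 0)"
  proof (rule tendsto_ennreal_zero_le)
    let ?A = "\<integral>\<^sup>+x. ennreal ((f x)\<^sup>2) \<partial>M"
    have "((\<lambda>t. \<integral>\<^sup>+x. ennreal ((S t x - h x)\<^sup>2) \<partial>?M') \<longlongrightarrow> 0) (at_right 0)"
      unfolding S_def using hm' fin h2 int by (intro g.L2_continuity) auto
    moreover have "((\<lambda>t. ennreal (2 * (1 - exp (- t))\<^sup>2)) \<longlongrightarrow> ennreal (2 * (1 - exp (- 0))\<^sup>2)) (at_right 0)"
      by (intro tendsto_ennrealI tendsto_intros)
    ultimately have "((\<lambda>t. 2 * ?N t + ?A * ennreal (2 * (1 - exp (- t))\<^sup>2)) \<longlongrightarrow> 2 * 0 + ?A * 0) (at_right 0)"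
      using fin by (intro tendsto_add ennreal_tendsto_cmult) auto
    then show "((\<lambda>t. 2 * ?N t + ?A * ennreal (2 * (1 - exp (- t))\<^sup>2)) \<longlongrightarrow> 0) (at_right 0)"
      by simp
    show "eventually (\<lambda>t. (\<integral>\<^sup>+x. ennreal ((T t f x - f x)\<^sup>2) \<partial>M)
      \<le> 2 * ?N t + ?A * ennreal (2 * (1 - exp (- t))\<^sup>2)) (at_right 0)"
      using eventually_at_right_less[of 0]
    proof eventually_elim
      fix t :: real assume t: "0 < t"
      interpret k: symmetric_kernel ?M' "laguerre_kernel \<gamma> t" 1 by (rule g.kernel[OF t])
      have Sm': "S t \<in> borel_measurable ?M'"
        using k.op_measurable[OF hm'] by (simp add: k.op_def[abs_def] S_def[abs_def])
      then have Sm[measurable]: "S t \<in> borel_measurable M" by (simp add: measurable_cong_sets[OF sets_eq refl])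
      have "(\<integral>\<^sup>+x. ennreal ((T t f x - f x)\<^sup>2) \<partial>M)
        = (\<integral>\<^sup>+x. ennreal (x $ j) * ennreal ((exp (- t) * S t x - h x)\<^sup>2) \<partial>M)"
      proof (rule nn_integral_cong)
        fix x assume "x \<in> space M"
        then have x: "x \<in> pos_orthant" by simp
        then have xj: "x $ j > 0" by (simp add: pos_orthant_def)
        have "T t f x - f x = sqrt (x $ j) * (exp (- t) * S t x - h x)"
          unfolding TS[OF t x] fh[OF x] by (simp add: right_diff_distrib)
        then show "ennreal ((T t f x - f x)\<^sup>2) = ennreal (x $ j) * ennreal ((exp (- t) * S t x - h x)\<^sup>2)"
          using xj by (simp add: power_mult_distrib ennreal_mult')
      qed
      also have "\<dots> = (\<integral>\<^sup>+x. ennreal ((exp (- t) * S t x - h x)\<^sup>2) \<partial>?M')"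
        by (subst nn_integral_shifted) auto
      also have "\<dots> \<le> (\<integral>\<^sup>+x. ennreal 2 * ennreal ((S t x - h x)\<^sup>2) + ennreal (2 * (1 - exp (- t))\<^sup>2) * ennreal ((h x)\<^sup>2) \<partial>?M')"
      proof (intro nn_integral_mono ennreal_le_linear_combination)
        fix x
        have e: "(exp (- t))\<^sup>2 \<le> 1" using t by (simp add: power_le_one)
        \<comment> \<open>Separates the error of the Markovian semigroup from the defect caused by
          the scalar exp (-t).\<close>
        have "exp (- t) * S t x - h x = exp (- t) * (S t x - h x) - (1 - exp (- t)) * h x"
          by (simp add: algebra_simps)
        also have "\<dots>\<^sup>2 \<le> 2 * (exp (- t) * (S t x - h x))\<^sup>2 + 2 * ((1 - exp (- t)) * h x)\<^sup>2"
          using zero_le_power2[of "exp (- t) * (S t x - h x) + (1 - exp (- t)) * h x"]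
          by (simp only: power2_sum power2_diff)
        also have "\<dots> \<le> 2 * (S t x - h x)\<^sup>2 + 2 * (1 - exp (- t))\<^sup>2 * (h x)\<^sup>2"
          using mult_right_mono[OF e zero_le_power2[of "S t x - h x"]] by (simp add: power_mult_distrib)
        finally show "(exp (- t) * S t x - h x)\<^sup>2 \<le> 2 * (S t x - h x)\<^sup>2 + 2 * (1 - exp (- t))\<^sup>2 * (h x)\<^sup>2" .
      qed auto
      also have "\<dots> = ennreal 2 * ?N t + ennreal (2 * (1 - exp (- t))\<^sup>2) * (\<integral>\<^sup>+x. ennreal ((h x)\<^sup>2) \<partial>?M')"
        using Sm' hm' by (simp only: nn_integral_add nn_integral_cmult borel_measurable_times_ennreal borel_measurable_const
            measurable_compose[OF _ measurable_ennreal] borel_measurable_power borel_measurable_diff)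
      finally show "(\<integral>\<^sup>+x. ennreal ((T t f x - f x)\<^sup>2) \<partial>M)
        \<le> 2 * ?N t + ?A * ennreal (2 * (1 - exp (- t))\<^sup>2)"
        unfolding h2 by (simp add: mult.commute)
    qed
  qed
qed


section \<open>Verification of the semigroup axioms and the two negative statements\<close>

lemma semigroup_0: "T 0 = (\<lambda>f. f)"
  by (auto simp: modified_laguerre_semigroup_def)

lemma linear_operator_0: "linear_operator M D (T 0)"
  using operator_domain_modified_laguerre
  by (auto simp: semigroup_0 linear_operator_def operator_domain_def)

lemma op_norm_0_le: "op_norm M D p (T 0) \<le> 1"
  using linear_operator_0 by (auto simp: semigroup_0 op_norm_def intro!: SUP_least)

lemma symmetric_kernel_exists:
  assumes "t > 0"
  obtains c where "symmetric_kernel M (K t) c"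
proof -
  obtain c where "c > 1" "\<And>\<mu>. \<mu> > 0 \<Longrightarrow> ennreal (sqrt (\<mu> / pi)) * half_mass (\<gamma> $ j) \<mu> \<le> ennreal c"
    using half_mass_bounded[OF gamma_j] by blast
  then show ?thesis
    using assms by (intro that[of "c * exp (- t / 2)"] symmetric_kernel_K) auto
qed

lemma semigroup_eq_op:
  assumes "symmetric_kernel M (K t) c" "t > 0"
  shows "T t = symmetric_kernel.op M (K t)"
  by (intro ext) (simp add: semigroup_eq_kernel assms symmetric_kernel.op_def[OF assms(1)])

lemma linear_operator_semigroup:
  assumes "t \<ge> 0"
  shows "linear_operator M D (T t)"
proof (cases "t = 0")
  case True
  then show ?thesis by (simp add: linear_operator_0)
next
  case False
  then have t: "t > 0" using assms by simp
  obtain c where c: "symmetric_kernel M (K t) c" by (rule symmetric_kernel_exists[OF t])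
  show ?thesis
    unfolding semigroup_eq_op[OF c t] using t
    by (intro symmetric_kernel.linear_operator_op[OF c] operator_domain_modified_laguerre) (auto simp: domain_eq_kernel)
qed

lemma op_norm_semigroup_le:
  assumes t: "t > 0" and p: "p \<ge> 1" and c: "c > 0"
    and bound: "\<And>\<mu>. \<mu> > 0 \<Longrightarrow> ennreal (sqrt (\<mu> / pi)) * half_mass (\<gamma> $ j) \<mu> \<le> ennreal c"
  shows "op_norm M D p (T t) \<le> ennreal (c * exp (- t / 2))"
proof -
  have k: "symmetric_kernel M (K t) (c * exp (- t / 2))"
    by (rule symmetric_kernel_K[OF t c bound])
  show ?thesis
    using symmetric_kernel.op_norm_op_le[OF k _ p, of D] linear_operator_semigroup[of t] t
    by (simp add: semigroup_eq_op[OF k t])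
qed

lemma semigroup_property:
  assumes f: "f \<in> Lp M p" and p: "p \<ge> 1" and s: "s \<ge> 0" and t: "t \<ge> 0"
  shows "AE x in M. T (s + t) f x = T s (T t f) x"
proof (cases "s = 0 \<or> t = 0")
  case True
  then show ?thesis by (auto simp: semigroup_0)
next
  case False
  then have st: "s > 0" "t > 0" "s + t > 0" using s t by auto
  obtain c1 where k1: "symmetric_kernel M (K s) c1" by (rule symmetric_kernel_exists[OF st(1)])
  obtain c2 where k2: "symmetric_kernel M (K t) c2" by (rule symmetric_kernel_exists[OF st(2)])
  have fD: "f \<in> D" by (rule Lp_subset_domain[OF f p])
  show ?thesis
  proof (rule AE_I2)
    fix x assume x: "x \<in> space M"
    have "(LINT y|M. K (s + t) x y * f y) = (LINT z|M. K s x z * (LINT y|M. K t z y * f y))"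
      using x st fD
      by (intro kernel_composition[OF k1 k2]) (auto simp: kernel_Chapman_Kolmogorov kernel_nonneg domain_eq_kernel)
    then show "T (s + t) f x = T s (T t f) x"
      using st by (simp add: semigroup_eq_kernel)
  qed
qed

lemma semigroup_selfadjoint:
  assumes f: "f \<in> Lp M 2" and g: "g \<in> Lp M 2" and t: "t \<ge> 0"
  shows "(LINT x|M. T t f x * g x) = (LINT x|M. f x * T t g x)"
proof (cases "t = 0")
  case True
  then show ?thesis by (simp add: semigroup_0)
next
  case False
  then have t: "t > 0" using t by simp
  obtain c where c: "symmetric_kernel M (K t) c" by (rule symmetric_kernel_exists[OF t])
  show ?thesis
    unfolding semigroup_eq_op[OF c t] by (rule symmetric_kernel.op_selfadjoint[OF c f g])
qed

lemma positive_operators_semigroup: "positive_operators M D T"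
  unfolding positive_operators_def
proof (intro allI impI ballI)
  fix t :: real and f assume t: "t \<ge> 0" and f: "f \<in> D" "AE x in M. 0 \<le> f x"
  show "AE x in M. 0 \<le> T t f x"
  proof (cases "t = 0")
    case True
    then show ?thesis using f by (simp add: semigroup_0)
  next
    case False
    then have t: "t > 0" using t by simp
    obtain c where c: "symmetric_kernel M (K t) c" by (rule symmetric_kernel_exists[OF t])
    show ?thesis
      unfolding semigroup_eq_op[OF c t]
      by (rule AE_I2) (rule symmetric_kernel.op_nonneg[OF c f(2)])
  qed
qed

lemma half_mass_bound_1:
  assumes "\<alpha> $ j \<ge> - 1 / 2" "\<mu> > 0"
  shows "ennreal (sqrt (\<mu> / pi)) * half_mass (\<gamma> $ j) \<mu> \<le> ennreal 1"
  using half_mass_le_1[of "\<gamma> $ j" \<mu>] assms by (simp add: gamma_nth)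

lemma symmetric_diffusion_semigroup_modified_laguerre:
  assumes aj: "\<alpha> $ j \<ge> - 1 / 2"
  shows "symmetric_diffusion_semigroup M D T"
  unfolding symmetric_diffusion_semigroup_def
proof (intro conjI allI impI ballI)
  show "sigma_finite_measure M" by (rule sigma_finite_laguerre_measure)
  show "linear_operator M D (T t)" if "t \<ge> 0" for t using that by (rule linear_operator_semigroup)
  show "AE x in M. T 0 f x = f x" if "f \<in> D" for f by (simp add: semigroup_0)
  show "op_norm M D p (T t) \<le> 1" if "p \<ge> 1" "t \<ge> 0" for p t
  proof (cases "t = 0")
    case True
    then show ?thesis by (simp add: op_norm_0_le)
  next
    case False
    then have t: "t > 0" using that by simp
    have "op_norm M D p (T t) \<le> ennreal (1 * exp (- t / 2))"
      by (rule op_norm_semigroup_le[OF t that(1) _ half_mass_bound_1[OF aj]]) auto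
    also have "\<dots> \<le> 1" using t by simp
    finally show ?thesis .
  qed
  show "AE x in M. T (s + t) f x = T s (T t f) x" if "p \<ge> 1" "f \<in> Lp M p" "s \<ge> 0" "t \<ge> 0" for p f s t
    using that by (intro semigroup_property)
  show "(LINT x|M. T t f x * g x) = (LINT x|M. f x * T t g x)" if "t \<ge> 0" "f \<in> Lp M 2" "g \<in> Lp M 2" for t f g
    using that by (intro semigroup_selfadjoint)
  show "((\<lambda>t. Lp_norm M 2 (\<lambda>x. T t f x - f x)) \<longlongrightarrow> 0) (at_right 0)" if "f \<in> Lp M 2" for f
    using that by (rule semigroup_strongly_continuous)
qed

lemma semigroup_one_le:
  assumes aj: "\<alpha> $ j \<ge> - 1 / 2" and t: "t > 0" and x: "x \<in> pos_orthant"
  shows "T t (\<lambda>_. 1) x \<le> exp (- t / 2)"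
proof -
  have k: "symmetric_kernel M (K t) (1 * exp (- t / 2))"
    by (rule symmetric_kernel_K[OF t _ half_mass_bound_1[OF aj]]) auto
  have "\<bar>symmetric_kernel.op M (K t) (\<lambda>_. 1) x\<bar> \<le> (1 * exp (- t / 2)) * 1"
    using x by (intro symmetric_kernel.op_sup_bound[OF k]) auto
  then show ?thesis
    unfolding semigroup_eq_op[OF k t] by simp
qed

lemma submarkovian:
  assumes aj: "\<alpha> $ j \<ge> - 1 / 2"
  shows "submarkovian_semigroup M D T"
  unfolding submarkovian_semigroup_def
proof (intro conjI allI impI)
  show "symmetric_diffusion_semigroup M D T" by (rule symmetric_diffusion_semigroup_modified_laguerre[OF aj])
  show "positive_operators M D T" by (rule positive_operators_semigroup)
  fix t :: real assume t: "t \<ge> 0"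
  show "AE x in M. T t (\<lambda>_. 1) x \<le> 1"
  proof (cases "t = 0")
    case False
    then have t: "t > 0" using t by simp
    show ?thesis
    proof (rule AE_I2)
      fix x assume "x \<in> space M"
      then have "T t (\<lambda>_. 1) x \<le> exp (- t / 2)"
        by (intro semigroup_one_le[OF aj t]) simp
      also have "\<dots> \<le> 1" using t by simp
      finally show "T t (\<lambda>_. 1) x \<le> 1" .
    qed
  qed (simp add: semigroup_0)
qed

text \<open>The image of 1 at time 1 is at most exp (-1/2) at every point of the orthant, so one
  point where it equals 1 is a contradiction.\<close>

lemma not_markovian:
  assumes aj: "\<alpha> $ j \<ge> - 1 / 2"
  shows "\<not> markovian_semigroup M D T"
proof
  assume "markovian_semigroup M D T"
  then have "AE x in M. T 1 (\<lambda>_. 1) x = 1"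
    by (auto simp: markovian_semigroup_def)
  then obtain x where x: "\<And>i. 1 < x $ i" "T 1 (\<lambda>_. 1) x = 1"
    by (rule AE_laguerre_measureE[of _ _ 1 2]) auto
  have "x \<in> pos_orthant"
    unfolding pos_orthant_def using x(1) by (auto intro: less_trans[OF zero_less_one])
  from semigroup_one_le[OF aj zero_less_one this] x(2) have "1 \<le> exp (- 1 / 2 :: real)" by simp
  then show False by simp
qed

lemma not_contractive:
  assumes aj: "\<alpha> $ j < - 1 / 2"
  shows "\<not> Lp_contractive M T"
proof
  assume contr: "Lp_contractive M T"
  note ident_measurable_laguerre_measure[measurable]
  have "\<gamma> $ j < 1 / 2" using aj by (simp add: gamma_nth)
  then obtain \<mu>\<^sub>0 \<delta> where \<mu>0: "\<mu>\<^sub>0 > 0" and \<delta>: "\<delta> > 0"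
    and big: "\<And>\<mu>. \<mu>\<^sub>0 \<le> \<mu> \<Longrightarrow> \<mu> \<le> 2 * \<mu>\<^sub>0 \<Longrightarrow> ennreal (1 + \<delta>) \<le> ennreal (sqrt (\<mu> / pi)) * half_mass (\<gamma> $ j) \<mu>"
    using half_mass_gt_1 by blast
  \<comment> \<open>With this \<open>t\<close> the row mass exceeds \<open>1\<close> where \<open>x\<^sub>j\<close> lies in an interval. The constant \<open>1\<close> need not
    be in \<open>L\<^sup>2\<close>, so it is truncated near \<open>x\<^sub>j = 0\<close>.\<close>
  define t where "t = ln (1 + \<delta>)"
  have t: "t > 0" using \<delta> by (simp add: t_def)
  define q where "q = exp (- t)"
  have q: "0 < q" "q < 1" using t by (auto simp: q_def)
  obtain c where c: "symmetric_kernel M (K t) c" by (rule symmetric_kernel_exists[OF t])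
  interpret k: symmetric_kernel M "K t" c by (rule c)
  define f where "f n x = (indicator {x :: real ^ 'n. 1 / real (Suc n) \<le> x $ j} x :: real)" for n x
  have fm[measurable]: "f n \<in> borel_measurable M" for n
    unfolding f_def by measurable
  have f2: "f n \<in> Lp M 2" for n
  proof -
    \<comment> \<open>On the support of \<open>f n\<close> one has 1 \<le> (n + 1) x_j, and x_j
      times the measure is the finite shifted one.\<close>
    interpret g: finite_measure "laguerre_measure \<gamma>" by (rule finite_laguerre_measure[OF gamma_gt])
    have "(\<integral>\<^sup>+x. ennreal ((f n x)\<^sup>2) \<partial>M) \<le> (\<integral>\<^sup>+x. ennreal (x $ j) * ennreal (real (Suc n)) \<partial>M)"
    proof (rule nn_integral_mono)
      fix x assume "x \<in> space M"
      then have "x $ j > 0" by (simp add: pos_orthant_def)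
      moreover have "1 \<le> x $ j * real (Suc n)" if "1 / real (Suc n) \<le> x $ j"
        using that by (simp add: divide_le_eq del: of_nat_Suc)
      ultimately have "(f n x)\<^sup>2 \<le> x $ j * real (Suc n)"
        by (auto simp: f_def indicator_def)
      then show "ennreal ((f n x)\<^sup>2) \<le> ennreal (x $ j) * ennreal (real (Suc n))"
        by (subst ennreal_mult''[symmetric]) (auto intro: ennreal_leI)
    qed
    also have "\<dots> = (\<integral>\<^sup>+x. ennreal (real (Suc n)) \<partial>laguerre_measure \<gamma>)"
      by (subst nn_integral_shifted) auto
    also have "\<dots> < \<infinity>"
      by (simp add: ennreal_mult_less_top del: of_nat_Suc) (simp flip: less_top)
    finally show ?thesis by (simp add: mem_Lp_2_iff)
  qed
  have ftop: "Lp_norm M \<infinity> (f n) \<le> 1" for n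
    unfolding Lp_norm_def by (auto intro!: esssup_I simp: f_def indicator_def)
  have "Lp_norm M \<infinity> (T t (f n)) \<le> 1" for n
  proof -
    have "f n \<in> Lp M 2 \<inter> Lp M \<infinity>"
      using f2[of n] ftop[of n] by (auto simp: Lp_def intro: le_less_trans)
    then have "Lp_norm M \<infinity> (T t (f n)) \<le> Lp_norm M \<infinity> (f n)"
      using contr[unfolded Lp_contractive_def, rule_format, of \<infinity> t "f n"] t by simp
    then show ?thesis using ftop by (rule order_trans)
  qed
  then have sup: "esssup M (\<lambda>x. ennreal \<bar>T t (f n) x\<bar>) \<le> 1" for n
    by (simp add: Lp_norm_def)
  have "AE x in M. ennreal \<bar>T t (f n) x\<bar> \<le> 1" for n
    using esssup_AE by (rule eventually_mono) (rule order_trans[OF _ sup])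
  \<comment> \<open>The truncations are indexed by naturals, so one null set serves all of them and
    the limit can be taken at a single x.\<close>
  then have "AE x in M. \<forall>n. ennreal \<bar>T t (f n) x\<bar> \<le> 1"
    by (simp add: AE_all_countable)
  \<comment> \<open>For x_j between u and 2 u, the number q x_j / (1 - q) lies between
    \<open>\<mu>\<^sub>0\<close> and \<open>2 * \<mu>\<^sub>0\<close>.\<close>
  moreover define u where "u = \<mu>\<^sub>0 * (1 - q) / q"
  moreover have u: "0 < u" using \<mu>0 q by (simp add: u_def)
  ultimately obtain x where x: "\<And>i. u < x $ i" "\<And>i. x $ i < 2 * u" and le: "\<And>n. ennreal \<bar>T t (f n) x\<bar> \<le> 1"
    by (elim AE_laguerre_measureE[of _ _ u "2 * u"]) auto
  have xp: "x \<in> pos_orthant"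
    unfolding pos_orthant_def using x(1) u by (auto intro: less_trans)
  define \<mu> where "\<mu> = q * x $ j / (1 - q)"
  have "\<mu>\<^sub>0 \<le> \<mu>" "\<mu> \<le> 2 * \<mu>\<^sub>0"
    using x(1)[of j] x(2)[of j] q by (auto simp: \<mu>_def u_def field_simps)
  then have "ennreal (exp (- t / 2)) * ennreal (1 + \<delta>) \<le> ennreal (exp (- t / 2)) * (ennreal (sqrt (\<mu> / pi)) * half_mass (\<gamma> $ j) \<mu>)"
    by (intro mult_left_mono big) auto
  also have "\<dots> = (\<integral>\<^sup>+y. ennreal (K t x y) \<partial>M)"
    unfolding \<mu>_def q_def by (rule kernel_mass[OF t xp, symmetric])
  \<comment> \<open>The truncations increase to 1 on the orthant: monotone convergence transfers the
    bound 1 from each \<open>T t (f n) x\<close> to the full row mass.\<close>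
  also have "\<dots> = (\<integral>\<^sup>+y. (SUP n. ennreal (K t x y * f n y)) \<partial>M)"
  proof (rule nn_integral_cong)
    fix y assume "y \<in> space M"
    then have y: "y $ j > 0" "y \<in> pos_orthant" by (auto simp: pos_orthant_def)
    obtain n where n: "1 / real (Suc n) < y $ j" using y(1) reals_Archimedean[of "y $ j"] by (auto simp: inverse_eq_divide)
    show "ennreal (K t x y) = (SUP n. ennreal (K t x y * f n y))"
    proof (rule antisym)
      show "ennreal (K t x y) \<le> (SUP n. ennreal (K t x y * f n y))"
        using n by (intro SUP_upper2[of n]) (auto simp: f_def less_imp_le)
      show "(SUP n. ennreal (K t x y * f n y)) \<le> ennreal (K t x y)"
        using kernel_nonneg[OF t xp y(2)] by (intro SUP_least ennreal_leI) (auto simp: f_def indicator_def)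
    qed
  qed
  also have "\<dots> = (SUP n. \<integral>\<^sup>+y. ennreal (K t x y * f n y) \<partial>M)"
  proof (rule nn_integral_monotone_convergence_SUP_AE)
    show "(\<lambda>y. ennreal (K t x y * f n y)) \<in> borel_measurable M" for n
      using k.kernel_measurable_row[of x] xp by simp
    show "AE y in M. ennreal (K t x y * f n y) \<le> ennreal (K t x y * f (Suc n) y)" for n
    proof (rule AE_I2)
      fix y assume "y \<in> space M"
      then have "0 \<le> K t x y" using kernel_nonneg[OF t xp] by simp
      moreover have "1 / real (Suc (Suc n)) \<le> 1 / real (Suc n)" by (simp add: frac_le)
      ultimately show "ennreal (K t x y * f n y) \<le> ennreal (K t x y * f (Suc n) y)"
        by (intro ennreal_leI mult_left_mono) (auto simp: f_def indicator_def simp del: of_nat_Suc)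
    qed
  qed
  also have "\<dots> \<le> 1"
  proof (rule SUP_least)
    fix n
    have int: "integrable M (\<lambda>y. K t x y * f n y)"
      using Lp_subset_domain[OF f2[of n]] t xp by (auto simp: domain_eq_kernel)
    have "(\<integral>\<^sup>+y. ennreal (K t x y * f n y) \<partial>M) = ennreal (T t (f n) x)"
      unfolding semigroup_eq_kernel[OF t] using int kernel_nonneg[OF t xp]
      by (intro nn_integral_eq_integral AE_I2) (auto simp: f_def)
    also have "\<dots> \<le> ennreal \<bar>T t (f n) x\<bar>" by (intro ennreal_leI) simp
    also have "\<dots> \<le> 1" by (rule le)
    finally show "(\<integral>\<^sup>+y. ennreal (K t x y * f n y) \<partial>M) \<le> 1" .
  qed
  finally have "ennreal (exp (- t / 2) * (1 + \<delta>)) \<le> 1"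
    by (subst ennreal_mult') auto
  then have "exp (- t / 2) * (1 + \<delta>) \<le> 1"
    by (simp only: ennreal_le_1)
  \<comment> \<open>The gain exp t exceeds the loss exp (-t/2), leaving exp (t/2) > 1.\<close>
  moreover have "1 + \<delta> = exp t" using \<delta> by (simp add: t_def)
  ultimately have "exp (t / 2) \<le> 1" by (simp add: mult_exp_exp)
  then show False using t by simp
qed

end

theorem proposition2p4:
  fixes \<alpha> :: "real ^ 'n" and j :: 'n
  defines "M \<equiv> laguerre_measure \<alpha>"
    and "D \<equiv> modified_laguerre_domain \<alpha> j"
    and "T \<equiv> modified_laguerre_semigroup \<alpha> j"
  assumes "\<alpha> $ j > - 3 / 2"
    and "\<And>i. i \<noteq> j \<Longrightarrow> \<alpha> $ i > - 1"
  shows "(\<alpha> $ j \<ge> - 1 / 2 \<longrightarrow>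
            submarkovian_semigroup M D T \<and>
            \<not> markovian_semigroup M D T \<and>
            (\<forall>p\<ge>1. \<forall>t>0. op_norm M D p (T t) \<le> ennreal (exp (- t / 2)))) \<and>
         (\<alpha> $ j < - 1 / 2 \<longrightarrow>
            \<not> Lp_contractive M T \<and>
            (\<exists>c>1. \<forall>p\<ge>1. \<forall>t>0. op_norm M D p (T t) \<le> ennreal (c * exp (- t / 2))))"
proof -
  interpret l: modified_laguerre \<alpha> j
    using assms(4,5) by unfold_locales
  have "op_norm M D p (T t) \<le> ennreal (exp (- t / 2))" if "\<alpha> $ j \<ge> - 1 / 2" "p \<ge> 1" "t > 0" for p t
    unfolding M_def D_def T_def
    using l.op_norm_semigroup_le[OF that(3,2) _ l.half_mass_bound_1[OF that(1)]] by simp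
  moreover have "\<exists>c>1. \<forall>p\<ge>1. \<forall>t>0. op_norm M D p (T t) \<le> ennreal (c * exp (- t / 2))"
  proof -
    obtain c where "c > 1" "\<And>\<mu>. \<mu> > 0 \<Longrightarrow> ennreal (sqrt (\<mu> / pi)) * half_mass (l.\<gamma> $ j) \<mu> \<le> ennreal c"
      using half_mass_bounded[OF l.gamma_j] by blast
    then show ?thesis
      unfolding M_def D_def T_def by (intro exI[of _ c] conjI allI impI l.op_norm_semigroup_le) auto
  qed
  ultimately show ?thesis
    using l.submarkovian l.not_markovian l.not_contractive unfolding M_def D_def T_def by blast
qed

end
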